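(* Let $n\ge 1$, let $\lambda$ be a partition of $n$, and let $\lambda'$ be its conjugate. Write the coefficient of the Schur function $s_\lambda$ in $\tilde J_{(n)}^{(\alpha)}(X)$ as $$\langle \tilde{J}_{(n)}^{(\alpha)}(X), s_\lambda\rangle = \sum_{k=0}^{n-1} a_k((n),\lambda) \binom{\alpha + k}{n}.$$ Then $a_k((n),\lambda) = n!\,\mathrm{QYT}_{=k+1}(\lambda')$ for all $0\le k\le n-1$.
   Context: Jack polynomials: over $\mathbb{Q}(\alpha)$, with $\alpha$ an indeterminate, let $\langle p_\lambda,p_\nu\rangle_\alpha=\delta_{\lambda\nu}z_\lambda\alpha^{\ell(\lambda)}$, where $z_\lambda=\prod_i i^{m_i}m_i!$ and $m_i$ is the number of parts of $\lambda$ equal to $i$. The integral form Jack symmetric functions $J_\mu^{(\alpha)}(X)$ are the unique family, indexed by partitions $\mu$, of symmetric functions that are pairwise orthogonal for $\langle\cdot,\cdot\rangle_\alpha$, are triangular (only monomial symmetric functions $m_\lambda$ with $\lambda\le\mu$ in dominance order appear in $J_\mu^{(\alpha)}$), and are normalized so that the coefficient of $m_{1^n}$ in $J_\mu^{(\alpha)}$ is $n!$ where $n=|\mu|$. For $\mu$ a partition of $n$, define $\tilde J_\mu^{(\alpha)}(X)=\alpha^nJ_\mu^{(1/\alpha)}(X)$. The bracket $\langle\cdot,\cdot\rangle$ (without subscript) is the Hall scalar product, for which Schur functions are orthonormal (extended linearly over $\mathbb{Q}(\alpha)$). $\binom{\alpha+k}{n}=(\alpha+k)(\alpha+k-1)\cdots(\alpha+k-n+1)/n!$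 is a polynomial in $\alpha$; the coefficients of $\tilde J_\mu^{(\alpha)}$ in the Schur basis are polynomials in $\alpha$, and the polynomials $\binom{\alpha+k}{n}$, $0\le k\le n-1$, are linearly independent. Quasi-Yamanouchi tableaux: partition diagrams are drawn in French notation (rows left-justified, first row at the bottom). A semistandard Young tableau is a filling of the diagram by positive integers weakly increasing to the right along rows and strictly increasing upwards in columns. An entry $i$ is weakly left of an entry $j$ when $i$ is above, or above and to the left of, $j$. A semistandard Young tableau is quasi-Yamanouchi if, for every $i>1$ that appears in it, the leftmost instance of $i$ is weakly left of some entry equal to $i-1$. $\mathrm{QYT}_{=m}(\mu)$ denotes (the number of) quasi-Yamanouchi tableaux of shape $\mu$ with maximum entry exactly $m$. Equivalently, this is the number of standard Young tableaux of shape $\mu$ with exactly $m-1$ descents, where $i$ is a descent of $T$ if $i+1$ is weakly left of $i$ in $T$. *)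

theory Defs
  imports
    "HOL-Library.Poly_Mapping"
    "HOL-Computational_Algebra.Computational_Algebra"
    "HOL-Computational_Algebra.Field_as_Ring"
begin

section \<open>Formal power series in countably many variables\<close>

text \<open>
  Symmetric functions live in the ring of formal power series in the variables
  $x_0, x_1, x_2, \dots$; a monomial is its finitely supported exponent vector. The type contains
  all formal power series; those that are symmetric and of bounded degree are singled out by the
  predicate \<open>symmetric_function\<close> below.
\<close>

typedef 'a mfps = "UNIV :: ((nat \<Rightarrow>\<^sub>0 nat) \<Rightarrow> 'a) set"
  morphisms mcoeff Abs_mfps ..

lemma mcoeff_Abs_mfps [simp]: "mcoeff (Abs_mfps f) = f"
  by (simp add: Abs_mfps_inverse)

lemma mfps_eqI: "(\<And>m. mcoeff f m = mcoeff g m) \<Longrightarrow> f = g"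
  by (metis ext mcoeff_inject)

definition msplits :: "(nat \<Rightarrow>\<^sub>0 nat) \<Rightarrow> ((nat \<Rightarrow>\<^sub>0 nat) \<times> (nat \<Rightarrow>\<^sub>0 nat)) set" where
  "msplits m = {(a, b). a + b = m}"

lemma in_msplits [simp]: "(a, b) \<in> msplits m \<longleftrightarrow> a + b = m"
  by (simp add: msplits_def)

lemma finite_msplits [simp]: "finite (msplits m)"
proof -
  let ?F = "{f. \<forall>i. (i \<in> Poly_Mapping.keys m \<longrightarrow> f i \<in> {..Max (range (Poly_Mapping.lookup m))}) \<and>
    (i \<notin> Poly_Mapping.keys m \<longrightarrow> f i = (0::nat))}"
  have fin: "finite (range (Poly_Mapping.lookup m))"
  proof -
    have "range (Poly_Mapping.lookup m) \<subseteq> insert 0 (Poly_Mapping.lookup m ` Poly_Mapping.keys m)"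
      by (auto simp: in_keys_iff)
    then show ?thesis by (rule finite_subset) simp
  qed
  have "finite ?F"
    by (rule finite_set_of_finite_funs) simp_all
  moreover have "Poly_Mapping.lookup ` (fst ` msplits m) \<subseteq> ?F"
  proof -
    have "Poly_Mapping.lookup a i \<le> Max (range (Poly_Mapping.lookup m))" "i \<notin> Poly_Mapping.keys m \<Longrightarrow> Poly_Mapping.lookup a i = 0"
      if "a + b = m" for a b i
    proof -
      have "Poly_Mapping.lookup a i \<le> Poly_Mapping.lookup m i" using that by (auto simp: lookup_add)
      also have "\<dots> \<le> Max (range (Poly_Mapping.lookup m))" using fin by simp
      finally show "Poly_Mapping.lookup a i \<le> Max (range (Poly_Mapping.lookup m))" .
      show "Poly_Mapping.lookup a i = 0" if "i \<notin> Poly_Mapping.keys m"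
        using that \<open>Poly_Mapping.lookup a i \<le> Poly_Mapping.lookup m i\<close> by (simp add: in_keys_iff)
    qed
    then show ?thesis by (auto simp: msplits_def)
  qed
  ultimately have "finite (Poly_Mapping.lookup ` (fst ` msplits m))" by (rule finite_subset[rotated])
  then have fin1: "finite (fst ` msplits m)"
    by (rule finite_imageD) (simp add: inj_on_def poly_mapping_eqI)
  have "inj_on fst (msplits m)"
    by (auto simp: inj_on_def msplits_def)
  with fin1 show ?thesis by (rule finite_imageD)
qed

instantiation mfps :: (comm_ring_1) comm_ring_1
begin

definition zero_mfps :: "'a mfps" where "0 = Abs_mfps (\<lambda>_. 0)"
definition one_mfps :: "'a mfps" where "1 = Abs_mfps (\<lambda>m. if m = 0 then 1 else 0)"
definition plus_mfps :: "'a mfps \<Rightarrow> 'a mfps \<Rightarrow> 'a mfps" where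
  "f + g = Abs_mfps (\<lambda>m. mcoeff f m + mcoeff g m)"
definition minus_mfps :: "'a mfps \<Rightarrow> 'a mfps \<Rightarrow> 'a mfps" where
  "f - g = Abs_mfps (\<lambda>m. mcoeff f m - mcoeff g m)"
definition uminus_mfps :: "'a mfps \<Rightarrow> 'a mfps" where
  "- f = Abs_mfps (\<lambda>m. - mcoeff f m)"
definition times_mfps :: "'a mfps \<Rightarrow> 'a mfps \<Rightarrow> 'a mfps" where
  "f * g = Abs_mfps (\<lambda>m. \<Sum>(a, b)\<in>msplits m. mcoeff f a * mcoeff g b)"

instance
proof
  fix f g h :: "'a mfps"
  note defs = zero_mfps_def one_mfps_def plus_mfps_def minus_mfps_def uminus_mfps_def times_mfps_def
  show "f + g + h = f + (g + h)" "f + g = g + f" "0 + f = f" "- f + f = 0" "f - g = f + - g"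
    by (simp_all add: defs algebra_simps mcoeff_inverse)
  show "f * g = g * f"
  proof (rule mfps_eqI)
    fix m
    have "(\<Sum>(a, b)\<in>msplits m. mcoeff f a * mcoeff g b) =
        (\<Sum>(a, b)\<in>msplits m. mcoeff g a * mcoeff f b)"
      by (rule sum.reindex_bij_witness[of _ prod.swap prod.swap])
        (auto simp: ac_simps)
    then show "mcoeff (f * g) m = mcoeff (g * f) m" by (simp add: defs)
  qed
  show "(f + g) * h = f * h + g * h"
    by (rule mfps_eqI) (simp add: defs case_prod_unfold algebra_simps sum.distrib)
  show "1 * f = f"
  proof (rule mfps_eqI)
    fix m
    have "(\<Sum>(a, b)\<in>msplits m. (if a = 0 then 1 else 0) * mcoeff f b) =
        (\<Sum>(a, b)\<in>{(0 :: nat \<Rightarrow>\<^sub>0 nat, m)}. (if a = 0 then 1 else 0) * mcoeff f b)"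
      by (rule sum.mono_neutral_right) (auto split: if_splits)
    then show "mcoeff (1 * f) m = mcoeff f m" by (simp add: defs)
  qed
  show "f * g * h = f * (g * h)"
  proof (rule mfps_eqI)
    fix m
    have "(\<Sum>(d, c)\<in>msplits m. (\<Sum>(a, b)\<in>msplits d. mcoeff f a * mcoeff g b) * mcoeff h c) =
        (\<Sum>((d, c), (a, b))\<in>(SIGMA p:msplits m. msplits (fst p)).
          mcoeff f a * mcoeff g b * mcoeff h c)"
      by (simp add: case_prod_unfold sum_distrib_right sum.Sigma)
    also have "\<dots> = (\<Sum>((a, e), (b, c))\<in>(SIGMA p:msplits m. msplits (snd p)).
          mcoeff f a * (mcoeff g b * mcoeff h c))"
      by (rule sum.reindex_bij_witness[of _ "\<lambda>((a, e), (b, c)). ((a + b, c), (a, b))"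
            "\<lambda>((d, c), (a, b)). ((a, b + c), (b, c))"])
        (auto simp: ac_simps)
    also have "\<dots> = (\<Sum>(a, e)\<in>msplits m. mcoeff f a * (\<Sum>(b, c)\<in>msplits e. mcoeff g b * mcoeff h c))"
      by (simp add: case_prod_unfold sum_distrib_left sum.Sigma)
    finally show "mcoeff (f * g * h) m = mcoeff (f * (g * h)) m" by (simp add: defs)
  qed
  show "(0 :: 'a mfps) \<noteq> 1"
    by (auto simp: defs Abs_mfps_inject fun_eq_iff)
qed

end

definition mscale :: "'a::comm_ring_1 \<Rightarrow> 'a mfps \<Rightarrow> 'a mfps" where
  "mscale c f = Abs_mfps (\<lambda>m. c * mcoeff f m)"

definition map_mfps :: "('a \<Rightarrow> 'b) \<Rightarrow> 'a mfps \<Rightarrow> 'b mfps" where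
  "map_mfps \<phi> f = Abs_mfps (\<lambda>m. \<phi> (mcoeff f m))"

global_interpretation mfps: vector_space "mscale :: 'a::field \<Rightarrow> 'a mfps \<Rightarrow> 'a mfps"
  by unfold_locales
    (simp_all add: mscale_def plus_mfps_def algebra_simps mcoeff_inverse)

definition symmetric_function :: "'a::zero mfps \<Rightarrow> bool" where
  "symmetric_function f \<longleftrightarrow>
     (\<forall>\<pi> m. bij \<pi> \<longrightarrow> mcoeff f (Poly_Mapping.map_key \<pi> m) = mcoeff f m) \<and>
     (\<exists>d. \<forall>m. mcoeff f m \<noteq> 0 \<longrightarrow> (\<Sum>i\<in>Poly_Mapping.keys m. Poly_Mapping.lookup m i) \<le> d)"


section \<open>Partitions\<close>

definition is_partition :: "nat list \<Rightarrow> bool" where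
  "is_partition \<mu> \<longleftrightarrow> sorted_wrt (\<ge>) \<mu> \<and> 0 \<notin> set \<mu>"

definition conjugate :: "nat list \<Rightarrow> nat list" where
  "conjugate \<mu> = map (\<lambda>j. card {i. i < length \<mu> \<and> j < \<mu> ! i}) [0..<(if \<mu> = [] then 0 else hd \<mu>)]"

definition dominated :: "nat list \<Rightarrow> nat list \<Rightarrow> bool" where
  "dominated \<nu> \<mu> \<longleftrightarrow>
     sum_list \<nu> = sum_list \<mu> \<and> (\<forall>k. sum_list (take k \<nu>) \<le> sum_list (take k \<mu>))"

definition zee :: "nat list \<Rightarrow> nat" where
  "zee \<mu> = (\<Prod>i\<in>set \<mu>. i ^ count_list \<mu> i * fact (count_list \<mu> i))"


section \<open>Tableaux\<close>

text \<open>
  Cells are pairs (row, column), both counted from 0, with row 0 at the bottom (French notation).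
  A tableau is extended by 0 outside its diagram, so that tableaux of a given shape are equal iff
  they agree on the diagram.
\<close>

definition diagram :: "nat list \<Rightarrow> (nat \<times> nat) set" where
  "diagram \<mu> = {(r, c). r < length \<mu> \<and> c < \<mu> ! r}"

definition ssyt :: "nat list \<Rightarrow> (nat \<times> nat \<Rightarrow> nat) \<Rightarrow> bool" where
  "ssyt \<mu> T \<longleftrightarrow>
     (\<forall>x. x \<notin> diagram \<mu> \<longrightarrow> T x = 0) \<and>
     (\<forall>x\<in>diagram \<mu>. T x > 0) \<and>
     (\<forall>r c c'. (r, c) \<in> diagram \<mu> \<and> (r, c') \<in> diagram \<mu> \<and> c < c' \<longrightarrow> T (r, c) \<le> T (r, c')) \<and>
     (\<forall>r r' c. (r, c) \<in> diagram \<mu> \<and> (r', c) \<in> diagram \<mu> \<and> r < r' \<longrightarrow> T (r, c) < T (r', c))"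

fun weakly_left :: "nat \<times> nat \<Rightarrow> nat \<times> nat \<Rightarrow> bool" where
  "weakly_left (r, c) (r', c') \<longleftrightarrow> r > r' \<and> c \<le> c'"

text \<open>
  By column strictness there is exactly one leftmost cell \<open>x\<close> carrying a given entry \<open>i\<close> that
  occurs in the tableau.
\<close>

definition quasi_yamanouchi :: "nat list \<Rightarrow> (nat \<times> nat \<Rightarrow> nat) \<Rightarrow> bool" where
  "quasi_yamanouchi \<mu> T \<longleftrightarrow> ssyt \<mu> T \<and>
     (\<forall>i>1. \<forall>x\<in>diagram \<mu>. T x = i \<and> (\<forall>y\<in>diagram \<mu>. T y = i \<longrightarrow> snd x \<le> snd y) \<longrightarrow>
        (\<exists>y\<in>diagram \<mu>. T y = i - 1 \<and> weakly_left x y))"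

definition QYT :: "nat \<Rightarrow> nat list \<Rightarrow> nat" where
  "QYT m \<mu> = card {T. quasi_yamanouchi \<mu> T \<and> m \<in> T ` diagram \<mu> \<and> (\<forall>x\<in>diagram \<mu>. T x \<le> m)}"


section \<open>Bases of the symmetric functions and scalar products\<close>

definition monomial_sym :: "nat list \<Rightarrow> 'a::comm_ring_1 mfps" where
  "monomial_sym \<mu> =
     Abs_mfps (\<lambda>m. if image_mset (Poly_Mapping.lookup m) (mset_set (Poly_Mapping.keys m)) = mset \<mu> then 1 else 0)"

definition power_sum :: "nat \<Rightarrow> 'a::comm_ring_1 mfps" where
  "power_sum k = Abs_mfps (\<lambda>m. if \<exists>i. m = Poly_Mapping.single i k then 1 else 0)"

definition power_sym :: "nat list \<Rightarrow> 'a::comm_ring_1 mfps" where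
  "power_sym \<mu> = prod_list (map power_sum \<mu>)"

text \<open>Tableau entries are positive whereas variables are indexed from 0: entry \<open>i + 1\<close> has weight $x_i$.\<close>

definition schur :: "nat list \<Rightarrow> 'a::comm_ring_1 mfps" where
  "schur \<mu> = Abs_mfps (\<lambda>m. of_nat (card {T. ssyt \<mu> T \<and>
     (\<forall>i. Poly_Mapping.lookup m i = card {x \<in> diagram \<mu>. T x = Suc i})}))"

text \<open>
  \<open>expansion B f \<nu>\<close> is the coefficient of \<open>B \<nu>\<close> when \<open>f\<close> is written in the basis \<open>B\<close>, which is
  indexed by all partitions.
\<close>

definition expansion :: "(nat list \<Rightarrow> 'a::field mfps) \<Rightarrow> 'a mfps \<Rightarrow> nat list \<Rightarrow> 'a" where
  "expansion B f \<nu> = (if is_partition \<nu> then mfps.representation (B ` {\<mu>. is_partition \<mu>}) f (B \<nu>) else 0)"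

definition hall :: "'a::field mfps \<Rightarrow> 'a mfps \<Rightarrow> 'a" where
  "hall f g = (\<Sum>\<nu> | expansion schur f \<nu> \<noteq> 0. expansion schur f \<nu> * expansion schur g \<nu>)"

definition jack_form :: "'a::field \<Rightarrow> 'a mfps \<Rightarrow> 'a mfps \<Rightarrow> 'a" where
  "jack_form a f g = (\<Sum>\<nu> | expansion power_sym f \<nu> \<noteq> 0.
     expansion power_sym f \<nu> * expansion power_sym g \<nu> * (of_nat (zee \<nu>) * a ^ length \<nu>))"


section \<open>Jack symmetric functions\<close>

type_synonym ratfun = "rat poly fract"

definition alpha :: ratfun where
  "alpha = to_fract [:0, 1:]"

text \<open>
  The value of the rational function \<open>q\<close> at \<open>t\<close>. It is only used for \<open>t = 1 / alpha\<close>, which is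
  transcendental over the rationals, so the denominator does not vanish.
\<close>

definition ratfun_subst :: "ratfun \<Rightarrow> ratfun \<Rightarrow> ratfun" where
  "ratfun_subst t q =
     (case quot_of_fract q of (a, b) \<Rightarrow> poly (map_poly of_rat a) t / poly (map_poly of_rat b) t)"

text \<open>
  Classically there is exactly one such family on the partitions (values at other lists are
  irrelevant); a result about the integral form Jack functions is stated for any \<open>J\<close> with
  these properties.
\<close>

definition jack_family :: "(nat list \<Rightarrow> ratfun mfps) \<Rightarrow> bool" where
  "jack_family J \<longleftrightarrow>
     (\<forall>\<mu>. is_partition \<mu> \<longrightarrow> symmetric_function (J \<mu>)) \<and>
     (\<forall>\<mu> \<nu>. is_partition \<mu> \<and> is_partition \<nu> \<and> \<mu> \<noteq> \<nu> \<longrightarrow> jack_form alpha (J \<mu>) (J \<nu>) = 0) \<and>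
     (\<forall>\<mu> \<nu>. is_partition \<mu> \<and> is_partition \<nu> \<and> expansion monomial_sym (J \<mu>) \<nu> \<noteq> 0 \<longrightarrow> dominated \<nu> \<mu>) \<and>
     (\<forall>\<mu>. is_partition \<mu> \<longrightarrow>
        expansion monomial_sym (J \<mu>) (replicate (sum_list \<mu>) 1) = fact (sum_list \<mu>))"

definition jack_tilde :: "(nat list \<Rightarrow> ratfun mfps) \<Rightarrow> nat list \<Rightarrow> ratfun mfps" where
  "jack_tilde J \<mu> = mscale (alpha ^ sum_list \<mu>) (map_mfps (ratfun_subst (1 / alpha)) (J \<mu>))"

end

(*
  In the family J only J_(n) has a monomial x_0^n, and pairing with
    g_n = sum_mu z_mu^(-1) alpha^(-length mu) p_mu
  extracts the coefficient of x_0^n. So g_n is orthogonal to every other J_mu; as alpha > 0 in the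
  ordered field Q(alpha), the form is definite, the J_mu form an orthogonal basis, and J_(n) is a
  multiple of g_n. Hence J~_(n) = n! times the coefficient of t^n in prod_i (1 - x_i t)^(-alpha). For
  alpha = N a positive integer this is h_n in N copies of the variables, which by the Cauchy identity
  is the sum of s_lambda(1^N) s_lambda(x). Standardization gives
    s_lambda(1^N) = sum_T binomial (N + asc T) n
  over standard tableaux T of shape lambda, and transposition turns ascents into descents. Both sides
  are polynomials in N, so N may be replaced by alpha.

  The Cauchy identity is proved by removing the largest letter on either side: adding a horizontal
  strip and removing one commute up to a sum over strip sizes, by a local bijection.
*)

theory Submission
  imports Defs "HOL-Combinatorics.Permutations"
begin


section \<open>Interlacing partitions and the Cauchy identity\<close>

text \<open>Only one side of the Cauchy identity keeps its variables; the other is specialized to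
  \<open>1^N\<close>. Hence each of its \<open>N\<close> letters multiplies the other side by
  \<open>\<Prod>i. 1 / (1 - x_i)\<close>, and the identity reduces to one strip exchange repeated
  \<open>N\<close> times.

  The scalar products are defined by coordinates with respect to infinite families, so the monomial,
  power sum and Schur functions must first be shown independent. In each case one test monomial per
  index gives a triangular matrix of coefficients. Spanning is required only degree by degree, where
  counting partitions suffices.

  The substitution of \<open>1 / alpha\<close> in a rational function is never treated as a ring
  homomorphism: the coefficients of \<open>J [n]\<close> are \<open>n!\<close> times products of
  \<open>(\<Prod>j<k. 1 + j alpha) / k!\<close>, hence values of rational polynomials at
  \<open>alpha\<close>. The factor \<open>n!\<close> is the prescribed coefficient of the squarefree
  monomial, whose coefficient in \<open>row_series (1 / alpha) n\<close> is
  \<open>alpha^(-n)\<close>. The powers of \<open>alpha\<close> cancel after the substitution and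
  leave \<open>n!\<close> times \<open>row_series alpha n\<close>.\<close>

definition cells :: "(nat \<Rightarrow> nat) \<Rightarrow> (nat \<times> nat) set" where
  "cells p = {(r, c). c < p r}"

definition psize :: "(nat \<Rightarrow> nat) \<Rightarrow> nat" where
  "psize p = card (cells p)"

text \<open>Infinite sequences with a zero tail let interlacing be stated row by row without regard
  to lengths, and a strip may open a new row.\<close>

definition partition_funs :: "(nat \<Rightarrow> nat) set" where
  "partition_funs = {p. decseq p \<and> (\<exists>L. \<forall>i\<ge>L. p i = 0)}"

text \<open>Interlacing: the cells of \<open>p\<close> outside \<open>q\<close> form a horizontal
  strip, with at most one cell in each column.\<close>

definition strip :: "(nat \<Rightarrow> nat) \<Rightarrow> (nat \<Rightarrow> nat) \<Rightarrow> bool" where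
  "strip q p \<longleftrightarrow> (\<forall>i. p (Suc i) \<le> q i \<and> q i \<le> p i)"

definition tableau :: "(nat \<times> nat) set \<Rightarrow> (nat \<times> nat \<Rightarrow> nat) \<Rightarrow> bool" where
  "tableau D T \<longleftrightarrow>
     (\<forall>x. x \<notin> D \<longrightarrow> T x = 0) \<and>
     (\<forall>x\<in>D. T x > 0) \<and>
     (\<forall>r c c'. (r, c) \<in> D \<and> (r, c') \<in> D \<and> c < c' \<longrightarrow> T (r, c) \<le> T (r, c')) \<and>
     (\<forall>r r' c. (r, c) \<in> D \<and> (r', c) \<in> D \<and> r < r' \<longrightarrow> T (r, c) < T (r', c))"

text \<open>For the diagram of a partition the cardinality is the value of the Schur polynomial at
  \<open>1^N\<close>.\<close>

definition tableaux :: "nat \<Rightarrow> (nat \<times> nat) set \<Rightarrow> (nat \<times> nat \<Rightarrow> nat) set" where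
  "tableaux N D = {T. tableau D T \<and> (\<forall>x. T x \<le> N)}"

lemma in_cells [simp]: "(r, c) \<in> cells p \<longleftrightarrow> c < p r"
  by (simp add: cells_def)

lemma cells_eq_Sigma: "(\<And>i. i \<ge> L \<Longrightarrow> p i = 0) \<Longrightarrow> cells p = (SIGMA r:{..<L}. {..<p r})"
  by (fastforce simp: not_le[symmetric])

lemma psize_eq_sum: "(\<And>i. i \<ge> L \<Longrightarrow> p i = 0) \<Longrightarrow> psize p = (\<Sum>i<L. p i)"
  by (simp add: psize_def cells_eq_Sigma[of L])

lemma finite_cells:
  assumes "p \<in> partition_funs"
  shows "finite (cells p)"
proof -
  obtain L where "\<forall>i\<ge>L. p i = 0" using assms by (auto simp: partition_funs_def)
  then show ?thesis by (simp add: cells_eq_Sigma[of L])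
qed

lemma strip_partition_funs_iff:
  assumes "strip q p"
  shows "q \<in> partition_funs \<longleftrightarrow> p \<in> partition_funs"
proof -
  have "decseq q" "decseq p"
    using assms by (auto simp: strip_def decseq_Suc_iff intro: order_trans)
  moreover have "\<forall>i\<ge>L. q i = 0" if "\<forall>i\<ge>L. p i = 0" for L
    using assms that by (metis strip_def le_zero_eq)
  moreover have "\<forall>i\<ge>Suc L. p i = 0" if "\<forall>i\<ge>L. q i = 0" for L
    using assms that by (metis strip_def le_zero_eq Suc_le_D Suc_le_mono)
  ultimately show ?thesis unfolding partition_funs_def by blast
qed

lemma strip_cells_subset: "strip q p \<Longrightarrow> cells q \<subseteq> cells p"
  by (auto simp: cells_def strip_def intro: less_le_trans)

lemma strip_psize_le: "strip q p \<Longrightarrow> p \<in> partition_funs \<Longrightarrow> psize q \<le> psize p"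
  unfolding psize_def by (intro card_mono finite_cells strip_cells_subset)

lemma finite_partition_funs_psize_le: "finite {p \<in> partition_funs. psize p \<le> n}"
proof (rule finite_subset)
  show "finite {f. \<forall>i. (i \<in> {..<n} \<longrightarrow> f i \<in> {..n}) \<and> (i \<notin> {..<n} \<longrightarrow> f i = (0::nat))}"
    by (rule finite_set_of_finite_funs) simp_all
  have "p i \<le> n \<and> (i \<ge> n \<longrightarrow> p i = 0)" if "p \<in> partition_funs" "psize p \<le> n" for p i
  proof -
    have "Pair i ` {..<p i} \<subseteq> cells p" by auto
    from card_mono[OF finite_cells[OF that(1)] this] have 1: "p i \<le> psize p"
      by (simp add: psize_def card_image inj_on_def)
    have "i < n" if "p i \<noteq> 0"
    proof -
      have "(\<lambda>j. (j, 0)) ` {..i} \<subseteq> cells p"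
        using \<open>p \<in> _\<close> that by (fastforce simp: partition_funs_def dest: decseqD)
      from card_mono[OF finite_cells[OF \<open>p \<in> _\<close>] this] have "Suc i \<le> psize p"
        by (simp add: psize_def card_image inj_on_def)
      with \<open>psize p \<le> n\<close> show ?thesis by simp
    qed
    with 1 that show ?thesis by force
  qed
  then show "{p \<in> partition_funs. psize p \<le> n} \<subseteq>
      {f. \<forall>i. (i \<in> {..<n} \<longrightarrow> f i \<in> {..n}) \<and> (i \<notin> {..<n} \<longrightarrow> f i = (0::nat))}"
    by (auto simp: not_less)
qed

lemma finite_strips:
  assumes "p \<in> partition_funs"
  shows "finite {q. strip q p}"
  by (rule finite_subset[OF _ finite_partition_funs_psize_le[of "psize p"]])
    (use assms in \<open>auto simp: strip_partition_funs_iff strip_psize_le\<close>)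

text \<open>
  Reflecting every row inside its interlacing interval turns an upper corner \<open>p\<close> of the square with
  sides \<open>a\<close> and \<open>q\<close> into a lower corner \<open>r\<close>; only the excess of the first row of \<open>p\<close> is lost.
\<close>

lemma reflected_psize:
  assumes "a \<in> partition_funs" "q \<in> partition_funs" "strip r a" "strip r q"
    and "p 0 = max (a 0) (q 0) + e"
    and "\<And>i. p (Suc i) + r i = min (a i) (q i) + max (a (Suc i)) (q (Suc i))"
  shows "psize p + psize r = psize a + psize q + e"
proof -
  obtain L1 L2 where "\<forall>i\<ge>L1. a i = 0" "\<forall>i\<ge>L2. q i = 0"
    using assms(1,2) by (auto simp: partition_funs_def)
  then obtain L where L: "\<And>i. i \<ge> L \<Longrightarrow> a i = 0" "\<And>i. i \<ge> L \<Longrightarrow> q i = 0"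
    by (metis max.cobounded1 max.cobounded2 order_trans)
  have rL: "r i = 0" if "i \<ge> L" for i
    using assms(3) L(1)[OF that] by (metis strip_def le_zero_eq)
  have pL: "p i = 0" if "i \<ge> Suc L" for i
    using that assms(6)[of "i - 1"] L[of "i - 1"] L[of i] by (cases i) auto
  \<comment> \<open>The maxima occur shifted by one row. The first row of \<open>p\<close> supplies
    the missing index 0, and index \<open>L\<close> contributes nothing.\<close>
  have *: "(\<Sum>i<L. max (a (Suc i)) (q (Suc i))) + max (a 0) (q 0) = (\<Sum>i<L. max (a i) (q i))"
    using sum.lessThan_Suc_shift[of "\<lambda>i. max (a i) (q i)" L] L[of L]
    by (simp add: sum.lessThan_Suc)
  have "psize p + psize r = (\<Sum>i<Suc L. p i) + (\<Sum>i<L. r i)"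
    using psize_eq_sum[of "Suc L" p] psize_eq_sum[of L r] pL rL by simp
  also have "\<dots> = p 0 + (\<Sum>i<L. p (Suc i) + r i)"
    by (simp add: sum.lessThan_Suc_shift sum.distrib del: sum.lessThan_Suc)
  also have "\<dots> = e + (\<Sum>i<L. min (a i) (q i)) + (\<Sum>i<L. max (a i) (q i))"
    by (simp add: assms(5,6) sum.distrib flip: *)
  also have "\<dots> = e + (\<Sum>i<L. a i + q i)"
  proof -
    have "min (a i) (q i) + max (a i) (q i) = a i + q i" for i by linarith
    then show ?thesis by (simp add: sum.distrib[symmetric] add.assoc)
  qed
  also have "\<dots> = psize a + psize q + e"
    using psize_eq_sum[of L a] psize_eq_sum[of L q] L by (simp add: sum.distrib)
  finally show ?thesis .
qed

text \<open>Row \<open>Suc i\<close> of an upper corner \<open>p\<close> and row \<open>i\<close> of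
  a lower corner \<open>r\<close> range over the same interval, from
  \<open>max (a (Suc i)) (q (Suc i))\<close> to \<open>min (a i) (q i)\<close>; \<open>u i\<close>
  is the sum of its ends, so subtraction from \<open>u i\<close> is the reflection. Row 0 of
  \<open>p\<close> is unbounded above, and its excess \<open>e\<close> over
  \<open>max (a 0) (q 0)\<close> is a free parameter. By \<open>reflected_psize\<close> the size
  \<open>j\<close> of the strip from \<open>a\<close> to \<open>p\<close> is \<open>e\<close> plus
  the size of the strip from \<open>r\<close> to \<open>q\<close>, which gives the lower limit of
  the inner sum.\<close>

lemma strip_exchange:
  fixes f :: "nat \<Rightarrow> nat"
  assumes a: "a \<in> partition_funs" and q: "q \<in> partition_funs"
  shows "(\<Sum>p | strip a p \<and> strip q p \<and> psize p \<le> psize a + w. f (psize p - psize a)) =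
    (\<Sum>r | strip r a \<and> strip r q. \<Sum>j=psize q - psize r..w. f j)"
proof -
  define u where "u i = min (a i) (q i) + max (a (Suc i)) (q (Suc i))" for i
  define up where "up r e = (\<lambda>i. case i of 0 \<Rightarrow> max (a 0) (q 0) + e | Suc i \<Rightarrow> u i - r i)" for r and e :: nat
  define down where "down p = (\<lambda>i. u i - p (Suc i))" for p
  have up_simps: "up r e 0 = max (a 0) (q 0) + e" "up r e (Suc i) = u i - r i" for r e i
    by (simp_all add: up_def)
  have up: "strip a (up r e)" "strip q (up r e)" "down (up r e) = r"
      "psize (up r e) + psize r = psize a + psize q + e"
    if r: "strip r a" "strip r q" for r e
  proof -
    have 1: "r i \<le> min (a i) (q i)" "max (a (Suc i)) (q (Suc i)) \<le> r i" for i
      using r by (auto simp: strip_def)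
    have "up r e (Suc i) \<le> min (a i) (q i) \<and> max (a i) (q i) \<le> up r e i" for i
    proof
      show "up r e (Suc i) \<le> min (a i) (q i)"
        using 1(2)[of i] unfolding up_simps u_def by linarith
      show "max (a i) (q i) \<le> up r e i"
      proof (cases i)
        case (Suc j)
        show ?thesis using 1(1)[of j] unfolding Suc up_simps u_def by linarith
      qed (simp add: up_simps)
    qed
    then show "strip a (up r e)" "strip q (up r e)"
      by (auto simp: strip_def)
    have ru: "r i \<le> u i" for i using 1(1)[of i] unfolding u_def by linarith
    then show "down (up r e) = r"
      by (simp add: down_def up_simps fun_eq_iff)
    show "psize (up r e) + psize r = psize a + psize q + e"
      using ru by (intro reflected_psize a q r) (simp_all add: up_simps u_def)
  qed
  have down: "strip (down p) a" "strip (down p) q" "up (down p) (p 0 - max (a 0) (q 0)) = p"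
      "psize p + psize (down p) = psize a + psize q + (p 0 - max (a 0) (q 0))"
    if p: "strip a p" "strip q p" for p
  proof -
    have 1: "p (Suc i) \<le> min (a i) (q i)" "max (a i) (q i) \<le> p i" for i
      using p by (auto simp: strip_def)
    have "down p i \<le> min (a i) (q i) \<and> max (a (Suc i)) (q (Suc i)) \<le> down p i" for i
      using 1(1)[of i] 1(2)[of "Suc i"] unfolding down_def u_def by linarith
    then show s: "strip (down p) a" "strip (down p) q"
      by (auto simp: strip_def)
    have pu: "p (Suc i) \<le> u i" for i using 1(1)[of i] unfolding u_def by linarith
    then show "up (down p) (p 0 - max (a 0) (q 0)) = p"
      using 1(2)[of 0] by (auto simp: down_def up_def fun_eq_iff split: nat.split)
    show "psize p + psize (down p) = psize a + psize q + (p 0 - max (a 0) (q 0))"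
      using pu 1(2)[of 0] by (intro reflected_psize a q s) (simp_all add: down_def u_def)
  qed
  have le: "psize r \<le> psize q" "psize r \<le> psize a" if "strip r a" "strip r q" for r
    using that a q by (simp_all add: strip_psize_le)
  have "(\<Sum>r | strip r a \<and> strip r q. \<Sum>j=psize q - psize r..w. f j) =
      (\<Sum>(r, j)\<in>(SIGMA r:{r. strip r a \<and> strip r q}. {psize q - psize r..w}). f j)"
    by (rule sum.Sigma) (use finite_strips[OF a] in auto)
  also have "\<dots> = (\<Sum>p | strip a p \<and> strip q p \<and> psize p \<le> psize a + w. f (psize p - psize a))"
  proof (rule sum.reindex_bij_witness[of _
        "\<lambda>p. (down p, psize p - psize a)" "\<lambda>(r, j). up r (j - (psize q - psize r))"])
    fix x assume "x \<in> (SIGMA r:{r. strip r a \<and> strip r q}. {psize q - psize r..w})"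
    then obtain r j where x: "x = (r, j)" "strip r a" "strip r q" "psize q - psize r \<le> j" "j \<le> w"
      by auto
    note u = up[OF x(2,3), of "j - (psize q - psize r)"]
    have sz: "psize (up r (j - (psize q - psize r))) = psize a + j"
      using u(4) x(4) le[OF x(2,3)] by linarith
    show "(\<lambda>p. (down p, psize p - psize a)) ((\<lambda>(r, j). up r (j - (psize q - psize r))) x) = x"
      using u(3) sz x(1) by simp
    show "(\<lambda>(r, j). up r (j - (psize q - psize r))) x \<in> {p. strip a p \<and> strip q p \<and> psize p \<le> psize a + w}"
      using u(1,2) sz x(1,5) by simp
    show "f (psize ((\<lambda>(r, j). up r (j - (psize q - psize r))) x) - psize a) = (\<lambda>(r, j). f j) x"
      using sz x(1) by simp
  next
    fix p assume "p \<in> {p. strip a p \<and> strip q p \<and> psize p \<le> psize a + w}"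
    then have p: "strip a p" "strip q p" "psize p \<le> psize a + w" by auto
    note d = down[OF p(1,2)]
    have "psize a \<le> psize p"
      using strip_psize_le[OF p(1)] a strip_partition_funs_iff[OF p(1)] by simp
    then have sz: "psize p - psize a - (psize q - psize (down p)) = p 0 - max (a 0) (q 0)"
        "psize q - psize (down p) \<le> psize p - psize a"
      using d(4) le[OF d(1,2)] by linarith+
    then show "(\<lambda>(r, j). up r (j - (psize q - psize r))) (down p, psize p - psize a) = p"
      using d(3) by simp
    show "(down p, psize p - psize a) \<in> (SIGMA r:{r. strip r a \<and> strip r q}. {psize q - psize r..w})"
      using d(1,2) sz p(3) by auto
  qed
  finally show ?thesis by simp
qed

section \<open>Removing the largest letter of a tableau\<close>

lemma finite_tableaux:
  assumes "finite D"
  shows "finite (tableaux N D)"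
proof (rule finite_subset)
  show "finite {f. \<forall>i. (i \<in> D \<longrightarrow> f i \<in> {..N}) \<and> (i \<notin> D \<longrightarrow> f i = (0::nat))}"
    by (rule finite_set_of_finite_funs) (simp_all add: assms)
qed (auto simp: tableaux_def tableau_def)

lemma tableaux_0: "tableaux 0 (cells p) = (if p = (\<lambda>_. 0) then {\<lambda>_. 0} else {})"
proof -
  have A: "T = (\<lambda>_. 0) \<and> p = (\<lambda>_. 0)" if "T \<in> tableaux 0 (cells p)" for T
  proof -
    have T: "T = (\<lambda>_. 0)" using that by (auto simp: tableaux_def)
    then have "c \<ge> p r" for r c
      using that in_cells[of r c p] by (auto simp: tableaux_def tableau_def not_less[symmetric])
    then have "p r = 0" for r by (metis le_zero_eq)
    with T show ?thesis by auto
  qed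
  have B: "(\<lambda>_. 0) \<in> tableaux 0 (cells (\<lambda>_. 0))"
    by (simp add: tableaux_def tableau_def)
  show ?thesis
  proof (cases "p = (\<lambda>_. 0)")
    case True
    have "tableaux 0 (cells p) = {\<lambda>_. 0}" using A B unfolding True by blast
    then show ?thesis by (simp add: True)
  next
    case False
    then have "tableaux 0 (cells p) = {}" using A by blast
    then show ?thesis by (simp add: False)
  qed
qed

text \<open>Strict columns force the cells with the largest letter \<open>Suc N\<close> to form a
  horizontal strip, and any strip may be filled with it. The arbitrary statistic \<open>g\<close>
  serves both plain counting and counting with weights.\<close>

lemma sum_tableaux_Suc:
  fixes g :: "(nat \<times> nat \<Rightarrow> nat) \<Rightarrow> nat"
  assumes p: "p \<in> partition_funs"
  shows "(\<Sum>T\<in>tableaux (Suc N) (cells p). g T) =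
    (\<Sum>q | strip q p. \<Sum>T\<in>tableaux N (cells q).
      g (\<lambda>x. if x \<in> cells p - cells q then Suc N else T x))"
proof -
  define F where "F q T = (\<lambda>x. if x \<in> cells p - cells q then Suc N else T x)" for q T
  define Q where "Q T = (\<lambda>r. card {c. c < p r \<and> T (r, c) \<le> N})" for T :: "nat \<times> nat \<Rightarrow> nat"
  define R where "R T = (\<lambda>x. if T x \<le> N then T x else 0)" for T :: "nat \<times> nat \<Rightarrow> nat"
  have dec: "r \<le> r' \<Longrightarrow> p r' \<le> p r" for r r'
    using p by (auto simp: partition_funs_def dest: decseqD)
  have finq: "finite (cells q)" if "strip q p" for q
    using that p by (simp add: finite_cells strip_partition_funs_iff)
  have "(\<Sum>q | strip q p. \<Sum>T\<in>tableaux N (cells q). g (F q T)) =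
      (\<Sum>(q, T)\<in>(SIGMA q:{q. strip q p}. tableaux N (cells q)). g (F q T))"
    by (rule sum.Sigma) (auto intro!: finite_strips p finite_tableaux finq)
  also have "\<dots> = (\<Sum>T\<in>tableaux (Suc N) (cells p). g T)"
  proof (rule sum.reindex_bij_witness[of _ "\<lambda>T. (Q T, R T)" "\<lambda>(q, T). F q T"])
    fix x assume "x \<in> (SIGMA q:{q. strip q p}. tableaux N (cells q))"
    then obtain q T where x: "x = (q, T)" and q: "strip q p" and T: "tableau (cells q) T" "\<And>x. T x \<le> N"
      by (auto simp: tableaux_def)
    have qle: "q r \<le> p r" "p (Suc r) \<le> q r" for r using q by (auto simp: strip_def)
    have T0: "c \<ge> q r \<Longrightarrow> T (r, c) = 0" "c < q r \<Longrightarrow> T (r, c) > 0" for r c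
      using T by (auto simp: tableau_def)
    have Trow: "T (r, c) \<le> T (r, c')" if "c < c'" "c' < q r" for r c c'
      using T(1) that unfolding tableau_def in_cells by (meson less_trans)
    have Tcol: "T (r, c) < T (r', c)" if "r < r'" "c < q r" "c < q r'" for r r' c
      using T(1) that unfolding tableau_def in_cells by blast
    have F: "F q T (r, c) = (if q r \<le> c \<and> c < p r then Suc N else T (r, c))" for r c
      by (auto simp: F_def)
    have col: "F q T (r, c) < F q T (r', c)" if "r < r'" "c < p r'" for r r' c
    proof -
      \<comment> \<open>Interlacing puts every cell below another cell of \<open>p\<close> inside
        \<open>q\<close>, so it keeps an entry of at most \<open>N\<close>.\<close>
      have "p r' \<le> q r" using qle(2)[of r] dec[of "Suc r" r'] that by simp
      then have "F q T (r, c) = T (r, c)" "c < q r" using that by (auto simp: F)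
      then show ?thesis using that Tcol[of r r' c] T(2)[of "(r,c)"] by (auto simp: F not_le le_imp_less_Suc)
    qed
    have "tableau (cells p) (F q T)"
      unfolding tableau_def
    proof (intro conjI allI ballI impI; (elim conjE)?)
      fix x assume "x \<notin> cells p"
      then show "F q T x = 0" using T0(1) qle(1) by (cases x) (auto simp: F not_less intro: order_trans)
    next
      fix x assume "x \<in> cells p"
      then show "F q T x > 0" using T0(2) by (cases x) (auto simp: F not_le)
    next
      fix r c c' assume "(r, c) \<in> cells p" "(r, c') \<in> cells p" "c < c'"
      then show "F q T (r, c) \<le> F q T (r, c')" using Trow[of c c' r] T(2)[of "(r,c)"]
        by (auto simp: F not_le intro: le_SucI)
    next
      fix r r' c assume "(r, c) \<in> cells p" "(r', c) \<in> cells p" "r < r'"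
      then show "F q T (r, c) < F q T (r', c)" using col by auto
    qed
    moreover have "F q T x \<le> Suc N" for x using T(2)[of x] by (auto simp: F_def le_SucI)
    ultimately show "(\<lambda>(q, T). F q T) x \<in> tableaux (Suc N) (cells p)"
      by (simp add: x tableaux_def)
    have "{c. c < p r \<and> F q T (r, c) \<le> N} = {..<q r}" for r
      using qle(1)[of r] T(2) by (auto simp: F split: if_splits)
    then have "Q (F q T) = q" by (simp add: Q_def)
    moreover have "R (F q T) = T"
      using T(2) T0(1) by (auto simp: R_def F fun_eq_iff)
    ultimately show "(Q ((\<lambda>(q, T). F q T) x), R ((\<lambda>(q, T). F q T) x)) = x"
      by (simp add: x)
    show "g ((\<lambda>(q, T). F q T) x) = (case x of (q, T) \<Rightarrow> g (F q T))" by (simp add: x)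
  next
    fix T assume "T \<in> tableaux (Suc N) (cells p)"
    then have T: "tableau (cells p) T" "\<And>x. T x \<le> Suc N" by (auto simp: tableaux_def)
    have T0: "c \<ge> p r \<Longrightarrow> T (r, c) = 0" "c < p r \<Longrightarrow> T (r, c) > 0" for r c
      using T by (auto simp: tableau_def)
    have Trow: "T (r, c) \<le> T (r, c')" if "c \<le> c'" "c' < p r" for r c c'
      using T(1) that unfolding tableau_def in_cells by (metis le_eq_less_or_eq less_trans)
    have Tcol: "T (r, c) < T (r', c)" if "r < r'" "c < p r'" for r r' c
      using T(1) that dec[of r r'] unfolding tableau_def in_cells by (meson less_imp_le less_le_trans)
    \<comment> \<open>Rows increase weakly, so the entries up to \<open>N\<close> fill an initial
      segment of the row.\<close>
    have Q: "{c. c < p r \<and> T (r, c) \<le> N} = {..<Q T r}" for r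
    proof -
      let ?S = "{c. c < p r \<and> T (r, c) \<le> N}"
      have down: "c' \<in> ?S" if "c \<in> ?S" "c' \<le> c" for c c'
        using that Trow[of c' c r] by auto
      have fin: "finite ?S" by simp
      show ?thesis
      proof (cases "?S = {}")
        case False
        have "?S = {..Max ?S}"
          using down[OF Max_in[OF fin False]] Max_ge[OF fin] by blast
        then show ?thesis unfolding Q_def by (metis card_atMost lessThan_Suc_atMost)
      qed (metis Q_def card.empty lessThan_0)
    qed
    have Qle: "Q T r \<le> p r" for r
      using Q[of r] by (metis (no_types, lifting) lessThan_iff mem_Collect_eq not_le order_less_irrefl)
    have inQ: "c < Q T r \<longleftrightarrow> c < p r \<and> T (r, c) \<le> N" for r c
      using Q[of r] by blast
    have "p (Suc r) \<le> Q T r" for r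
    proof -
      have "c < Q T r" if "c < p (Suc r)" for c
        using Tcol[of r "Suc r" c] T(2)[of "(Suc r, c)"] that dec[of r "Suc r"] by (simp add: inQ)
      then show ?thesis using not_le by blast
    qed
    with Qle have strip: "strip (Q T) p" by (simp add: strip_def)
    have "tableau (cells (Q T)) (R T)"
      using T0 Trow Tcol by (auto simp: tableau_def R_def inQ not_less)
    moreover have "R T x \<le> N" for x by (simp add: R_def)
    ultimately show "(Q T, R T) \<in> (SIGMA q:{q. strip q p}. tableaux N (cells q))"
      using strip by (simp add: tableaux_def)
    have "F (Q T) (R T) (r, c) = T (r, c)" for r c
      using T0(1)[of r c] T(2)[of "(r, c)"] by (auto simp: F_def R_def inQ not_le)
    then show "(\<lambda>(q, T). F q T) (Q T, R T) = T" by (auto simp: fun_eq_iff)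
  qed
  finally show ?thesis by (simp add: F_def)
qed

section \<open>Contents counted with iterated tail sums\<close>

text \<open>
  \<open>strip_weight t w\<close> arises from the indicator function of \<open>w\<close> by taking tail sums
  \<open>\<lambda>k. \<Sum>j\<ge>k. f j\<close> \<open>t\<close> times. Moving one removal of a strip past the addition of
  a strip takes one tail sum.
\<close>

definition strip_weight :: "nat \<Rightarrow> nat \<Rightarrow> nat \<Rightarrow> nat" where
  "strip_weight t w k = (if k \<le> w then (t + (w - k) - 1) choose (w - k) else 0)"

text \<open>Truncated subtraction matters here: with \<open>d = w - k\<close> the binomial is
  \<open>(0 - 1) choose 0 = 1\<close> for \<open>d = 0\<close> and
  \<open>(d - 1) choose d = 0\<close> for \<open>d > 0\<close>.\<close>

lemma strip_weight_0: "strip_weight 0 w k = (if k = w then 1 else 0)"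
  by (auto simp: strip_weight_def)

text \<open>The hockey-stick identity, counted from the upper end of the range.\<close>

lemma sum_strip_weight: "(\<Sum>j=k..w. strip_weight t w j) = strip_weight (Suc t) w k"
proof (cases "k \<le> w")
  case True
  have "(\<Sum>i\<le>d. (t + i - 1) choose i) = (t + d) choose d" for d
    by (induction d) simp_all
  from this[of "w - k"] show ?thesis using True
    by (subst sum.reindex_bij_witness[of _ "\<lambda>i. w - i" "\<lambda>i. w - i" "{..w-k}" "\<lambda>i. (t + i - 1) choose i"])
       (auto simp: strip_weight_def)
qed (simp add: strip_weight_def)

text \<open>As \<open>strip_weight t w k\<close> is the coefficient of \<open>x^(w - k)\<close> in
  \<open>(1 - x)^(-t)\<close>, this is the coefficient of \<open>\<Prod>i<N. x_i^(w i)\<close> in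
  the Schur polynomial of \<open>p\<close> times \<open>\<Prod>i<N. (1 - x_i)^(-t)\<close>. At
  \<open>t = 0\<close> it counts the tableaux of content \<open>w\<close>.\<close>

definition weighted_tableaux :: "nat \<Rightarrow> (nat \<Rightarrow> nat) \<Rightarrow> nat \<Rightarrow> (nat \<Rightarrow> nat) \<Rightarrow> nat" where
  "weighted_tableaux t w N p =
     (\<Sum>T\<in>tableaux N (cells p). \<Prod>i<N. strip_weight t (w i) (card {x. T x = Suc i}))"

lemma weighted_tableaux_0: "weighted_tableaux t w 0 p = (if p = (\<lambda>_. 0) then 1 else 0)"
  by (simp add: weighted_tableaux_def tableaux_0)

lemma weighted_tableaux_Suc:
  assumes p: "p \<in> partition_funs"
  shows "weighted_tableaux t w (Suc N) p =
    (\<Sum>q | strip q p. strip_weight t (w N) (psize p - psize q) * weighted_tableaux t w N q)"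
  unfolding weighted_tableaux_def sum_tableaux_Suc[OF p] sum_distrib_left
proof (intro sum.cong refl)
  fix q T assume "q \<in> {q. strip q p}" and "T \<in> tableaux N (cells q)"
  then have q: "strip q p" and T: "tableau (cells q) T" "\<And>x. T x \<le> N" by (auto simp: tableaux_def)
  let ?F = "\<lambda>x. if x \<in> cells p - cells q then Suc N else T x"
  have "T x = 0" if "x \<notin> cells q" for x using T(1) that unfolding tableau_def by blast
  then have "{x. ?F x = Suc i} = {x. T x = Suc i}" if "i < N" for i
    by (intro Collect_cong) (use that in auto)
  moreover have "T x \<noteq> Suc N" for x using T(2)[of x] by auto
  then have "{x. ?F x = Suc N} = cells p - cells q" by auto
  moreover have "card (cells p - cells q) = psize p - psize q"
    using p q unfolding psize_def
    by (intro card_Diff_subset strip_cells_subset finite_cells) (simp_all add: strip_partition_funs_iff)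
  ultimately show "(\<Prod>i<Suc N. strip_weight t (w i) (card {x. ?F x = Suc i})) =
      strip_weight t (w N) (psize p - psize q) * (\<Prod>i<N. strip_weight t (w i) (card {x. T x = Suc i}))"
    by simp
qed

lemma weighted_tableaux_eq_0:
  assumes "p \<in> partition_funs" "psize p > (\<Sum>i<N. w i)"
  shows "weighted_tableaux t w N p = 0"
  using assms
proof (induction N arbitrary: p)
  case 0
  then show ?case by (auto simp: weighted_tableaux_0 psize_def cells_def)
next
  case (Suc N)
  have "strip_weight t (w N) (psize p - psize q) * weighted_tableaux t w N q = 0" if "strip q p" for q
  proof (cases "psize p - psize q \<le> w N")
    case True
    then show ?thesis using Suc that by (simp add: strip_partition_funs_iff)
  qed (simp add: strip_weight_def)
  then show ?case
    unfolding weighted_tableaux_Suc[OF Suc.prems(1)] by (intro sum.neutral ballI) simp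
qed

text \<open>Summing Schur polynomials over all ways to add a strip to \<open>q\<close> multiplies
  that of \<open>q\<close> by \<open>\<Prod>i<N. 1 / (1 - x_i)\<close>. In the induction the largest
  letter of the tableau leads from \<open>p\<close> down to \<open>a\<close>;
  \<open>strip_exchange\<close> replaces the corner \<open>p\<close> above \<open>a\<close> and
  \<open>q\<close> by a corner \<open>r\<close> below them, and the induction hypothesis sums over
  \<open>a\<close>.\<close>

lemma sum_weighted_tableaux_strip:
  assumes "q \<in> partition_funs" "(\<Sum>i<N. w i) \<le> B"
  shows "(\<Sum>p | p \<in> partition_funs \<and> psize p \<le> B \<and> strip q p. weighted_tableaux t w N p) =
    weighted_tableaux (Suc t) w N q"
  using assms
proof (induction N arbitrary: q B)
  case 0
  have "{p \<in> partition_funs. psize p \<le> B \<and> strip q p \<and> p = (\<lambda>_. 0)} =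
      (if q = (\<lambda>_. 0) then {\<lambda>_. 0} else {})"
    by (auto simp: strip_def partition_funs_def psize_def cells_def decseq_def)
  moreover have "(\<Sum>p | p \<in> partition_funs \<and> psize p \<le> B \<and> strip q p. if p = (\<lambda>_. 0) then 1 else 0) =
      (\<Sum>p | p \<in> partition_funs \<and> psize p \<le> B \<and> strip q p \<and> p = (\<lambda>_. 0). 1 :: nat)"
    by (rule sum.mono_neutral_cong_right)
       (auto intro: finite_subset[OF _ finite_partition_funs_psize_le[of B]])
  ultimately show ?case by (simp add: weighted_tableaux_0)
next
  case (Suc N)
  define P where "P B = {p \<in> partition_funs. psize p \<le> B}" for B
  define W where "W = (\<Sum>i<N. w i)"
  have WB: "W + w N \<le> B" using Suc.prems by (simp add: W_def)
  have finP: "finite (P B)" for B unfolding P_def by (rule finite_partition_funs_psize_le)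
  have wt0: "weighted_tableaux t w N a = 0" if "a \<in> partition_funs" "\<not> psize a \<le> W" for a
    using that by (simp add: weighted_tableaux_eq_0 W_def)
  have swt: "strip_weight t (w N) k = 0" if "k > w N" for k using that by (simp add: strip_weight_def)
  have "(\<Sum>p | p \<in> partition_funs \<and> psize p \<le> B \<and> strip q p. weighted_tableaux t w (Suc N) p) =
      (\<Sum>p | p \<in> P B \<and> strip q p. \<Sum>a | strip a p. strip_weight t (w N) (psize p - psize a) * weighted_tableaux t w N a)"
    by (rule sum.cong) (auto simp: P_def weighted_tableaux_Suc)
  \<comment> \<open>Larger \<open>a\<close> contribute 0. The restriction yields an index set
    independent of \<open>p\<close>, as swapping the sums requires.\<close>
  also have "\<dots> = (\<Sum>p | p \<in> P B \<and> strip q p. \<Sum>a | a \<in> P W \<and> strip a p.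
      strip_weight t (w N) (psize p - psize a) * weighted_tableaux t w N a)"
  proof (rule sum.cong[OF refl], rule sum.mono_neutral_right)
    fix p assume p: "p \<in> {p. p \<in> P B \<and> strip q p}"
    then show "finite {a. strip a p}" by (simp add: P_def finite_strips)
    have z: "weighted_tableaux t w N a = 0" if "a \<in> {a. strip a p} - {a. a \<in> P W \<and> strip a p}" for a
      using p that by (intro wt0) (auto simp: P_def strip_partition_funs_iff)
    show "\<forall>a\<in>{a. strip a p} - {a. a \<in> P W \<and> strip a p}.
        strip_weight t (w N) (psize p - psize a) * weighted_tableaux t w N a = 0" using z by (metis mult_0_right)
  qed auto
  also have "\<dots> = (\<Sum>a\<in>P W. \<Sum>p | p \<in> P B \<and> strip q p \<and> strip a p.
      strip_weight t (w N) (psize p - psize a) * weighted_tableaux t w N a)"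
    using finP by (subst sum.swap_restrict[symmetric]) (auto intro!: sum.cong simp: conj_ac)
  also have "\<dots> = (\<Sum>a\<in>P W. weighted_tableaux t w N a *
      (\<Sum>r | strip r a \<and> strip r q. strip_weight (Suc t) (w N) (psize q - psize r)))"
  proof (rule sum.cong[OF refl])
    fix a assume a: "a \<in> P W"
    have fin: "finite {p. p \<in> P B \<and> strip q p \<and> strip a p}" using finP[of B] by simp
    \<comment> \<open>Beyond size \<open>psize a + w N\<close> the weight vanishes, and this size is
      at most \<open>B\<close> because \<open>psize a \<le> W\<close>. So the bound \<open>B\<close>
      can be traded for the one in \<open>strip_exchange\<close>.\<close>
    have "(\<Sum>p | p \<in> P B \<and> strip q p \<and> strip a p. strip_weight t (w N) (psize p - psize a)) =
        (\<Sum>p | strip a p \<and> strip q p \<and> psize p \<le> psize a + w N. strip_weight t (w N) (psize p - psize a))"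
      using a WB Suc.prems(1)
      by (intro sum.mono_neutral_right[OF fin]) (auto simp: P_def strip_partition_funs_iff intro!: swt)
    also have "\<dots> = (\<Sum>r | strip r a \<and> strip r q. strip_weight (Suc t) (w N) (psize q - psize r))"
      using a Suc.prems(1) by (subst strip_exchange) (simp_all add: P_def sum_strip_weight)
    finally show "(\<Sum>p | p \<in> P B \<and> strip q p \<and> strip a p.
        strip_weight t (w N) (psize p - psize a) * weighted_tableaux t w N a) =
        weighted_tableaux t w N a * (\<Sum>r | strip r a \<and> strip r q. strip_weight (Suc t) (w N) (psize q - psize r))"
      unfolding sum_distrib_right[symmetric] by (simp only: mult.commute)
  qed
  also have "\<dots> = (\<Sum>a\<in>P W. \<Sum>r | r \<in> {r. strip r q} \<and> strip r a.
      strip_weight (Suc t) (w N) (psize q - psize r) * weighted_tableaux t w N a)"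
    by (simp add: sum_distrib_left mult.commute conj_commute)
  also have "\<dots> = (\<Sum>r | strip r q. \<Sum>a | a \<in> P W \<and> strip r a.
      strip_weight (Suc t) (w N) (psize q - psize r) * weighted_tableaux t w N a)"
    using finP finite_strips[OF Suc.prems(1)] by (rule sum.swap_restrict)
  also have "\<dots> = (\<Sum>r | strip r q. strip_weight (Suc t) (w N) (psize q - psize r) * weighted_tableaux (Suc t) w N r)"
    using Suc.prems(1)
    by (intro sum.cong refl) (simp add: P_def W_def Suc.IH strip_partition_funs_iff flip: sum_distrib_left)
  also have "\<dots> = weighted_tableaux (Suc t) w (Suc N) q"
    by (simp add: weighted_tableaux_Suc Suc.prems)
  finally show ?case .
qed

text \<open>Each letter removed from the unweighted tableaux is a strip whose sum raises
  \<open>t\<close> by one. After \<open>N\<close> letters only the empty shape is left.\<close>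

lemma cauchy_weighted:
  assumes "(\<Sum>i<M. w i) \<le> B"
  shows "(\<Sum>p | p \<in> partition_funs \<and> psize p \<le> B. card (tableaux N (cells p)) * weighted_tableaux t w M p) =
    weighted_tableaux (t + N) w M (\<lambda>_. 0)"
proof (induction N arbitrary: t)
  case 0
  have "(\<lambda>_. 0) \<in> {p. p \<in> partition_funs \<and> psize p \<le> B}"
    by (auto simp: partition_funs_def psize_def cells_def decseq_def)
  moreover have "card (tableaux 0 (cells p)) * weighted_tableaux t w M p =
      (if p = (\<lambda>_. 0) then weighted_tableaux t w M p else 0)" for p
    by (simp add: tableaux_0)
  ultimately show ?case
    using finite_partition_funs_psize_le[of B] by (simp add: sum.delta)
next
  case (Suc N)
  define P where "P = {p \<in> partition_funs. psize p \<le> B}"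
  have finP: "finite P" unfolding P_def by (rule finite_partition_funs_psize_le)
  have "(\<Sum>p\<in>P. card (tableaux (Suc N) (cells p)) * weighted_tableaux t w M p) =
      (\<Sum>p\<in>P. \<Sum>q | q \<in> P \<and> strip q p. card (tableaux N (cells q)) * weighted_tableaux t w M p)"
  proof (rule sum.cong[OF refl])
    fix p assume p: "p \<in> P"
    then have "{q. q \<in> P \<and> strip q p} = {q. strip q p}"
      by (auto simp: P_def strip_partition_funs_iff dest: strip_psize_le)
    moreover have "card (tableaux (Suc N) (cells p)) = (\<Sum>q | strip q p. card (tableaux N (cells q)))"
      using sum_tableaux_Suc[of p "\<lambda>_. 1" N] p by (simp add: P_def)
    ultimately show "card (tableaux (Suc N) (cells p)) * weighted_tableaux t w M p =
        (\<Sum>q | q \<in> P \<and> strip q p. card (tableaux N (cells q)) * weighted_tableaux t w M p)"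
      by (simp add: sum_distrib_right)
  qed
  also have "\<dots> = (\<Sum>q\<in>P. \<Sum>p | p \<in> P \<and> strip q p. card (tableaux N (cells q)) * weighted_tableaux t w M p)"
    by (rule sum.swap_restrict[OF finP finP])
  also have "\<dots> = (\<Sum>q\<in>P. card (tableaux N (cells q)) * weighted_tableaux (Suc t) w M q)"
    using assms
    by (intro sum.cong refl)
       (simp add: P_def sum_weighted_tableaux_strip conj_assoc flip: sum_distrib_left)
  also have "\<dots> = weighted_tableaux (t + Suc N) w M (\<lambda>_. 0)"
    using Suc[of "Suc t"] by (simp add: P_def)
  finally show ?case by (simp add: P_def)
qed

lemma weighted_tableaux_empty: "weighted_tableaux t w M (\<lambda>_. 0) = (\<Prod>i<M. (t + w i - 1) choose (w i))"
proof -
  have "tableaux M (cells (\<lambda>_. 0)) = {\<lambda>_. 0}"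
    by (auto simp: tableaux_def tableau_def)
  then show ?thesis by (simp add: weighted_tableaux_def strip_weight_def)
qed

text \<open>
  A form of the Cauchy identity for the Schur polynomials
  \<open>s\<^sub>p(1\<^sup>N)\<close> and \<open>s\<^sub>p(x\<^sub>0, \<dots>, x\<^sub>M\<^sub>-\<^sub>1)\<close>.
\<close>

lemma cauchy_tableaux:
  assumes "(\<Sum>i<M. w i) \<le> B"
  shows "(\<Sum>p | p \<in> partition_funs \<and> psize p \<le> B. card (tableaux N (cells p)) *
      card {T \<in> tableaux M (cells p). \<forall>i<M. card {x. T x = Suc i} = w i}) =
    (\<Prod>i<M. (N + w i - 1) choose (w i))"
proof -
  have "card {T \<in> tableaux M (cells p). \<forall>i<M. card {x. T x = Suc i} = w i} = weighted_tableaux 0 w M p"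
    if "p \<in> partition_funs" for p
  proof -
    have "(\<Prod>i<M. strip_weight 0 (w i) (card {x. T x = Suc i})) =
        (if \<forall>i<M. card {x. T x = Suc i} = w i then 1 else 0)" for T :: "nat \<times> nat \<Rightarrow> nat"
      by (auto simp: strip_weight_0)
    then show ?thesis
      using finite_tableaux[OF finite_cells[OF that], of M]
      by (simp add: weighted_tableaux_def sum.If_cases Int_def)
  qed
  then have "(\<Sum>p | p \<in> partition_funs \<and> psize p \<le> B. card (tableaux N (cells p)) *
      card {T \<in> tableaux M (cells p). \<forall>i<M. card {x. T x = Suc i} = w i}) =
    (\<Sum>p | p \<in> partition_funs \<and> psize p \<le> B. card (tableaux N (cells p)) * weighted_tableaux 0 w M p)"
    by (intro sum.cong) auto
  then show ?thesis by (simp add: cauchy_weighted[OF assms] weighted_tableaux_empty)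
qed


section \<open>Standardization\<close>

definition down_closed :: "(nat \<times> nat) set \<Rightarrow> bool" where
  "down_closed D \<longleftrightarrow> (\<forall>r c r' c'. (r, c) \<in> D \<and> r' \<le> r \<and> c' \<le> c \<longrightarrow> (r', c') \<in> D)"

text \<open>
  A standard Young tableau is encoded as the list of its cells in the order of their entries. All
  positions are counted from 0, so position \<open>i\<close> is an ascent iff the entry \<open>i + 1\<close> is not a
  descent.
\<close>

definition standard_orders :: "(nat \<times> nat) set \<Rightarrow> (nat \<times> nat) list set" where
  "standard_orders D = {xs. distinct xs \<and> set xs = D \<and>
     (\<forall>i j. i < j \<and> j < length xs \<longrightarrow> \<not> (fst (xs ! j) \<le> fst (xs ! i) \<and> snd (xs ! j) \<le> snd (xs ! i)))}"

definition ascent :: "(nat \<times> nat) list \<Rightarrow> nat \<Rightarrow> bool" where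
  "ascent xs i \<longleftrightarrow> snd (xs ! i) < snd (xs ! Suc i)"

definition ascents_before :: "(nat \<times> nat) list \<Rightarrow> nat \<Rightarrow> nat" where
  "ascents_before xs i = card {j. j < i \<and> ascent xs j}"

definition ascents :: "(nat \<times> nat) list \<Rightarrow> nat" where
  "ascents xs = ascents_before xs (length xs - 1)"

text \<open>Standardization of \<open>T\<close>: by entries, ties from left to right. Equal entries
  of a tableau lie in different columns, so no further ties occur.\<close>

definition reading_order :: "(nat \<times> nat \<Rightarrow> nat) \<Rightarrow> (nat \<times> nat) list \<Rightarrow> bool" where
  "reading_order T xs \<longleftrightarrow> (\<forall>i j. i < j \<and> j < length xs \<longrightarrow>
     T (xs ! i) < T (xs ! j) \<or> T (xs ! i) = T (xs ! j) \<and> snd (xs ! i) < snd (xs ! j))"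

lemma standard_ordersD:
  assumes "xs \<in> standard_orders D"
  shows "distinct xs" "set xs = D" "length xs = card D"
    "\<And>i j. i < j \<Longrightarrow> j < card D \<Longrightarrow> fst (xs ! j) \<le> fst (xs ! i) \<Longrightarrow> snd (xs ! j) \<le> snd (xs ! i) \<Longrightarrow> False"
  using assms distinct_card[of xs] by (auto simp: standard_orders_def)

lemma finite_standard_orders: "finite D \<Longrightarrow> finite (standard_orders D)"
  by (rule finite_subset[OF _ finite_lists_length_eq[of D "card D"]])
     (use standard_ordersD in auto)

lemma ascents_before_0 [simp]: "ascents_before xs 0 = 0"
  by (simp add: ascents_before_def)

lemma ascents_before_Suc:
  "ascents_before xs (Suc i) = ascents_before xs i + (if ascent xs i then 1 else 0)"
proof -
  have "{j. j < Suc i \<and> ascent xs j} =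
      (if ascent xs i then insert i {j. j < i \<and> ascent xs j} else {j. j < i \<and> ascent xs j})"
    by (auto simp: less_Suc_eq)
  then show ?thesis by (simp add: ascents_before_def)
qed

lemma ascents_before_le: "ascents_before xs i \<le> i"
  by (induction i) (simp_all add: ascents_before_Suc)

text \<open>The second of two consecutive cells cannot be strictly above and strictly right of the
  first: the corner in the row of the first and the column of the second would have to come strictly
  between them. Hence strictly right and strictly above are complementary.\<close>

lemma descent_step:
  assumes xs: "xs \<in> standard_orders D" and D: "down_closed D" and i: "Suc i < card D"
  shows "ascent xs i \<longleftrightarrow> fst (xs ! Suc i) \<le> fst (xs ! i)"
proof -
  note x = standard_ordersD[OF xs]
  let ?a = "xs ! i" and ?b = "xs ! Suc i"
  have "\<not> (fst ?a < fst ?b \<and> snd ?a < snd ?b)"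
  proof
    assume lt: "fst ?a < fst ?b \<and> snd ?a < snd ?b"
    have "?b \<in> D" using x(2,3) i nth_mem[of "Suc i" xs] by simp
    then have "(fst ?a, snd ?b) \<in> D"
      using D lt unfolding down_closed_def by (metis less_imp_le order_refl prod.collapse)
    then obtain j where j: "j < card D" "xs ! j = (fst ?a, snd ?b)"
      using x(2,3) by (metis in_set_conv_nth)
    have "\<not> j < i" using x(4)[of j i] j i lt by auto
    moreover have "\<not> Suc i < j" using x(4)[of "Suc i" j] j i lt by auto
    moreover have "snd (xs ! j) = snd ?b" "fst (xs ! j) = fst ?a" using j by simp_all
    then have "j \<noteq> i" "j \<noteq> Suc i" using lt by auto
    ultimately show False by simp
  qed
  moreover have "\<not> (fst ?b \<le> fst ?a \<and> snd ?b \<le> snd ?a)" using x(4)[of i "Suc i"] i by auto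
  ultimately show ?thesis by (auto simp: ascent_def not_less not_le)
qed

lemma reading_orderI:
  assumes "\<And>i. Suc i < length xs \<Longrightarrow>
    T (xs ! i) < T (xs ! Suc i) \<or> T (xs ! i) = T (xs ! Suc i) \<and> ascent xs i"
  shows "reading_order T xs"
proof -
  have "T (xs ! i) < T (xs ! j) \<or> T (xs ! i) = T (xs ! j) \<and> snd (xs ! i) < snd (xs ! j)"
    if "i < j" "j < length xs" for i j
    using that
  proof (induction j)
    case (Suc j)
    then show ?case using assms[of j] by (cases "i = j") (auto simp: ascent_def)
  qed simp
  then show ?thesis by (simp add: reading_order_def)
qed

text \<open>The number \<open>T x * B + snd x\<close>, with \<open>B\<close> above all columns,
  encodes the lexicographic comparison. Both lists are then strictly sorted by the same key and have
  the same set.\<close>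

lemma reading_order_unique:
  assumes "reading_order T xs" "reading_order T ys" "set xs = set ys"
  shows "xs = ys"
proof -
  obtain B where B: "\<And>x. x \<in> set xs \<Longrightarrow> snd x < B"
    using finite_nat_set_iff_bounded[of "snd ` set xs"] by auto
  define key where "key x = T x * B + snd x" for x
  have key: "key x < key y \<longleftrightarrow> T x < T y \<or> T x = T y \<and> snd x < snd y"
    if "x \<in> set xs" "y \<in> set xs" for x y
  proof -
    have "key x < key y" if "T x < T y" "snd x < B" for x y
    proof -
      have "key x < Suc (T x) * B" using that by (simp add: key_def)
      also have "\<dots> \<le> T y * B" using that by (intro mult_le_mono1) simp
      finally show ?thesis by (simp add: key_def)
    qed
    from this[of x y] this[of y x] B[OF that(1)] B[OF that(2)] show ?thesis
      by (cases "T x" "T y" rule: linorder_cases) (auto simp: key_def)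
  qed
  have sorted: "sorted_wrt (<) (map key zs)" if "reading_order T zs" "set zs = set xs" for zs
  proof -
    have "key (zs ! i) < key (zs ! j)" if ij: "i < j" "j < length zs" for i j
    proof -
      have "zs ! i \<in> set xs" "zs ! j \<in> set xs" using \<open>set zs = set xs\<close> ij nth_mem less_trans by metis+
      then show ?thesis
        using \<open>reading_order T zs\<close> ij by (simp add: reading_order_def key)
    qed
    then show ?thesis by (simp add: sorted_wrt_iff_nth_less)
  qed
  have "map key xs = map key ys"
    using sorted[OF assms(1) refl] sorted[OF assms(2) assms(3)[symmetric]] assms(3)
    by (intro strict_sorted_equal) auto
  moreover have "inj_on key (set xs)"
  proof (rule inj_onI)
    fix x y assume x: "x \<in> set xs" "y \<in> set xs" "key x = key y"
    have "i = j" if "i < length xs" "j < length xs" "key (xs ! i) = key (xs ! j)" for i j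
      using that sorted_wrt_nth_less[OF sorted[OF assms(1) refl], of i j]
        sorted_wrt_nth_less[OF sorted[OF assms(1) refl], of j i]
      by (cases i j rule: linorder_cases) auto
    then show "x = y" using x by (metis in_set_conv_nth)
  qed
  ultimately show ?thesis using assms(3) by (metis map_inj_on sup.idem)
qed

text \<open>If a later cell \<open>(r', c')\<close> were weakly below and left of an earlier cell
  \<open>(r, c)\<close>, comparison through the corner \<open>(r', c)\<close> would give it a
  smaller entry, or an equal one that is not further right.\<close>

lemma reading_order_standard:
  assumes T: "tableau D T" and D: "down_closed D"
    and xs: "distinct xs" "set xs = D" "reading_order T xs"
  shows "xs \<in> standard_orders D"
proof -
  have False if ij: "i < j" "j < length xs" and le: "fst (xs ! j) \<le> fst (xs ! i)" "snd (xs ! j) \<le> snd (xs ! i)" for i j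
  proof -
    obtain r c r' c' where eq: "xs ! i = (r, c)" "xs ! j = (r', c')" by (metis prod.collapse)
    have mem: "(r, c) \<in> D" "(r', c') \<in> D" using ij xs(2) eq by (metis nth_mem less_trans)+
    have le': "r' \<le> r" "c' \<le> c" using le eq by auto
    have mem2: "(r', c) \<in> D" using mem le' D unfolding down_closed_def by blast
    have "T (r', c') \<le> T (r', c)"
      using T mem mem2 le' unfolding tableau_def by (cases "c' = c") (auto simp: le_less)
    moreover have "r' < r \<Longrightarrow> T (r', c) < T (r, c)"
      using T mem mem2 unfolding tableau_def by blast
    moreover have "T (r, c) < T (r', c') \<or> T (r, c) = T (r', c') \<and> c < c'"
      using xs(3) ij eq unfolding reading_order_def by fastforce
    ultimately show False using le' by (cases "r' = r") auto
  qed
  then show ?thesis using xs by (auto simp: standard_orders_def)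
qed

text \<open>Sorting by the lexicographic key works because strict columns make the key injective;
  quotient and remainder by \<open>B\<close> recover entry and column.\<close>

lemma reading_order_exists:
  assumes T: "tableau D T" and D: "down_closed D" "finite D"
  obtains xs where "xs \<in> standard_orders D" "reading_order T xs"
proof -
  obtain B where B: "\<And>x. x \<in> D \<Longrightarrow> snd x < B"
    using finite_nat_set_iff_bounded[of "snd ` D"] D(2) by auto
  define key where "key x = T x * B + snd x" for x
  have key_div: "key x div B = T x" "key x mod B = snd x" if "x \<in> D" for x
    using B[OF that] by (simp_all add: key_def)
  have inj: "inj_on key D"
  proof (rule inj_onI)
    fix x y assume x: "x \<in> D" "y \<in> D" "key x = key y"
    obtain r c r' c' where eq: "x = (r, c)" "y = (r', c')" by (metis prod.collapse)
    have "T x = T y" "c = c'" using x key_div[of x] key_div[of y] eq by auto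
    moreover have "r < r' \<Longrightarrow> T (r, c) < T (r', c)" "r' < r \<Longrightarrow> T (r', c) < T (r, c)"
      using T x eq \<open>c = c'\<close> unfolding tableau_def by blast+
    ultimately show "x = y" using eq by (cases r r' rule: linorder_cases) auto
  qed
  define xs where "xs = map (the_inv_into D key) (sorted_list_of_set (key ` D))"
  have mk: "map key xs = sorted_list_of_set (key ` D)"
    unfolding xs_def map_map using D(2) inj
    by (intro map_idI) (auto simp: f_the_inv_into_f)
  have set_xs: "set xs = D"
    unfolding xs_def using D(2) inj by (auto simp: the_inv_into_f_f image_image)
  have dist: "distinct xs"
    using mk by (metis distinct_map distinct_sorted_list_of_set)
  have "reading_order T xs"
    unfolding reading_order_def
  proof (intro allI impI)
    fix i j assume ij: "i < j \<and> j < length xs"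
    have "sorted_wrt (<) (map key xs)" unfolding mk by (rule strict_sorted_list_of_set)
    then have "key (xs ! i) < key (xs ! j)"
      using ij by (simp add: sorted_wrt_map sorted_wrt_iff_nth_less)
    moreover have "xs ! i \<in> D" "xs ! j \<in> D" using ij set_xs by (metis nth_mem less_trans)+
    ultimately show "T (xs ! i) < T (xs ! j) \<or> T (xs ! i) = T (xs ! j) \<and> snd (xs ! i) < snd (xs ! j)"
      by (metis div_le_mono key_div less_imp_le mod_div_decomp nat_add_left_cancel_less nless_le)
  qed
  with that reading_order_standard[OF T D(1) dist set_xs] show ?thesis by blast
qed

lemma reading_order_tableau:
  assumes xs: "xs \<in> standard_orders D" and "\<And>x. x \<notin> D \<Longrightarrow> T x = 0" "\<And>x. x \<in> D \<Longrightarrow> T x > 0"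
    and T: "reading_order T xs"
  shows "tableau D T"
proof -
  note x = standard_ordersD[OF xs]
  have *: "T (r, c) \<le> T (r', c') \<and> (c = c' \<longrightarrow> T (r, c) < T (r', c'))"
    if h: "(r, c) \<in> D" "(r', c') \<in> D" "r \<le> r'" "c \<le> c'" "(r, c) \<noteq> (r', c')" for r c r' c'
  proof -
    obtain i j where ij: "i < length xs" "j < length xs" "xs ! i = (r, c)" "xs ! j = (r', c')"
      using h(1,2) x(2) by (metis in_set_conv_nth)
    have "\<not> j < i" using x(4)[of j i] ij h x(3) by auto
    moreover have "i \<noteq> j" using ij h(5) by auto
    ultimately have "i < j" by simp
    then have "T (xs ! i) < T (xs ! j) \<or> T (xs ! i) = T (xs ! j) \<and> snd (xs ! i) < snd (xs ! j)"
      using T ij(2) unfolding reading_order_def by blast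
    then show ?thesis using ij by auto
  qed
  show ?thesis unfolding tableau_def using assms(2,3) * by force
qed

text \<open>
  The tableaux with a given reading order correspond to weakly increasing sequences that increase
  strictly at the descents. Adding the number of preceding ascents makes them strictly increasing.
\<close>

lemma card_tableaux_reading_order:
  assumes xs: "xs \<in> standard_orders D" and D: "finite D" "D \<noteq> {}"
  shows "card {T \<in> tableaux N D. reading_order T xs} = (N + ascents xs) choose card D"
proof -
  note x = standard_ordersD[OF xs]
  define n where "n = card D"
  have n: "n > 0" "length xs = n" using D x(3) by (auto simp: n_def card_gt_0_iff)
  define ab where "ab = ascents_before xs"
  have ab_Suc: "ab (Suc i) = ab i + (if ascent xs i then 1 else 0)" for i
    by (simp add: ab_def ascents_before_Suc)
  have ab_n: "ab (n - 1) = ascents xs" by (simp add: ab_def ascents_def n)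
  \<comment> \<open>Subtracting 1 makes the entries start at 0. At the last position the added
    number is \<open>ascents xs\<close>, so the image consists of the \<open>n\<close>-element
    subsets of \<open>{..<N + ascents xs}\<close>.\<close>
  define b where "b T i = T (xs ! i) - 1 + ab i" for T :: "nat \<times> nat \<Rightarrow> nat" and i
  define bs where "bs T = map (b T) [0..<n]" for T
  let ?S = "{T \<in> tableaux N D. reading_order T xs}"
  have mem: "xs ! i \<in> D" if "i < n" for i using that x(2) n nth_mem by metis
  have S: "T x = 0" if "T \<in> ?S" "x \<notin> D" for T x
    using that unfolding tableaux_def tableau_def by blast
  have Spos: "T x > 0" if "T \<in> ?S" "x \<in> D" for T x
    using that unfolding tableaux_def tableau_def by blast
  have Sle: "T x \<le> N" if "T \<in> ?S" for T x
    using that unfolding tableaux_def by blast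
  have step: "b T i < b T (Suc i)" if "T \<in> ?S" "Suc i < n" for T i
  proof -
    have "T (xs ! i) < T (xs ! Suc i) \<or> T (xs ! i) = T (xs ! Suc i) \<and> ascent xs i"
      using that n unfolding reading_order_def ascent_def by auto
    then show ?thesis
      using Spos[OF that(1) mem[of i]] that(2) by (auto simp: b_def ab_Suc)
  qed
  have strict: "b T i < b T j" if "T \<in> ?S" "i < j" "j < n" for T i j
    using that(2,3) by (induction j) (use step[OF that(1)] in \<open>fastforce simp: less_Suc_eq\<close>)+
  have sorted: "sorted_wrt (<) (bs T)" if "T \<in> ?S" for T
    using strict[OF that] by (auto simp: bs_def sorted_wrt_iff_nth_less)
  have len: "length (bs T) = n" for T by (simp add: bs_def)
  have bij: "bij_betw (\<lambda>T. set (bs T)) ?S {A. A \<subseteq> {..<N + ascents xs} \<and> card A = n}"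
    unfolding bij_betw_def
  proof (intro conjI inj_onI set_eqI iffI)
    fix T T' assume T: "T \<in> ?S" "T' \<in> ?S" and eq: "set (bs T) = set (bs T')"
    have "bs T = bs T'" using sorted[OF T(1)] sorted[OF T(2)] eq by (intro strict_sorted_equal) auto
    then have "b T i = b T' i" if "i < n" for i
      using that by (auto simp: bs_def)
    then have "T (xs ! i) = T' (xs ! i)" if "i < n" for i
      using that Spos[OF T(1) mem[OF that]] Spos[OF T(2) mem[OF that]] by (fastforce simp: b_def)
    then have "T x = T' x" if "x \<in> D" for x
      using that x(2) n(2) by (metis in_set_conv_nth)
    then show "T = T'" using S[OF T(1)] S[OF T(2)] by (metis ext)
  next
    fix A assume "A \<in> (\<lambda>T. set (bs T)) ` ?S"
    then obtain T where T: "T \<in> ?S" and A: "A = set (bs T)" by auto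
    have "card A = n" using sorted[OF T] len A by (metis distinct_card strict_sorted_iff)
    moreover have "b T i < N + ascents xs" if "i < n" for i
    proof -
      have "b T i \<le> b T (n - 1)"
        using strict[OF T, of i "n - 1"] that by (cases "i < n - 1") (auto simp: not_less dest: le_antisym)
      also have "\<dots> < N + ascents xs"
        using Spos[OF T mem[of "n - 1"]] Sle[OF T, of "xs ! (n - 1)"] n(1) ab_n by (simp add: b_def)
      finally show ?thesis .
    qed
    ultimately show "A \<in> {A. A \<subseteq> {..<N + ascents xs} \<and> card A = n}" by (auto simp: A bs_def)
  next
    fix A assume "A \<in> {A. A \<subseteq> {..<N + ascents xs} \<and> card A = n}"
    then have A: "A \<subseteq> {..<N + ascents xs}" "card A = n" "finite A" by (auto intro: finite_subset)
    define as where "as = sorted_list_of_set A"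
    have as: "sorted_wrt (<) as" "set as = A" "length as = n"
      using A by (auto simp: as_def)
    have as_step: "as ! i < as ! Suc i" if "Suc i < n" for i
      using as that by (simp add: sorted_wrt_nth_less)
    have as_ge: "as ! i \<ge> i" if "i < n" for i
      using that by (induction i) (use as_step in fastforce)+
    \<comment> \<open>The \<open>i\<close>-th element of a strictly increasing sequence of naturals
      is at least \<open>i\<close>, and at most \<open>i\<close> ascents precede position
      \<open>i\<close>. So the subtraction in \<open>a\<close> is exact.\<close>
    have ab_le: "ab i \<le> as ! i" if "i < n" for i
      using as_ge[OF that] ascents_before_le[of xs i] by (simp add: ab_def)
    define a where "a i = as ! i - ab i" for i
    have a_step: "a i < a (Suc i) \<or> a i = a (Suc i) \<and> ascent xs i" if "Suc i < n" for i
      using as_step[OF that] ab_le[OF that] ab_le[of i] that by (auto simp: a_def ab_Suc split: if_splits)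
    have a_mono: "a i \<le> a (n - 1)" if "i < n" for i
    proof -
      have "a i \<le> a j" if "i \<le> j" "j < n" for j
        using that by (induction j rule: dec_induct) (use a_step in fastforce)+
      then show ?thesis using that by simp
    qed
    have "as ! (n - 1) < N + ascents xs" using as A n(1) nth_mem[of "n - 1" as] by auto
    then have a_less: "a i < N" if "i < n" for i
      using a_mono[OF that] ab_le[of "n - 1"] n(1) ab_n by (simp add: a_def)
    define T where "T x = (if x \<in> D then Suc (a (the_inv_into {..<n} ((!) xs) x)) else 0)" for x
    have "inj_on ((!) xs) {..<n}" using x(1) n(2) by (auto simp: inj_on_def nth_eq_iff_index_eq)
    then have T_nth: "T (xs ! i) = Suc (a i)" if "i < n" for i
      using that mem by (simp add: T_def the_inv_into_f_f)
    have ro: "reading_order T xs"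
      by (rule reading_orderI) (use a_step in \<open>simp add: T_nth n(2)\<close>)
    have "tableau D T" by (rule reading_order_tableau[OF xs _ _ ro]) (simp_all add: T_def)
    moreover have "T x \<le> N" for x
    proof (cases "x \<in> D")
      case True
      then obtain i where "i < n" "x = xs ! i" using x(2) n(2) by (metis in_set_conv_nth)
      then show ?thesis using a_less[of i] by (simp add: T_nth)
    qed (simp add: T_def)
    ultimately have "T \<in> ?S" using ro by (simp add: tableaux_def)
    moreover have "bs T = as"
      using ab_le as(3) by (intro nth_equalityI) (auto simp: bs_def b_def T_nth a_def)
    ultimately show "A \<in> (\<lambda>T. set (bs T)) ` ?S" using as(2) by force
  qed
  from bij_betw_same_card[OF bij] show ?thesis by (simp add: n_subsets n_def)
qed

text \<open>Every tableau has exactly one reading order. This is the expansion of a Schur function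
  into fundamental quasisymmetric functions, evaluated at \<open>1^N\<close>.\<close>

lemma card_tableaux:
  assumes D: "finite D" "D \<noteq> {}" "down_closed D"
  shows "card (tableaux N D) = (\<Sum>xs\<in>standard_orders D. (N + ascents xs) choose card D)"
proof -
  have "tableaux N D = (\<Union>xs\<in>standard_orders D. {T \<in> tableaux N D. reading_order T xs})"
  proof -
    have "\<exists>xs\<in>standard_orders D. reading_order T xs" if "T \<in> tableaux N D" for T
      using that reading_order_exists[OF _ D(3,1), of T] unfolding tableaux_def by blast
    then show ?thesis by blast
  qed
  also have "card \<dots> = (\<Sum>xs\<in>standard_orders D. card {T \<in> tableaux N D. reading_order T xs})"
  proof (rule card_UN_disjoint)
    show "\<forall>xs\<in>standard_orders D. \<forall>ys\<in>standard_orders D. xs \<noteq> ys \<longrightarrow>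
        {T \<in> tableaux N D. reading_order T xs} \<inter> {T \<in> tableaux N D. reading_order T ys} = {}"
      using reading_order_unique standard_ordersD(2) by blast
  qed (use D finite_standard_orders finite_tableaux in auto)
  finally show ?thesis using D by (simp add: card_tableaux_reading_order)
qed

lemma card_tableaux_by_ascents:
  assumes D: "finite D" "D \<noteq> {}" "down_closed D"
  shows "card (tableaux N D) =
    (\<Sum>k=0..card D - 1. card {xs \<in> standard_orders D. ascents xs = k} * ((N + k) choose card D))"
proof -
  have le: "ascents xs \<le> card D - 1" if "xs \<in> standard_orders D" for xs
    using standard_ordersD(3)[OF that] ascents_before_le[of xs "card D - 1"] by (simp add: ascents_def)
  have "(\<Sum>k=0..card D - 1. card {xs \<in> standard_orders D. ascents xs = k} * ((N + k) choose card D)) =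
      (\<Sum>k=0..card D - 1. \<Sum>xs | xs \<in> standard_orders D \<and> ascents xs = k. (N + ascents xs) choose card D)"
    by (intro sum.cong) auto
  also have "\<dots> = (\<Sum>xs\<in>standard_orders D. (N + ascents xs) choose card D)"
    by (rule sum.group) (use le finite_standard_orders[OF D(1)] in auto)
  finally show ?thesis by (simp add: card_tableaux[OF D])
qed

section \<open>Quasi-Yamanouchi tableaux and transposition\<close>

lemma ssyt_iff_tableau: "ssyt \<mu> T \<longleftrightarrow> tableau (diagram \<mu>) T"
  by (simp add: ssyt_def tableau_def)

text \<open>
  A quasi-Yamanouchi tableau is the smallest one with its reading order: its entries start at 1 and
  grow by one exactly at the descents.
\<close>

lemma quasi_yamanouchi_iff:
  assumes T: "tableau (diagram \<mu>) T" and xs: "xs \<in> standard_orders (diagram \<mu>)" "reading_order T xs"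
    and D: "down_closed (diagram \<mu>)"
  shows "quasi_yamanouchi \<mu> T \<longleftrightarrow> (\<forall>i<length xs. T (xs ! i) + ascents_before xs i = Suc i)"
proof
  note x = standard_ordersD[OF xs(1)]
  have pos: "T y > 0" if "y \<in> diagram \<mu>" for y using T that unfolding tableau_def by blast
  have ro: "T (xs ! i) < T (xs ! j) \<or> T (xs ! i) = T (xs ! j) \<and> snd (xs ! i) < snd (xs ! j)"
    if "i < j" "j < length xs" for i j using xs(2) that unfolding reading_order_def by blast
  have mem: "xs ! i \<in> diagram \<mu>" if "i < length xs" for i using that x(2) nth_mem by metis
  have nth: "\<exists>i<length xs. y = xs ! i" if "y \<in> diagram \<mu>" for y
    using that x(2) by (metis in_set_conv_nth)
  {
    assume "quasi_yamanouchi \<mu> T"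
    then have qy: "\<exists>y\<in>diagram \<mu>. T y = T x - 1 \<and> weakly_left x y"
      if "T x > 1" "x \<in> diagram \<mu>" "\<And>y. y \<in> diagram \<mu> \<Longrightarrow> T y = T x \<Longrightarrow> snd x \<le> snd y" for x
      using that unfolding quasi_yamanouchi_def by blast
    \<comment> \<open>The first position carrying a given entry holds its leftmost cell, since ties
      are read from left to right. The cell supplied by the quasi-Yamanouchi condition has a smaller
      entry, hence an earlier position. At position 0 there is none, so the first entry must be
      1.\<close>
    have qy_nth: "\<exists>j<i. T (xs ! j) = T (xs ! i) - 1 \<and> weakly_left (xs ! i) (xs ! j)"
      if i: "i < length xs" "T (xs ! i) > 1" and less: "\<And>j. j < i \<Longrightarrow> T (xs ! j) < T (xs ! i)" for i
    proof -
      have "snd (xs ! i) \<le> snd y" if y: "y \<in> diagram \<mu>" "T y = T (xs ! i)" for y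
      proof -
        obtain j where j: "j < length xs" "y = xs ! j" using nth[OF y(1)] by blast
        then show ?thesis using ro[of i j] less[of j] i(1) y(2) by (cases i j rule: linorder_cases) auto
      qed
      then obtain y where y: "y \<in> diagram \<mu>" "T y = T (xs ! i) - 1" "weakly_left (xs ! i) y"
        using qy[OF i(2) mem[OF i(1)]] by blast
      obtain j where j: "j < length xs" "y = xs ! j" using nth[OF y(1)] by blast
      have "j < i" using ro[of i j] y(2) j i(2) by (cases i j rule: linorder_cases) auto
      with y j show ?thesis by blast
    qed
    show "\<forall>i<length xs. T (xs ! i) + ascents_before xs i = Suc i"
    proof (intro allI impI)
      fix i assume "i < length xs"
      then show "T (xs ! i) + ascents_before xs i = Suc i"
      proof (induction i)
        case 0
        then show ?case using qy_nth[of 0] pos[OF mem[of 0]] by fastforce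
      next
        case (Suc i)
        have le: "T (xs ! j) \<le> T (xs ! i)" if "j < Suc i" for j
          using ro[of j i] that Suc.prems by (cases "j = i") auto
        show ?case
        proof (cases "T (xs ! i) < T (xs ! Suc i)")
          case True
          have "1 < T (xs ! Suc i)" using True pos[OF mem[of i]] Suc.prems by simp
          moreover have "T (xs ! j) < T (xs ! Suc i)" if "j < Suc i" for j
            using le[OF that] True by simp
          ultimately obtain j where j: "j < Suc i" "T (xs ! j) = T (xs ! Suc i) - 1"
              "weakly_left (xs ! Suc i) (xs ! j)"
            using qy_nth[of "Suc i"] Suc.prems by blast
          \<comment> \<open>The entry at \<open>i\<close> is the largest before the jump, while
            \<open>j\<close> attains one less than the new entry. So the jump is by one and
            \<open>j\<close> lies in the run of equal entries that ends at \<open>i\<close>. Columns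
            increase along this run, which excludes an ascent at \<open>i\<close>.\<close>
          have 1: "T (xs ! Suc i) = Suc (T (xs ! i))" "T (xs ! j) = T (xs ! i)" using j le[of j] True by auto
          then have "snd (xs ! j) \<le> snd (xs ! i)" using ro[of j i] j(1) Suc.prems by (cases "j = i") auto
          moreover have "snd (xs ! Suc i) \<le> snd (xs ! j)"
            using j(3) by (metis prod.collapse weakly_left.simps)
          ultimately have "\<not> ascent xs i" by (simp add: ascent_def)
          then show ?thesis using Suc 1 by (simp add: ascents_before_Suc)
        next
          case False
          then have "T (xs ! Suc i) = T (xs ! i)" "ascent xs i"
            using ro[of i "Suc i"] Suc.prems by (auto simp: ascent_def)
          then show ?thesis using Suc by (simp add: ascents_before_Suc)
        qed
      qed
    qed
  }
  {
    assume eq: "\<forall>i<length xs. T (xs ! i) + ascents_before xs i = Suc i"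
    have "\<exists>y\<in>diagram \<mu>. T y = T x - 1 \<and> weakly_left x y"
      if h: "T x > 1" "x \<in> diagram \<mu>" "\<And>y. y \<in> diagram \<mu> \<Longrightarrow> T y = T x \<Longrightarrow> snd x \<le> snd y" for x
    proof -
      obtain j where j: "j < length xs" "x = xs ! j" using nth[OF h(2)] by blast
      then obtain i where i: "j = Suc i" using h(1) eq[rule_format, of 0] by (cases j) auto
      have "i < length xs" using i j by simp
      have T_step: "T (xs ! Suc i) + (if ascent xs i then 1 else 0) = Suc (T (xs ! i))"
        using eq[rule_format, of i] eq[rule_format, of "Suc i"] i j by (simp add: ascents_before_Suc)
      \<comment> \<open>At an ascent \<open>xs ! i\<close> would carry the same entry as
        \<open>x\<close> further to the left, although \<open>x\<close> is leftmost.\<close>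
      have na: "\<not> ascent xs i"
      proof
        assume a: "ascent xs i"
        then have "T (xs ! i) = T x" using T_step i j by simp
        from h(3)[OF mem[OF \<open>i < length xs\<close>] this] a show False using i j by (simp add: ascent_def)
      qed
      then have "T (xs ! i) = T x - 1" using T_step i j by simp
      \<comment> \<open>The absence of an ascent only gives the comparison of columns;
        \<open>descent_step\<close> adds that \<open>x\<close> is strictly higher.\<close>
      moreover have "weakly_left x (xs ! i)"
        using na descent_step[OF xs(1) D, of i] i j x(3) unfolding ascent_def
        by (metis not_le prod.collapse weakly_left.simps)
      ultimately show ?thesis using mem[OF \<open>i < length xs\<close>] by blast
    qed
    then show "quasi_yamanouchi \<mu> T" using T unfolding quasi_yamanouchi_def ssyt_iff_tableau by blast
  }
qed

text \<open>By \<open>quasi_yamanouchi_iff\<close> each standard order carries exactly one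
  quasi-Yamanouchi tableau, \<open>F xs\<close>. Its largest entry stands in the last cell and
  equals \<open>n - ascents xs\<close>.\<close>

lemma QYT_eq_card_standard_orders:
  assumes D: "finite (diagram \<mu>)" "diagram \<mu> \<noteq> {}" "down_closed (diagram \<mu>)"
  shows "QYT m \<mu> = card {xs \<in> standard_orders (diagram \<mu>). card (diagram \<mu>) = m + ascents xs}"
proof -
  define n where "n = card (diagram \<mu>)"
  have n: "n > 0" using D by (auto simp: n_def card_gt_0_iff)
  define F where "F xs x = (if x \<in> diagram \<mu> then
      Suc (the_inv_into {..<n} ((!) xs) x) - ascents_before xs (the_inv_into {..<n} ((!) xs) x) else 0)"
    for xs x
  have F: "reading_order (F xs) xs" "tableau (diagram \<mu>) (F xs)"
      "\<And>i. i < n \<Longrightarrow> F xs (xs ! i) + ascents_before xs i = Suc i"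
    if xs: "xs \<in> standard_orders (diagram \<mu>)" for xs
  proof -
    note x = standard_ordersD[OF xs, folded n_def]
    have "inj_on ((!) xs) {..<n}" using x(1,3) by (auto simp: inj_on_def nth_eq_iff_index_eq)
    then have 1: "F xs (xs ! i) + ascents_before xs i = Suc i" if "i < n" for i
      using that x(2,3) nth_mem[of i xs] ascents_before_le[of xs i] by (auto simp: F_def the_inv_into_f_f)
    then show "F xs (xs ! i) + ascents_before xs i = Suc i" if "i < n" for i using that by blast
    show ro: "reading_order (F xs) xs"
    proof (rule reading_orderI)
      fix i assume "Suc i < length xs"
      then show "F xs (xs ! i) < F xs (xs ! Suc i) \<or> F xs (xs ! i) = F xs (xs ! Suc i) \<and> ascent xs i"
        using 1[of i] 1[of "Suc i"] x(3) by (auto simp: ascents_before_Suc split: if_splits)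
    qed
    have "F xs y > 0" if y: "y \<in> diagram \<mu>" for y
    proof -
      obtain i where "i < n" "y = xs ! i" using y x(2,3) by (metis in_set_conv_nth)
      then show ?thesis using 1[of i] ascents_before_le[of xs i] by simp
    qed
    then show "tableau (diagram \<mu>) (F xs)"
      by (intro reading_order_tableau[OF xs _ _ ro]) (auto simp: F_def)
  qed
  have top: "m \<in> T ` diagram \<mu> \<and> (\<forall>x\<in>diagram \<mu>. T x \<le> m) \<longleftrightarrow> T (xs ! (n - 1)) = m"
    if xs: "xs \<in> standard_orders (diagram \<mu>)" "reading_order T xs" for xs T
  proof -
    note x = standard_ordersD[OF xs(1), folded n_def]
    have mem: "xs ! (n - 1) \<in> diagram \<mu>" using x(2,3) n nth_mem[of "n - 1" xs] by auto
    have "T y \<le> T (xs ! (n - 1))" if y: "y \<in> diagram \<mu>" for y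
    proof -
      obtain i where "i < n" "y = xs ! i" using y x(2,3) by (metis in_set_conv_nth)
      moreover from this have "i = n - 1 \<or> i < n - 1 \<and> n - 1 < length xs" using x(3) by linarith
      ultimately show ?thesis using xs(2) unfolding reading_order_def by (metis less_imp_le order_refl)
    qed
    with mem show ?thesis by (auto intro: antisym)
  qed
  have "bij_betw F {xs \<in> standard_orders (diagram \<mu>). n = m + ascents xs}
      {T. quasi_yamanouchi \<mu> T \<and> m \<in> T ` diagram \<mu> \<and> (\<forall>x\<in>diagram \<mu>. T x \<le> m)}"
    unfolding bij_betw_def
  proof (intro conjI inj_onI set_eqI iffI)
    fix xs ys assume xy: "xs \<in> {xs \<in> standard_orders (diagram \<mu>). n = m + ascents xs}"
      "ys \<in> {xs \<in> standard_orders (diagram \<mu>). n = m + ascents xs}" "F xs = F ys"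
    show "xs = ys"
    proof (rule reading_order_unique)
      show "reading_order (F xs) xs" using F(1) xy(1) by simp
      show "reading_order (F xs) ys" unfolding xy(3) using F(1) xy(2) by simp
      show "set xs = set ys" using xy standard_ordersD(2)[of _ "diagram \<mu>"] by simp
    qed
  next
    fix T assume "T \<in> F ` {xs \<in> standard_orders (diagram \<mu>). n = m + ascents xs}"
    then obtain xs where xs: "xs \<in> standard_orders (diagram \<mu>)" "n = m + ascents xs" "T = F xs" by auto
    have "F xs (xs ! (n - 1)) = m"
      using F(3)[OF xs(1), of "n - 1"] xs(2) n standard_ordersD(3)[OF xs(1)] by (simp add: ascents_def n_def)
    moreover have "quasi_yamanouchi \<mu> T"
      using quasi_yamanouchi_iff[OF F(2)[OF xs(1)] xs(1) F(1)[OF xs(1)] D(3)] F(3)[OF xs(1)]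
        standard_ordersD(3)[OF xs(1)] xs(3) by (simp add: n_def)
    ultimately show "T \<in> {T. quasi_yamanouchi \<mu> T \<and> m \<in> T ` diagram \<mu> \<and> (\<forall>x\<in>diagram \<mu>. T x \<le> m)}"
      using top[OF xs(1) F(1)[OF xs(1)]] xs(3) by blast
  next
    fix T assume "T \<in> {T. quasi_yamanouchi \<mu> T \<and> m \<in> T ` diagram \<mu> \<and> (\<forall>x\<in>diagram \<mu>. T x \<le> m)}"
    then have qy: "quasi_yamanouchi \<mu> T" and m: "m \<in> T ` diagram \<mu> \<and> (\<forall>x\<in>diagram \<mu>. T x \<le> m)" by auto
    have T: "tableau (diagram \<mu>) T" using qy by (simp add: quasi_yamanouchi_def ssyt_iff_tableau)
    obtain xs where xs: "xs \<in> standard_orders (diagram \<mu>)" "reading_order T xs"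
      using reading_order_exists[OF T D(3,1)] by blast
    note x = standard_ordersD[OF xs(1), folded n_def]
    have eq: "T (xs ! i) + ascents_before xs i = Suc i" if "i < n" for i
      using quasi_yamanouchi_iff[OF T xs D(3)] qy that x(3) by simp
    have "T (xs ! (n - 1)) = m" using top[OF xs] m by simp
    then have "n = m + ascents xs" using eq[of "n - 1"] n x(3) by (simp add: ascents_def)
    moreover have "T = F xs"
    proof (rule ext)
      fix y show "T y = F xs y"
      proof (cases "y \<in> diagram \<mu>")
        case True
        then obtain i where "i < n" "y = xs ! i" using x(2,3) by (metis in_set_conv_nth)
        then show ?thesis using eq[of i] F(3)[OF xs(1), of i] by simp
      next
        case False
        then show ?thesis using T F(2)[OF xs(1)] unfolding tableau_def by metis
      qed
    qed
    ultimately show "T \<in> F ` {xs \<in> standard_orders (diagram \<mu>). n = m + ascents xs}" using xs by blast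
  qed
  from bij_betw_same_card[OF this] show ?thesis by (simp add: QYT_def n_def)
qed

text \<open>Transposition compares rows instead of columns, so by \<open>descent_step\<close> it
  turns ascents into non-ascents. Among the \<open>card D - 1\<close> positions, \<open>k\<close>
  ascents become \<open>card D - 1 - k\<close>.\<close>

lemma card_standard_orders_swap:
  assumes D: "down_closed D" "finite D" "D \<noteq> {}"
  shows "card {xs \<in> standard_orders (prod.swap ` D). card D = Suc k + ascents xs} =
    card {xs \<in> standard_orders D. ascents xs = k}"
proof -
  have so: "map prod.swap xs \<in> standard_orders (prod.swap ` D)" if "xs \<in> standard_orders D" for xs D
    using that by (auto simp: standard_orders_def distinct_map)
  have asc: "ascents_before (map prod.swap xs) i + ascents_before xs i = i"
    if xs: "xs \<in> standard_orders D" and i: "i < card D" for xs i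
    using i
  proof (induction i)
    case (Suc i)
    have "ascent (map prod.swap xs) i \<longleftrightarrow> fst (xs ! i) < fst (xs ! Suc i)"
      using Suc.prems standard_ordersD(3)[OF xs] by (simp add: ascent_def)
    also have "\<dots> \<longleftrightarrow> \<not> ascent xs i" using descent_step[OF xs D(1) Suc.prems] by auto
    finally show ?case using Suc by (simp add: ascents_before_Suc)
  qed simp
  have asc': "ascents (map prod.swap xs) + ascents xs = card D - 1" if "xs \<in> standard_orders D" for xs
    using asc[OF that, of "card D - 1"] standard_ordersD(3)[OF that] D by (simp add: ascents_def card_gt_0_iff)
  have pos: "card D > 0" using D by (simp add: card_gt_0_iff)
  have inv: "map prod.swap (map prod.swap xs) = xs" for xs :: "(nat \<times> nat) list" by (simp add: o_def)
  have "bij_betw (map prod.swap) {xs \<in> standard_orders D. ascents xs = k}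
      {xs \<in> standard_orders (prod.swap ` D). card D = Suc k + ascents xs}"
  proof (rule bij_betw_byWitness[where f' = "map prod.swap"])
    show "map prod.swap ` {xs \<in> standard_orders D. ascents xs = k} \<subseteq>
        {xs \<in> standard_orders (prod.swap ` D). card D = Suc k + ascents xs}"
      using so asc' pos by fastforce
    show "map prod.swap ` {xs \<in> standard_orders (prod.swap ` D). card D = Suc k + ascents xs} \<subseteq>
        {xs \<in> standard_orders D. ascents xs = k}"
    proof (rule image_subsetI)
      fix ys assume ys: "ys \<in> {xs \<in> standard_orders (prod.swap ` D). card D = Suc k + ascents xs}"
      have "map prod.swap ys \<in> standard_orders D"
        using so[of ys "prod.swap ` D"] ys by (simp add: image_image)
      moreover from asc'[OF this] ys have "ascents (map prod.swap ys) = k" unfolding inv by simp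
      ultimately show "map prod.swap ys \<in> {xs \<in> standard_orders D. ascents xs = k}" by simp
    qed
  qed (simp_all add: o_def)
  from bij_betw_same_card[OF this] show ?thesis by simp
qed

lemma diagram_conjugate:
  assumes "is_partition \<mu>"
  shows "diagram (conjugate \<mu>) = prod.swap ` diagram \<mu>"
proof -
  have sorted: "j < length \<mu> \<Longrightarrow> i \<le> j \<Longrightarrow> \<mu> ! j \<le> \<mu> ! i" for i j
    using assms by (cases "i = j") (auto simp: is_partition_def sorted_wrt_iff_nth_less)
  have "r < card {i. i < length \<mu> \<and> c < \<mu> ! i} \<longleftrightarrow> r < length \<mu> \<and> c < \<mu> ! r" for r c
  proof -
    have "{i. i < length \<mu> \<and> c < \<mu> ! i} = {..<card {i. i < length \<mu> \<and> c < \<mu> ! i}}" (is "?S = _")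
    proof (cases "?S = {}")
      case False
      have fin: "finite ?S" by simp
      have "?S = {..Max ?S}"
        using Max_in[OF fin False] Max_ge[OF fin] sorted by (fastforce intro: less_le_trans)
      then show ?thesis by (metis card_atMost lessThan_Suc_atMost)
    qed (metis card.empty lessThan_0)
    then show ?thesis by blast
  qed
  then have "(c, r) \<in> diagram (conjugate \<mu>) \<longleftrightarrow> (r, c) \<in> diagram \<mu>" for r c
    using sorted[of r 0] by (auto simp: diagram_def conjugate_def hd_conv_nth intro: less_le_trans)
  then show ?thesis by force
qed


section \<open>Triangular families\<close>

lemma mcoeff_zero [simp]: "mcoeff (0 :: 'a :: comm_ring_1 mfps) m = 0"
  by (simp add: zero_mfps_def)

lemma mcoeff_add [simp]: "mcoeff (f + g) m = mcoeff f m + mcoeff g m"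
  by (simp add: plus_mfps_def)

lemma mcoeff_diff [simp]: "mcoeff (f - g) m = mcoeff f m - mcoeff g m"
  by (simp add: minus_mfps_def)

lemma mcoeff_mscale [simp]: "mcoeff (mscale c f) m = c * mcoeff f m"
  by (simp add: mscale_def)

lemma mcoeff_sum [simp]: "mcoeff (sum f A) m = (\<Sum>x\<in>A. mcoeff (f x) m)"
  by (induction A rule: infinite_finite_induct) simp_all

lemma mcoeff_one: "mcoeff (1 :: 'a :: comm_ring_1 mfps) m = (if m = 0 then 1 else 0)"
  by (simp add: one_mfps_def)

lemma mcoeff_mult: "mcoeff (f * g) m = (\<Sum>(a, b)\<in>msplits m. mcoeff f a * mcoeff g b)"
  by (simp add: times_mfps_def)

text \<open>Each \<open>B i\<close> has a test monomial \<open>e i\<close>, and \<open>f\<close>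
  ranks the indices so that the matrix of coefficients is triangular. In a vanishing combination, at
  the test monomial of an index of least rank with nonzero scalar, only its own term
  survives.\<close>

lemma triangular_family:
  fixes B :: "'i \<Rightarrow> 'a::field mfps" and f :: "'i \<Rightarrow> int"
  assumes diag: "\<And>i. i \<in> I \<Longrightarrow> mcoeff (B i) (e i) \<noteq> 0"
    and off: "\<And>i j. i \<in> I \<Longrightarrow> j \<in> I \<Longrightarrow> i \<noteq> j \<Longrightarrow> mcoeff (B i) (e j) \<noteq> 0 \<Longrightarrow> f i < f j"
  shows "inj_on B I" "mfps.independent (B ` I)"
proof -
  show inj: "inj_on B I"
  proof (rule inj_onI, rule ccontr)
    fix i j assume "i \<in> I" "j \<in> I" "B i = B j" "i \<noteq> j"
    then show False using off[of i j] off[of j i] diag[of i] diag[of j] by simp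
  qed
  show "mfps.independent (B ` I)"
  proof
    assume "mfps.dependent (B ` I)"
    then obtain t u where t: "finite t" "t \<subseteq> B ` I" "(\<Sum>v\<in>t. mscale (u v) v) = 0" "\<exists>v\<in>t. u v \<noteq> 0"
      unfolding mfps.dependent_explicit by blast
    obtain S where S: "S \<subseteq> I" "finite S" "t = B ` S"
      using t(1,2) by (metis finite_subset_image)
    define A where "A = {i \<in> S. u (B i) \<noteq> 0}"
    have A: "finite A" "A \<noteq> {}" using S t(4) by (auto simp: A_def)
    then have "Min (f ` A) \<in> f ` A" by simp
    then obtain i where i: "i \<in> A" "f i = Min (f ` A)" by force
    then have min: "f i \<le> f j" if "j \<in> A" for j using A that by simp
    have inj': "inj_on B S" using inj S(1) by (rule inj_on_subset)
    have "0 = (\<Sum>j\<in>S. u (B j) * mcoeff (B j) (e i))"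
      using arg_cong[OF t(3), of "\<lambda>g. mcoeff g (e i)"] by (simp add: S(3) sum.reindex[OF inj'])
    also have "\<dots> = (\<Sum>j\<in>{i}. u (B j) * mcoeff (B j) (e i))"
    proof (rule sum.mono_neutral_right)
      show "\<forall>j\<in>S - {i}. u (B j) * mcoeff (B j) (e i) = 0"
      proof
        fix j assume j: "j \<in> S - {i}"
        show "u (B j) * mcoeff (B j) (e i) = 0"
        proof (rule ccontr)
          assume "u (B j) * mcoeff (B j) (e i) \<noteq> 0"
          then have "j \<in> A" "f j < f i"
            using j off[of j i] S(1) i(1) by (auto simp: A_def)
          with min[of j] show False by simp
        qed
      qed
    qed (use S i in \<open>auto simp: A_def\<close>)
    finally show False using i diag[of i] S(1) by (auto simp: A_def)
  qed
qed

text \<open>A counting argument replaces the invertibility of transition matrices.\<close>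

lemma span_eq_of_card:
  fixes S T :: "'a::field mfps set"
  assumes "mfps.independent S" "S \<subseteq> mfps.span T" "finite T" "card T \<le> card S"
  shows "mfps.span T \<subseteq> mfps.span S"
proof
  fix x assume x: "x \<in> mfps.span T"
  show "x \<in> mfps.span S"
  proof (rule ccontr)
    assume "x \<notin> mfps.span S"
    then have "mfps.independent (insert x S)" "x \<notin> S"
      using mfps.independent_insertI[OF _ assms(1)] mfps.span_base by blast+
    from mfps.independent_span_bound[OF assms(3) this(1)] this(2) show False
      using x assms by auto
  qed
qed

lemma span_imageE:
  fixes B :: "'i \<Rightarrow> 'a::field mfps"
  assumes "f \<in> mfps.span (B ` S)" "finite S" "inj_on B S"
  obtains c where "f = (\<Sum>i\<in>S. mscale (c i) (B i))"
proof -
  obtain u where "f = (\<Sum>v\<in>B ` S. mscale (u v) v)"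
    using assms(1,2) by (auto simp: mfps.span_finite)
  also have "\<dots> = (\<Sum>i\<in>S. mscale (u (B i)) (B i))"
    using assms(3) by (simp add: sum.reindex)
  finally show ?thesis by (rule that)
qed

text \<open>Ties \<open>expansion\<close>, which refers to a representation over the whole infinite
  basis, to explicit finite sums. Injectivity of \<open>B\<close> recovers the index from the basis
  element.\<close>

lemma expansion_sum:
  fixes B :: "nat list \<Rightarrow> 'a::field mfps"
  assumes ind: "mfps.independent (B ` {\<mu>. is_partition \<mu>})" and inj: "inj_on B {\<mu>. is_partition \<mu>}"
    and S: "finite S" "S \<subseteq> {\<mu>. is_partition \<mu>}" and f: "f = (\<Sum>\<mu>\<in>S. mscale (c \<mu>) (B \<mu>))"
  shows "expansion B f \<nu> = (if \<nu> \<in> S then c \<nu> else 0)"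
proof (cases "is_partition \<nu>")
  case True
  let ?B = "B ` {\<mu>. is_partition \<mu>}"
  have sp: "B \<mu> \<in> mfps.span ?B" if "\<mu> \<in> S" for \<mu> using that S(2) by (auto intro!: mfps.span_base)
  have "mfps.representation ?B f (B \<nu>) = (\<Sum>\<mu>\<in>S. mfps.representation ?B (mscale (c \<mu>) (B \<mu>)) (B \<nu>))"
    unfolding f using ind sp by (subst mfps.representation_sum) (auto intro: mfps.span_scale)
  also have "\<dots> = (\<Sum>\<mu>\<in>S. c \<mu> * (if \<mu> = \<nu> then 1 else 0))"
  proof (rule sum.cong[OF refl])
    fix \<mu> assume \<mu>: "\<mu> \<in> S"
    have "mfps.representation ?B (B \<mu>) (B \<nu>) = (if B \<nu> = B \<mu> then 1 else 0)"
      using \<mu> S(2) ind by (subst mfps.representation_basis) auto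
    also have "B \<nu> = B \<mu> \<longleftrightarrow> \<mu> = \<nu>" using inj True \<mu> S(2) by (auto dest: inj_onD)
    finally show "mfps.representation ?B (mscale (c \<mu>) (B \<mu>)) (B \<nu>) = c \<mu> * (if \<mu> = \<nu> then 1 else 0)"
      using ind sp[OF \<mu>] by (simp add: mfps.representation_scale)
  qed
  also have "\<dots> = (if \<nu> \<in> S then c \<nu> else 0)"
    using S(1) by (simp add: if_distrib sum.delta' cong: if_cong)
  finally show ?thesis using True by (simp add: expansion_def)
qed (use S in \<open>auto simp: expansion_def\<close>)


section \<open>Exponents of monomials and partitions\<close>

definition exponents :: "(nat \<Rightarrow>\<^sub>0 nat) \<Rightarrow> nat multiset" where
  "exponents m = image_mset (Poly_Mapping.lookup m) (mset_set (Poly_Mapping.keys m))"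

definition mdeg :: "(nat \<Rightarrow>\<^sub>0 nat) \<Rightarrow> nat" where
  "mdeg m = (\<Sum>i\<in>Poly_Mapping.keys m. Poly_Mapping.lookup m i)"

definition parts :: "nat \<Rightarrow> nat list set" where
  "parts n = {\<mu>. is_partition \<mu> \<and> sum_list \<mu> = n}"

definition partition_of :: "nat multiset \<Rightarrow> nat list" where
  "partition_of M = rev (sorted_list_of_multiset M)"

lemma mdeg_eq_sum:
  "finite A \<Longrightarrow> Poly_Mapping.keys m \<subseteq> A \<Longrightarrow> mdeg m = (\<Sum>i\<in>A. Poly_Mapping.lookup m i)"
  unfolding mdeg_def by (rule sum.mono_neutral_left) (auto simp: in_keys_iff)

lemma mdeg_add: "mdeg (a + b) = mdeg a + mdeg b"
proof -
  let ?A = "Poly_Mapping.keys a \<union> Poly_Mapping.keys b"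
  have "Poly_Mapping.keys (a + b) \<subseteq> ?A" by (rule keys_add)
  then show ?thesis
    by (simp add: mdeg_eq_sum[of ?A] lookup_add sum.distrib)
qed

lemma mdeg_single [simp]: "mdeg (Poly_Mapping.single i k) = k"
  by (simp add: mdeg_def)

lemma mdeg_zero [simp]: "mdeg 0 = 0"
  by (simp add: mdeg_def)

lemma sum_mset_exponents: "sum_mset (exponents m) = mdeg m"
  by (simp add: exponents_def mdeg_def sum_unfold_sum_mset)

lemma zero_notin_exponents: "0 \<notin># exponents m"
  by (auto simp: exponents_def in_keys_iff)

lemma mset_partition_of [simp]: "mset (partition_of M) = M"
  by (simp add: partition_of_def)

lemma is_partition_partition_of: "0 \<notin># M \<Longrightarrow> is_partition (partition_of M)"
  by (simp add: is_partition_def partition_of_def sorted_wrt_rev)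

lemma is_partition_unique: "is_partition \<mu> \<Longrightarrow> is_partition \<nu> \<Longrightarrow> mset \<mu> = mset \<nu> \<Longrightarrow> \<mu> = \<nu>"
proof -
  assume "is_partition \<mu>" "is_partition \<nu>" and eq: "mset \<mu> = mset \<nu>"
  then have "sorted (rev \<mu>)" "sorted (rev \<nu>)" by (simp_all add: is_partition_def sorted_wrt_rev)
  moreover have "mset (rev \<mu>) = mset (rev \<nu>)" using eq by simp
  ultimately have "rev \<mu> = rev \<nu>" by (metis properties_for_sort)
  then show "\<mu> = \<nu>" by simp
qed

lemma partition_of_mset: "is_partition \<mu> \<Longrightarrow> partition_of (mset \<mu>) = \<mu>"
  by (intro is_partition_unique is_partition_partition_of) (auto simp: is_partition_def)

lemma partition_of_exponents: "partition_of (exponents m) \<in> parts (mdeg m)"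
  by (simp add: parts_def is_partition_partition_of zero_notin_exponents sum_mset_exponents
        flip: sum_mset_sum_list)

text \<open>\<open>Poly_Mapping.nth \<mu>\<close> is the monomial in which \<open>x_i\<close> has
  exponent \<open>\<mu> ! i\<close>. It serves as representative of all monomials with these
  exponents.\<close>

lemma exponents_nth:
  assumes "is_partition \<mu>"
  shows "exponents (Poly_Mapping.nth \<mu>) = mset \<mu>"
proof -
  have "\<mu> ! i \<noteq> 0" if "i < length \<mu>" for i
    using assms nth_mem[OF that] by (metis is_partition_def)
  then have "Poly_Mapping.keys (Poly_Mapping.nth \<mu>) = {..<length \<mu>}"
    by (auto simp: in_keys_iff nth_default_def simp del: keys_nth split: if_splits)
  then have "exponents (Poly_Mapping.nth \<mu>) = image_mset ((!) \<mu>) (mset_set {..<length \<mu>})"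
    unfolding exponents_def by (auto intro!: image_mset_cong simp: nth_default_def)
  also have "\<dots> = mset (map ((!) \<mu>) [0..<length \<mu>])"
    by (simp only: mset_map mset_upt lessThan_atLeast0)
  finally show ?thesis by (simp add: map_nth)
qed

lemma mdeg_nth: "is_partition \<mu> \<Longrightarrow> mdeg (Poly_Mapping.nth \<mu>) = sum_list \<mu>"
  by (metis exponents_nth sum_mset_exponents sum_mset_sum_list)

lemma finite_parts: "finite (parts n)"
proof (rule finite_subset)
  show "finite {xs. set xs \<subseteq> {..n} \<and> length xs \<le> n}"
    by (rule finite_lists_length_le) simp
  have "length xs \<le> sum_list xs" if "0 \<notin> set xs" for xs :: "nat list"
    using that by (induction xs) auto
  then show "parts n \<subseteq> {xs. set xs \<subseteq> {..n} \<and> length xs \<le> n}"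
    using member_le_sum_list by (force simp: parts_def is_partition_def)
qed

lemma parts_subset: "parts n \<subseteq> {\<mu>. is_partition \<mu>}"
  by (auto simp: parts_def)


section \<open>Symmetric series and the monomial basis\<close>

definition invariant :: "'a mfps \<Rightarrow> bool" where
  "invariant f \<longleftrightarrow> (\<forall>\<pi> m. bij \<pi> \<longrightarrow> mcoeff f (Poly_Mapping.map_key \<pi> m) = mcoeff f m)"

definition homogeneous :: "nat \<Rightarrow> 'a::zero mfps \<Rightarrow> bool" where
  "homogeneous n f \<longleftrightarrow> (\<forall>m. mcoeff f m \<noteq> 0 \<longrightarrow> mdeg m = n)"

lemma lookup_map_key: "inj f \<Longrightarrow> Poly_Mapping.lookup (Poly_Mapping.map_key f m) i = Poly_Mapping.lookup m (f i)"
  by (simp add: map_key.rep_eq)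

text \<open>On the union of the two supports both exponent functions take the same multiset of
  values once padded with zeros, so a permutation of this finite set matches them. It fixes
  everything else.\<close>

lemma exponents_eq_imp_map_key:
  assumes "exponents m = exponents m'"
  obtains \<pi> where "bij \<pi>" "m' = Poly_Mapping.map_key \<pi> m"
proof -
  define U where "U = Poly_Mapping.keys m \<union> Poly_Mapping.keys m'"
  have U: "finite U" by (simp add: U_def)
  have *: "image_mset (Poly_Mapping.lookup x) (mset_set U) =
      exponents x + replicate_mset (card U - size (exponents x)) 0"
    if "Poly_Mapping.keys x \<subseteq> U" for x
  proof -
    have "mset_set U = mset_set (Poly_Mapping.keys x) + mset_set (U - Poly_Mapping.keys x)"
      using that U by (metis Diff_disjoint Un_Diff_cancel finite_Diff finite_keys mset_set_Union sup.absorb2)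
    moreover have "image_mset (Poly_Mapping.lookup x) (mset_set (U - Poly_Mapping.keys x)) =
        image_mset (\<lambda>_. 0) (mset_set (U - Poly_Mapping.keys x))"
      using U by (intro image_mset_cong) (auto simp: in_keys_iff)
    moreover have "card (U - Poly_Mapping.keys x) = card U - size (exponents x)"
      using that by (simp add: card_Diff_subset exponents_def)
    ultimately show ?thesis by (simp add: exponents_def image_mset_const_eq)
  qed
  have "image_mset (Poly_Mapping.lookup m') (mset_set U) = image_mset (Poly_Mapping.lookup m) (mset_set U)"
    using *[of m] *[of m'] assms by (simp add: U_def)
  from image_mset_eq_implies_permutes[OF U this] obtain p where
    p: "p permutes U" "\<forall>x\<in>U. Poly_Mapping.lookup m' x = Poly_Mapping.lookup m (p x)" by blast
  have bij: "bij p" using p(1) by (rule permutes_bij)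
  have "Poly_Mapping.lookup m' x = Poly_Mapping.lookup m (p x)" for x
  proof (cases "x \<in> U")
    case False
    then have "p x = x" using p(1) by (auto simp: permutes_def)
    then show ?thesis using False by (auto simp: U_def in_keys_iff)
  qed (use p in auto)
  then have "m' = Poly_Mapping.map_key p m"
    by (intro poly_mapping_eqI) (simp add: lookup_map_key bij_is_inj[OF bij])
  with bij that show ?thesis by blast
qed

lemma invariant_mcoeff_cong:
  assumes "invariant f" "exponents m = exponents m'"
  shows "mcoeff f m = mcoeff f m'"
  using exponents_eq_imp_map_key[OF assms(2)] assms(1) unfolding invariant_def by metis

lemma mcoeff_monomial_sym:
  "mcoeff (monomial_sym \<mu>) m = (if exponents m = mset \<mu> then 1 else 0 :: 'a::comm_ring_1)"
  by (simp add: monomial_sym_def exponents_def)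

lemma monomial_sym_basis:
  "inj_on (monomial_sym :: _ \<Rightarrow> 'a::field mfps) {\<mu>. is_partition \<mu>}"
  "mfps.independent ((monomial_sym :: _ \<Rightarrow> 'a mfps) ` {\<mu>. is_partition \<mu>})"
proof -
  have 1: "mcoeff (monomial_sym \<mu> :: 'a mfps) (Poly_Mapping.nth \<mu>) \<noteq> 0" if "\<mu> \<in> {\<mu>. is_partition \<mu>}" for \<mu>
    using that by (simp add: mcoeff_monomial_sym exponents_nth)
  \<comment> \<open>Off-diagonal coefficients vanish, so the assumptions are contradictory and a
    constant rank is enough.\<close>
  have 2: "(0::int) < 0" if "\<mu> \<in> {\<mu>. is_partition \<mu>}" "\<nu> \<in> {\<mu>. is_partition \<mu>}" "\<mu> \<noteq> \<nu>"
    "mcoeff (monomial_sym \<mu> :: 'a mfps) (Poly_Mapping.nth \<nu>) \<noteq> 0" for \<mu> \<nu>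
    using that is_partition_unique[of \<nu> \<mu>] by (auto simp: mcoeff_monomial_sym exponents_nth split: if_splits)
  show "inj_on (monomial_sym :: _ \<Rightarrow> 'a::field mfps) {\<mu>. is_partition \<mu>}"
    by (rule triangular_family(1)[OF 1 2])
  show "mfps.independent ((monomial_sym :: _ \<Rightarrow> 'a mfps) ` {\<mu>. is_partition \<mu>})"
    by (rule triangular_family(2)[OF 1 2])
qed

lemma invariant_monomial_expansion:
  fixes f :: "'a::field mfps"
  assumes f: "invariant f" and S: "finite S" "S \<subseteq> {\<mu>. is_partition \<mu>}"
    and supp: "\<And>m. mcoeff f m \<noteq> 0 \<Longrightarrow> partition_of (exponents m) \<in> S"
  shows "f = (\<Sum>\<mu>\<in>S. mscale (mcoeff f (Poly_Mapping.nth \<mu>)) (monomial_sym \<mu>))"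
proof (rule mfps_eqI)
  fix m
  let ?\<mu> = "partition_of (exponents m)"
  have part: "is_partition ?\<mu>" by (simp add: is_partition_partition_of zero_notin_exponents)
  have "(\<Sum>\<mu>\<in>S. mcoeff f (Poly_Mapping.nth \<mu>) * mcoeff (monomial_sym \<mu>) m) =
      (\<Sum>\<mu>\<in>S. if ?\<mu> = \<mu> then mcoeff f (Poly_Mapping.nth ?\<mu>) else 0)"
    using S(2) part is_partition_unique
    by (intro sum.cong) (auto simp: mcoeff_monomial_sym partition_of_mset)
  also have "\<dots> = (if ?\<mu> \<in> S then mcoeff f (Poly_Mapping.nth ?\<mu>) else 0)"
    using S(1) by simp
  also have "mcoeff f (Poly_Mapping.nth ?\<mu>) = mcoeff f m"
    by (rule invariant_mcoeff_cong[OF f]) (simp add: exponents_nth part)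
  also have "(if ?\<mu> \<in> S then mcoeff f m else 0) = mcoeff f m" using supp by auto
  finally show "mcoeff f m = mcoeff (\<Sum>\<mu>\<in>S. mscale (mcoeff f (Poly_Mapping.nth \<mu>)) (monomial_sym \<mu>)) m"
    by simp
qed

lemma homogeneous_in_span_monomial:
  fixes f :: "'a::field mfps"
  assumes "invariant f" "homogeneous n f"
  shows "f \<in> mfps.span (monomial_sym ` parts n)"
proof -
  have "f = (\<Sum>\<mu>\<in>parts n. mscale (mcoeff f (Poly_Mapping.nth \<mu>)) (monomial_sym \<mu>))"
    using partition_of_exponents assms(2)
    by (intro invariant_monomial_expansion assms finite_parts parts_subset) (auto simp: homogeneous_def)
  also have "\<dots> \<in> mfps.span (monomial_sym ` parts n)"
    by (intro mfps.span_sum mfps.span_scale mfps.span_base) auto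
  finally show ?thesis .
qed

text \<open>Translates the triangularity and normalization of \<open>jack_family\<close> into
  statements about coefficients. The bounded degree makes the expansion finite.\<close>

lemma expansion_monomial_sym:
  fixes f :: "'a::field mfps"
  assumes f: "symmetric_function f" and \<nu>: "is_partition \<nu>"
  shows "expansion monomial_sym f \<nu> = mcoeff f (Poly_Mapping.nth \<nu>)"
proof -
  obtain d where d: "\<And>m. mcoeff f m \<noteq> 0 \<Longrightarrow> mdeg m \<le> d"
    using f by (auto simp: symmetric_function_def mdeg_def)
  define S where "S = (\<Union>n\<in>{..d}. parts n)"
  have S: "finite S" "S \<subseteq> {\<mu>. is_partition \<mu>}"
    using finite_parts parts_subset by (auto simp: S_def)
  have "f = (\<Sum>\<mu>\<in>S. mscale (mcoeff f (Poly_Mapping.nth \<mu>)) (monomial_sym \<mu>))"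
    using f d partition_of_exponents
    by (intro invariant_monomial_expansion S) (auto simp: symmetric_function_def invariant_def S_def)
  from expansion_sum[OF monomial_sym_basis(2,1) S this, of \<nu>]
  have "expansion monomial_sym f \<nu> = (if \<nu> \<in> S then mcoeff f (Poly_Mapping.nth \<nu>) else 0)" .
  moreover have "\<nu> \<in> S" if "mcoeff f (Poly_Mapping.nth \<nu>) \<noteq> 0"
    using d[OF that] \<nu> by (auto simp: mdeg_nth S_def parts_def)
  ultimately show ?thesis by auto
qed


section \<open>Power sums\<close>

text \<open>For \<open>k > 0\<close> the monomials \<open>x_i^k\<close> are distinct, so the
  convolution runs over the variables from which \<open>x_i^k\<close> can be split off.\<close>

lemma mcoeff_power_sum_mult:
  fixes f :: "'a::comm_ring_1 mfps"
  assumes "k > 0"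
  shows "mcoeff (power_sum k * f) m =
    (\<Sum>i | k \<le> Poly_Mapping.lookup m i. mcoeff f (m - Poly_Mapping.single i k))"
proof -
  have split: "Poly_Mapping.single i k + (m - Poly_Mapping.single i k) = m" if "k \<le> Poly_Mapping.lookup m i" for i
    using that by (intro poly_mapping_eqI) (auto simp: lookup_add lookup_minus lookup_single when_def)
  have inj: "inj_on (\<lambda>i. Poly_Mapping.single i k) A" for A :: "nat set"
    using assms by (auto simp: inj_on_def) (metis keys_single less_irrefl singleton_inject)
  have "mcoeff (power_sum k * f) m =
      (\<Sum>(a, b)\<in>msplits m. (if \<exists>i. a = Poly_Mapping.single i k then 1 else 0) * mcoeff f b)"
    by (simp add: mcoeff_mult power_sum_def)
  also have "\<dots> = (\<Sum>(a, b)\<in>(\<lambda>i. (Poly_Mapping.single i k, m - Poly_Mapping.single i k)) `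
      {i. k \<le> Poly_Mapping.lookup m i}. mcoeff f b)"
  proof (rule sum.mono_neutral_cong_right)
    show "(\<lambda>i. (Poly_Mapping.single i k, m - Poly_Mapping.single i k)) ` {i. k \<le> Poly_Mapping.lookup m i} \<subseteq> msplits m"
      using split by auto
    have "(a, b) \<in> (\<lambda>i. (Poly_Mapping.single i k, m - Poly_Mapping.single i k)) ` {i. k \<le> Poly_Mapping.lookup m i}"
      if "a + b = m" "a = Poly_Mapping.single i k" for a b i
      using that by (auto simp: image_iff lookup_add lookup_single intro!: exI[of _ i])
    then show "\<forall>x\<in>msplits m - (\<lambda>i. (Poly_Mapping.single i k, m - Poly_Mapping.single i k)) ` {i. k \<le> Poly_Mapping.lookup m i}.
        (case x of (a, b) \<Rightarrow> (if \<exists>i. a = Poly_Mapping.single i k then 1 else 0) * mcoeff f b) = 0"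
      by (auto simp: msplits_def)
  qed auto
  also have "\<dots> = (\<Sum>i | k \<le> Poly_Mapping.lookup m i. mcoeff f (m - Poly_Mapping.single i k))"
    by (subst sum.reindex) (use inj in \<open>auto simp: inj_on_def\<close>)
  finally show ?thesis .
qed

lemma finite_lookup_ge:
  fixes m :: "'b \<Rightarrow>\<^sub>0 nat"
  assumes "k > 0"
  shows "finite {i. k \<le> Poly_Mapping.lookup m i}"
proof (rule finite_subset)
  show "{i. k \<le> Poly_Mapping.lookup m i} \<subseteq> Poly_Mapping.keys m"
  proof
    fix i assume "i \<in> {i. k \<le> Poly_Mapping.lookup m i}"
    then have "k \<le> Poly_Mapping.lookup m i" by simp
    then have "Poly_Mapping.lookup m i \<noteq> 0" using assms by linarith
    then show "i \<in> Poly_Mapping.keys m" by (simp add: in_keys_iff)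
  qed
qed simp

lemma map_key_inv:
  assumes "bij \<pi>"
  shows "Poly_Mapping.map_key (inv \<pi>) (Poly_Mapping.map_key \<pi> m) = m"
    and "Poly_Mapping.map_key \<pi> (Poly_Mapping.map_key (inv \<pi>) m) = m"
  using assms bij_imp_bij_inv[OF assms]
  by (auto intro!: poly_mapping_eqI simp: lookup_map_key bij_is_inj bij_is_surj surj_f_inv_f)

lemma invariant_one: "invariant (1 :: 'a::comm_ring_1 mfps)"
proof -
  have "Poly_Mapping.map_key \<pi> m = 0 \<longleftrightarrow> m = 0" if "bij \<pi>" for \<pi> :: "nat \<Rightarrow> nat" and m :: "nat \<Rightarrow>\<^sub>0 nat"
    using that bij_is_surj[OF that] bij_is_inj[OF that]
    by (auto simp: poly_mapping_eq_iff fun_eq_iff lookup_map_key) (metis surjD)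
  then show ?thesis by (simp add: invariant_def mcoeff_one)
qed

lemma invariant_power_sum: "invariant (power_sum k :: 'a::comm_ring_1 mfps)"
proof -
  have "(\<exists>i. Poly_Mapping.map_key \<pi> m = Poly_Mapping.single i k) \<longleftrightarrow> (\<exists>i. m = Poly_Mapping.single i k)"
    if "bij \<pi>" for \<pi> :: "nat \<Rightarrow> nat" and m :: "nat \<Rightarrow>\<^sub>0 nat"
  proof -
    have inj: "inj \<pi>" "inj (inv \<pi>)" using that by (simp_all add: bij_is_inj bij_imp_bij_inv)
    note inv = map_key_inv(1)[OF that, of m]
    have s: "Poly_Mapping.map_key \<pi> (Poly_Mapping.single i k) = Poly_Mapping.single (inv \<pi> i) k" for i
      using map_key_single[OF inj(1), of "inv \<pi> i" k] that by (simp add: bij_is_surj surj_f_inv_f)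
    have t: "Poly_Mapping.map_key (inv \<pi>) (Poly_Mapping.single i k) = Poly_Mapping.single (\<pi> i) k" for i
      using map_key_single[OF inj(2), of "\<pi> i" k] that by (simp add: bij_is_inj)
    show ?thesis using inv s t by metis
  qed
  then show ?thesis by (simp add: invariant_def power_sum_def)
qed

lemma invariant_mult:
  fixes f g :: "'a::comm_ring_1 mfps"
  assumes "invariant f" "invariant g"
  shows "invariant (f * g)"
  unfolding invariant_def
proof (intro allI impI)
  fix \<pi> :: "nat \<Rightarrow> nat" and m assume \<pi>: "bij \<pi>"
  let ?h = "\<lambda>(a, b). (Poly_Mapping.map_key \<pi> a, Poly_Mapping.map_key \<pi> b)"
  let ?h' = "\<lambda>(a, b). (Poly_Mapping.map_key (inv \<pi>) a, Poly_Mapping.map_key (inv \<pi>) b)"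
  have inj: "inj \<pi>" "inj (inv \<pi>)" using \<pi> by (simp_all add: bij_is_inj bij_imp_bij_inv)
  note inv1 = map_key_inv(1)[OF \<pi>] and inv2 = map_key_inv(2)[OF \<pi>]
  have "mcoeff (f * g) m = (\<Sum>(a, b)\<in>msplits m. mcoeff f a * mcoeff g b)" by (rule mcoeff_mult)
  also have "\<dots> = (\<Sum>(a, b)\<in>msplits (Poly_Mapping.map_key \<pi> m). mcoeff f a * mcoeff g b)"
  proof (rule sum.reindex_bij_witness[of _ ?h' ?h])
    fix x assume "x \<in> msplits (Poly_Mapping.map_key \<pi> m)"
    then obtain a b where x: "x = (a, b)" "a + b = Poly_Mapping.map_key \<pi> m" by (cases x) auto
    then have "Poly_Mapping.map_key (inv \<pi>) a + Poly_Mapping.map_key (inv \<pi>) b = m"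
      using map_key_plus[OF inj(2), of a b] inv1[of m] by simp
    then show "?h' x \<in> msplits m" by (simp add: x)
  qed (use assms \<pi> inv1 inv2 in \<open>auto simp: invariant_def map_key_plus[OF inj(1), symmetric]\<close>)
  finally show "mcoeff (f * g) (Poly_Mapping.map_key \<pi> m) = mcoeff (f * g) m" by (simp add: mcoeff_mult)
qed

lemma invariant_power_sym: "invariant (power_sym \<mu> :: 'a::comm_ring_1 mfps)"
  by (induction \<mu>) (simp_all add: power_sym_def invariant_one invariant_mult invariant_power_sum)

lemma power_sym_Cons: "power_sym (k # \<mu>) = power_sum k * power_sym \<mu>"
  by (simp add: power_sym_def)

text \<open>The parts of \<open>\<mu>\<close> are distributed over the variables, so a monomial of \<open>p\<^sub>\<mu>\<close> merges parts.\<close>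

lemma power_sym_support:
  assumes "0 \<notin> set \<mu>" "mcoeff (power_sym \<mu> :: 'a::comm_ring_1 mfps) m \<noteq> 0"
  shows "card (Poly_Mapping.keys m) \<le> length \<mu>"
    and "card (Poly_Mapping.keys m) = length \<mu> \<Longrightarrow> exponents m = mset \<mu>"
    and "mdeg m = sum_list \<mu>"
proof -
  have "card (Poly_Mapping.keys m) \<le> length \<mu> \<and>
      (card (Poly_Mapping.keys m) = length \<mu> \<longrightarrow> exponents m = mset \<mu>) \<and> mdeg m = sum_list \<mu>"
    using assms
  proof (induction \<mu> arbitrary: m)
    case Nil
    then have "m = 0" by (simp add: power_sym_def mcoeff_one split: if_splits)
    then show ?case by (simp add: exponents_def)
  next
    case (Cons k \<mu>)
    have k: "k > 0" using Cons.prems by auto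
    have "(\<Sum>i | k \<le> Poly_Mapping.lookup m i. mcoeff (power_sym \<mu> :: 'a mfps) (m - Poly_Mapping.single i k)) \<noteq> 0"
      using Cons.prems by (simp add: power_sym_Cons mcoeff_power_sum_mult[OF k])
    then obtain i where i: "k \<le> Poly_Mapping.lookup m i"
        "mcoeff (power_sym \<mu> :: 'a mfps) (m - Poly_Mapping.single i k) \<noteq> 0"
      by (auto elim: sum.not_neutral_contains_not_neutral)
    define b where "b = m - Poly_Mapping.single i k"
    have m: "m = Poly_Mapping.single i k + b"
      unfolding b_def using i(1)
      by (intro poly_mapping_eqI) (auto simp: lookup_add lookup_minus lookup_single when_def)
    have IH: "card (Poly_Mapping.keys b) \<le> length \<mu>"
        "card (Poly_Mapping.keys b) = length \<mu> \<Longrightarrow> exponents b = mset \<mu>" "mdeg b = sum_list \<mu>"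
      using Cons.IH[of b] Cons.prems i(2) by (auto simp: b_def)
    have keys: "Poly_Mapping.keys m = insert i (Poly_Mapping.keys b)"
      using k by (auto simp: m in_keys_iff lookup_add lookup_single when_def split: if_splits)
    have deg: "mdeg m = k + mdeg b" by (subst m) (simp add: mdeg_add)
    show ?case
    proof (cases "i \<in> Poly_Mapping.keys b")
      \<comment> \<open>The part \<open>k\<close> merges into a variable already in use, so the
        number of variables stays below the number of parts.\<close>
      case True
      then show ?thesis using IH by (simp add: keys insert_absorb deg)
    next
      case False
      then have "Poly_Mapping.lookup b i = 0" by (simp add: in_keys_iff)
      then have "Poly_Mapping.lookup m i = k" by (simp add: m lookup_add)
      moreover have "image_mset (Poly_Mapping.lookup m) (mset_set (Poly_Mapping.keys b)) = exponents b"
        unfolding exponents_def using False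
        by (intro image_mset_cong) (auto simp: m lookup_add lookup_single when_def)
      ultimately have "exponents m = add_mset k (exponents b)"
        using False by (simp add: exponents_def[of m] keys)
      then show ?thesis using IH False by (simp add: keys deg)
    qed
  qed
  then show "card (Poly_Mapping.keys m) \<le> length \<mu>" "mdeg m = sum_list \<mu>"
    "card (Poly_Mapping.keys m) = length \<mu> \<Longrightarrow> exponents m = mset \<mu>" by auto
qed

lemma mcoeff_power_sym_nonneg:
  assumes "0 \<notin> set \<mu>"
  shows "mcoeff (power_sym \<mu> :: 'a::linordered_field mfps) m \<ge> 0"
  using assms
proof (induction \<mu> arbitrary: m)
  case (Cons k \<mu>)
  then have "k > 0" by auto
  then show ?case using Cons by (auto simp: power_sym_Cons mcoeff_power_sum_mult intro!: sum_nonneg)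
qed (simp add: power_sym_def mcoeff_one)

text \<open>Sending the parts to different variables contributes positively, and over an ordered
  field the nonnegative other contributions cannot cancel it.\<close>

lemma mcoeff_power_sym_pos:
  assumes "exponents m = mset \<mu>"
  shows "mcoeff (power_sym \<mu> :: 'a::linordered_field mfps) m > 0"
  using assms
proof (induction \<mu> arbitrary: m)
  case Nil
  then have "Poly_Mapping.keys m = {}" by (simp add: exponents_def mset_set_empty_iff)
  then have "m = 0" by (simp add: poly_mapping_eqI in_keys_iff flip: ex_in_conv)
  then show ?case by (simp add: power_sym_def mcoeff_one)
next
  case (Cons k \<mu>)
  have "0 \<notin> set (k # \<mu>)" using zero_notin_exponents[of m] Cons.prems by (metis set_mset_mset)
  then have k: "k > 0" "0 \<notin> set \<mu>" by auto
  have "k \<in># exponents m" using Cons.prems by simp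
  then obtain i where i: "i \<in> Poly_Mapping.keys m" "Poly_Mapping.lookup m i = k"
    by (auto simp: exponents_def)
  define b where "b = m - Poly_Mapping.single i k"
  have keys: "Poly_Mapping.keys b = Poly_Mapping.keys m - {i}"
    using i by (auto simp: b_def in_keys_iff lookup_minus lookup_single when_def split: if_splits)
  have lb: "Poly_Mapping.lookup b j = Poly_Mapping.lookup m j" if "j \<noteq> i" for j
    using that by (simp add: b_def lookup_minus lookup_single)
  have "exponents m = add_mset k (exponents b)"
  proof -
    have "mset_set (Poly_Mapping.keys m) = add_mset i (mset_set (Poly_Mapping.keys b))"
      using i(1) by (simp add: keys mset_set.remove)
    moreover have "image_mset (Poly_Mapping.lookup m) (mset_set (Poly_Mapping.keys b)) = exponents b"
      unfolding exponents_def using lb keys by (intro image_mset_cong) auto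
    ultimately show ?thesis using i(2) by (simp add: exponents_def[of m])
  qed
  then have "mcoeff (power_sym \<mu> :: 'a mfps) b > 0" using Cons by simp
  also have "mcoeff (power_sym \<mu> :: 'a mfps) b \<le>
      (\<Sum>i | k \<le> Poly_Mapping.lookup m i. mcoeff (power_sym \<mu>) (m - Poly_Mapping.single i k))"
    unfolding b_def using i(2) k
    by (intro member_le_sum[of i _ "\<lambda>i. mcoeff (power_sym \<mu>) (m - Poly_Mapping.single i k)"])
       (auto simp: mcoeff_power_sym_nonneg finite_lookup_ge)
  finally show ?case by (simp add: power_sym_Cons mcoeff_power_sum_mult[OF k(1)])
qed

text \<open>A monomial of a power sum product with as many variables as parts has the parts
  themselves as exponents; all others merge parts and are shorter. So minus the length is the
  rank.\<close>

lemma power_sym_basis: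
  "inj_on (power_sym :: _ \<Rightarrow> 'a::linordered_field mfps) {\<mu>. is_partition \<mu>}"
  "mfps.independent ((power_sym :: _ \<Rightarrow> 'a mfps) ` {\<mu>. is_partition \<mu>})"
proof -
  have 1: "mcoeff (power_sym \<mu> :: 'a mfps) (Poly_Mapping.nth \<mu>) \<noteq> 0" if "\<mu> \<in> {\<mu>. is_partition \<mu>}" for \<mu>
    using that mcoeff_power_sym_pos[of "Poly_Mapping.nth \<mu>" \<mu>, where ?'a = 'a] by (simp add: exponents_nth)
  have 2: "- int (length \<mu>) < - int (length \<nu>)" if "\<mu> \<in> {\<mu>. is_partition \<mu>}" "\<nu> \<in> {\<mu>. is_partition \<mu>}" "\<mu> \<noteq> \<nu>"
    "mcoeff (power_sym \<mu> :: 'a mfps) (Poly_Mapping.nth \<nu>) \<noteq> 0" for \<mu> \<nu>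
  proof -
    have "card (Poly_Mapping.keys (Poly_Mapping.nth \<nu>)) = length \<nu>"
      using arg_cong[OF exponents_nth[of \<nu>], of size] that by (simp add: exponents_def del: keys_nth)
    then have "length \<nu> \<le> length \<mu>" "length \<nu> = length \<mu> \<Longrightarrow> mset \<nu> = mset \<mu>"
      using power_sym_support[OF _ that(4)] that(1,2) by (simp_all add: is_partition_def exponents_nth)
    then show ?thesis using that is_partition_unique[of \<mu> \<nu>] by fastforce
  qed
  show "inj_on (power_sym :: _ \<Rightarrow> 'a mfps) {\<mu>. is_partition \<mu>}"
    by (rule triangular_family(1)[OF 1 2])
  show "mfps.independent ((power_sym :: _ \<Rightarrow> 'a mfps) ` {\<mu>. is_partition \<mu>})"
    by (rule triangular_family(2)[OF 1 2])
qed

lemma homogeneous_power_sym: "is_partition \<mu> \<Longrightarrow> homogeneous (sum_list \<mu>) (power_sym \<mu> :: 'a::comm_ring_1 mfps)"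
  using power_sym_support(3)[of \<mu>, where ?'a = 'a] by (auto simp: homogeneous_def is_partition_def)

lemma span_monomial_eq_span_power:
  "mfps.span (monomial_sym ` parts n :: 'a::linordered_field mfps set) = mfps.span (power_sym ` parts n)"
proof
  have sub: "power_sym ` parts n \<subseteq> mfps.span (monomial_sym ` parts n :: 'a mfps set)"
    using homogeneous_power_sym homogeneous_in_span_monomial[OF invariant_power_sym]
    by (fastforce simp: parts_def)
  then show "mfps.span (power_sym ` parts n) \<subseteq> mfps.span (monomial_sym ` parts n :: 'a mfps set)"
    by (rule mfps.span_minimal) simp
  have "card ((power_sym :: _ \<Rightarrow> 'a mfps) ` parts n) = card (parts n)"
    using inj_on_subset[OF power_sym_basis(1) parts_subset] by (rule card_image)
  then show "mfps.span (monomial_sym ` parts n :: 'a mfps set) \<subseteq> mfps.span (power_sym ` parts n)"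
    using sub finite_parts card_image_le[OF finite_parts, of monomial_sym n]
    by (intro span_eq_of_card mfps.independent_mono[OF power_sym_basis(2)] image_mono parts_subset) auto
qed


section \<open>The power sum expansion of the one-row functions\<close>

definition rising_coeff :: "'a::field_char_0 \<Rightarrow> nat \<Rightarrow> 'a" where
  "rising_coeff b k = pochhammer b k / fact k"

text \<open>The coefficient of \<open>t\<^sup>n\<close> in \<open>\<Prod>i. (1 - x\<^sub>i t) powr (- b)\<close>.\<close>

definition row_series :: "'a::field_char_0 \<Rightarrow> nat \<Rightarrow> 'a mfps" where
  "row_series b n = Abs_mfps (\<lambda>m. if mdeg m = n then
     (\<Prod>i\<in>Poly_Mapping.keys m. rising_coeff b (Poly_Mapping.lookup m i)) else 0)"

lemma rising_coeff_0 [simp]: "rising_coeff b 0 = 1"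
  by (simp add: rising_coeff_def)

text \<open>The coefficients of \<open>t F'(t) = b t / (1 - t) F(t)\<close> for
  \<open>F(t) = (1 - t)^(-b)\<close>.\<close>

lemma sum_rising_coeff: "b * (\<Sum>j<k. rising_coeff b j) = of_nat k * rising_coeff b k"
proof (induction k)
  case (Suc k)
  have "b * (\<Sum>j<Suc k. rising_coeff b j) = (b + of_nat k) * rising_coeff b k"
    by (simp add: distrib_left distrib_right Suc)
  also have "\<dots> = of_nat (Suc k) * rising_coeff b (Suc k)"
    by (simp add: rising_coeff_def pochhammer_Suc field_simps del: of_nat_Suc)
  finally show ?case .
qed simp

lemma rising_coeff_rec: "of_nat k * rising_coeff b k = b * (\<Sum>j=1..k. rising_coeff b (k - j))"
proof -
  have "(\<Sum>j=1..k. rising_coeff b (k - j)) = (\<Sum>j<k. rising_coeff b j)"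
    by (rule sum.reindex_bij_witness[of _ "\<lambda>j. k - j" "\<lambda>j. k - j"]) auto
  then show ?thesis by (simp add: sum_rising_coeff)
qed

lemma mcoeff_row_series:
  assumes "finite A" "Poly_Mapping.keys m \<subseteq> A"
  shows "mcoeff (row_series b n) m =
    (if mdeg m = n then (\<Prod>i\<in>A. rising_coeff b (Poly_Mapping.lookup m i)) else 0)"
proof -
  have "(\<Prod>i\<in>Poly_Mapping.keys m. rising_coeff b (Poly_Mapping.lookup m i)) =
      (\<Prod>i\<in>A. rising_coeff b (Poly_Mapping.lookup m i))"
    using assms by (intro prod.mono_neutral_left) (auto simp: in_keys_iff)
  then show ?thesis by (simp add: row_series_def)
qed

lemma row_series_0: "row_series b 0 = 1"
proof (rule mfps_eqI)
  fix m
  have "mdeg m = 0 \<longleftrightarrow> m = 0"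
    by (auto simp: mdeg_def in_keys_iff poly_mapping_eq_iff fun_eq_iff)
  then show "mcoeff (row_series b 0) m = mcoeff 1 m"
    by (simp add: row_series_def mcoeff_one)
qed

text \<open>A Newton identity, from the logarithmic derivative of
  \<open>\<Prod>i. (1 - x_i t)^(-b)\<close>. In each coefficient \<open>rising_coeff_rec\<close>
  applies to one variable at a time, and the factors \<open>?l i\<close> so produced add up to the
  degree \<open>n\<close>.\<close>

lemma row_series_rec:
  "mscale (of_nat n) (row_series b n) = mscale b (\<Sum>k=1..n. power_sum k * row_series b (n - k))"
proof (rule mfps_eqI)
  fix m :: "nat \<Rightarrow>\<^sub>0 nat"
  let ?K = "Poly_Mapping.keys m" and ?l = "Poly_Mapping.lookup m"
  have le: "?l i \<le> mdeg m" for i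
    by (cases "i \<in> ?K") (auto simp: mdeg_def in_keys_iff intro: member_le_sum)
  have split: "Poly_Mapping.single i k + (m - Poly_Mapping.single i k) = m" if "k \<le> ?l i" for i k
    using that by (intro poly_mapping_eqI) (auto simp: lookup_add lookup_minus lookup_single when_def)
  have deg: "mdeg (m - Poly_Mapping.single i k) + k = mdeg m" if "k \<le> ?l i" for i k
    using arg_cong[OF split[OF that], of mdeg] by (simp add: mdeg_add)
  have rhs: "mcoeff (mscale b (\<Sum>k=1..n. power_sum k * row_series b (n - k))) m =
      b * (\<Sum>k=1..n. \<Sum>i | k \<le> ?l i. mcoeff (row_series b (n - k)) (m - Poly_Mapping.single i k))"
    by (simp add: mcoeff_power_sum_mult)
  show "mcoeff (mscale (of_nat n) (row_series b n)) m =
      mcoeff (mscale b (\<Sum>k=1..n. power_sum k * row_series b (n - k))) m"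
  proof (cases "mdeg m = n")
    case False
    have "mcoeff (row_series b (n - k)) (m - Poly_Mapping.single i k) = 0"
      if "k \<in> {1..n}" "k \<le> ?l i" for i k
      using deg[OF that(2)] that False by (auto simp: row_series_def)
    then show ?thesis unfolding rhs using False by (simp add: row_series_def)
  next
    case True
    define R where "R i = (\<Prod>j\<in>?K - {i}. rising_coeff b (?l j))" for i
    have c: "mcoeff (row_series b (n - k)) (m - Poly_Mapping.single i k) = rising_coeff b (?l i - k) * R i"
      if "1 \<le> k" "k \<le> ?l i" for i k
    proof -
      have i: "i \<in> ?K" using that by (auto simp: in_keys_iff)
      have "Poly_Mapping.keys (m - Poly_Mapping.single i k) \<subseteq> ?K"
        by (auto simp: in_keys_iff lookup_minus)
      moreover have "mdeg (m - Poly_Mapping.single i k) = n - k" using deg[OF that(2)] True by simp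
      ultimately have "mcoeff (row_series b (n - k)) (m - Poly_Mapping.single i k) =
          (\<Prod>j\<in>?K. rising_coeff b (Poly_Mapping.lookup (m - Poly_Mapping.single i k) j))"
        by (simp add: mcoeff_row_series[of ?K])
      also have "\<dots> = rising_coeff b (?l i - k) *
          (\<Prod>j\<in>?K - {i}. rising_coeff b (Poly_Mapping.lookup (m - Poly_Mapping.single i k) j))"
        using i by (simp add: prod.remove lookup_minus)
      also have "(\<Prod>j\<in>?K - {i}. rising_coeff b (Poly_Mapping.lookup (m - Poly_Mapping.single i k) j)) = R i"
        unfolding R_def by (intro prod.cong) (auto simp: lookup_minus lookup_single when_def)
      finally show ?thesis .
    qed
    have "(\<Sum>k=1..n. \<Sum>i | k \<le> ?l i. mcoeff (row_series b (n - k)) (m - Poly_Mapping.single i k)) =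
        (\<Sum>k=1..n. \<Sum>i | i \<in> ?K \<and> k \<le> ?l i. rising_coeff b (?l i - k) * R i)"
      by (intro sum.cong refl) (auto simp: c in_keys_iff)
    also have "\<dots> = (\<Sum>i\<in>?K. \<Sum>k | k \<in> {1..n} \<and> k \<le> ?l i. rising_coeff b (?l i - k) * R i)"
      by (rule sum.swap_restrict) auto
    also have "\<dots> = (\<Sum>i\<in>?K. (\<Sum>k=1..?l i. rising_coeff b (?l i - k)) * R i)"
      unfolding sum_distrib_right using le True
      by (intro sum.cong refl) (auto intro: order_trans)
    finally have "mcoeff (mscale b (\<Sum>k=1..n. power_sum k * row_series b (n - k))) m =
        b * (\<Sum>i\<in>?K. (\<Sum>k=1..?l i. rising_coeff b (?l i - k)) * R i)"
      unfolding rhs by (rule arg_cong)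
    also have "\<dots> = (\<Sum>i\<in>?K. b * (\<Sum>k=1..?l i. rising_coeff b (?l i - k)) * R i)"
      by (subst sum_distrib_left) (simp only: mult.assoc)
    also have "\<dots> = (\<Sum>i\<in>?K. of_nat (?l i) * (\<Prod>j\<in>?K. rising_coeff b (?l j)))"
    proof (intro sum.cong refl)
      fix i assume "i \<in> ?K"
      then have "(\<Prod>j\<in>?K. rising_coeff b (?l j)) = rising_coeff b (?l i) * R i"
        by (simp add: R_def prod.remove)
      then show "b * (\<Sum>k=1..?l i. rising_coeff b (?l i - k)) * R i =
          of_nat (?l i) * (\<Prod>j\<in>?K. rising_coeff b (?l j))"
        unfolding rising_coeff_rec[symmetric] by (simp add: mult.assoc)
    qed
    also have "\<dots> = of_nat (mdeg m) * (\<Prod>j\<in>?K. rising_coeff b (?l j))"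
      by (simp add: mdeg_def flip: sum_distrib_right)
    finally show ?thesis using True by (simp add: row_series_def)
  qed
qed

text \<open>Multisets replace partition lists in the recurrence, where adjoining a part to a list
  would require sorting it again.\<close>

definition zee_mset :: "nat multiset \<Rightarrow> nat" where
  "zee_mset M = (\<Prod>i\<in>set_mset M. i ^ count M i * fact (count M i))"

definition power_mset :: "nat multiset \<Rightarrow> 'a::comm_ring_1 mfps" where
  "power_mset M = prod_mset (image_mset power_sum M)"

definition part_msets :: "nat \<Rightarrow> nat multiset set" where
  "part_msets n = {M. 0 \<notin># M \<and> sum_mset M = n}"

lemma zee_eq: "zee \<mu> = zee_mset (mset \<mu>)"
  by (simp add: zee_def zee_mset_def count_mset)

lemma power_sym_eq: "power_sym \<mu> = power_mset (mset \<mu>)"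
  by (simp add: power_sym_def power_mset_def prod_mset_prod_list flip: mset_map)

lemma bij_betw_mset_parts: "bij_betw mset (parts n) (part_msets n)"
proof (rule bij_betw_byWitness[where f' = partition_of])
  show "mset ` parts n \<subseteq> part_msets n"
    by (auto simp: parts_def part_msets_def is_partition_def sum_mset_sum_list)
  show "partition_of ` part_msets n \<subseteq> parts n"
    by (auto simp: parts_def part_msets_def is_partition_partition_of simp flip: sum_mset_sum_list)
qed (auto simp: parts_def partition_of_mset)

lemma finite_part_msets: "finite (part_msets n)"
  using bij_betw_finite[OF bij_betw_mset_parts] finite_parts by blast

lemma zee_mset_pos: "0 \<notin># M \<Longrightarrow> zee_mset M > 0"
  unfolding zee_mset_def by (rule prod_pos) (metis fact_gt_zero gr0I mult_pos_pos zero_less_power)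

lemma zee_mset_add: "zee_mset (add_mset k M) = zee_mset M * (k * Suc (count M k))"
proof -
  have eq: "zee_mset N = (\<Prod>i\<in>insert k (set_mset M). i ^ count N i * fact (count N i))"
    if "set_mset N \<subseteq> insert k (set_mset M)" for N
    unfolding zee_mset_def using that by (intro prod.mono_neutral_left) (auto simp: not_in_iff)
  let ?A = "insert k (set_mset M) - {k}"
  have "zee_mset (add_mset k M) = (k ^ Suc (count M k) * fact (Suc (count M k))) *
      (\<Prod>i\<in>?A. i ^ count (add_mset k M) i * fact (count (add_mset k M) i))"
    by (subst eq) (simp_all add: prod.insert_remove)
  also have "(\<Prod>i\<in>?A. i ^ count (add_mset k M) i * fact (count (add_mset k M) i)) =
      (\<Prod>i\<in>?A. i ^ count M i * fact (count M i))"
    by (intro prod.cong) auto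
  also have "(k ^ Suc (count M k) * fact (Suc (count M k))) * \<dots> =
      (k ^ count M k * fact (count M k)) * (\<Prod>i\<in>?A. i ^ count M i * fact (count M i)) * (k * Suc (count M k))"
    by (simp add: algebra_simps)
  also have "(k ^ count M k * fact (count M k)) * (\<Prod>i\<in>?A. i ^ count M i * fact (count M i)) = zee_mset M"
    by (subst eq) (auto simp: prod.insert_remove)
  finally show ?thesis .
qed

lemma sum_count_eq: "(\<Sum>k\<in>set_mset M. k * count M k) = sum_mset M" for M :: "nat multiset"
proof -
  have "(\<Sum>k\<in>A. k * count M k) = sum_mset M" if "set_mset M \<subseteq> A" "finite A" for A
    using that
  proof (induction M)
    case (add x M)
    have "(\<Sum>k\<in>A. k * count (add_mset x M) k) = (\<Sum>k\<in>A. k * count M k + (if k = x then k else 0))"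
      by (intro sum.cong) auto
    also have "\<dots> = sum_mset M + x" using add by (simp add: sum.distrib)
    finally show ?case by simp
  qed simp
  then show ?thesis by simp
qed

text \<open>Adjoining a part \<open>k\<close> to \<open>M\<close> yields a multiset with a marked
  part. By \<open>zee_mset_add\<close> the coefficient of the result carries the factor
  \<open>k\<close> times the multiplicity of \<open>k\<close>, and these factors sum to
  \<open>n\<close> over the distinct parts.\<close>

lemma row_power_rec:
  fixes b :: "'a::field_char_0"
  defines "c \<equiv> \<lambda>M. b ^ size M / of_nat (zee_mset M)"
  defines "S \<equiv> \<lambda>n. \<Sum>M\<in>part_msets n. mscale (c M) (power_mset M)"
  shows "mscale (of_nat n) (S n) = mscale b (\<Sum>k=1..n. power_sum k * S (n - k))"
proof -
  have mult_right: "f * mscale d g = mscale d (f * g)" for f g :: "'a mfps" and d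
    by (rule mfps_eqI) (simp add: mcoeff_mult sum_distrib_left mult_ac case_prod_unfold)
  have "mscale b (\<Sum>k=1..n. power_sum k * S (n - k)) =
      (\<Sum>k=1..n. \<Sum>M\<in>part_msets (n - k). mscale (b * c M) (power_mset (add_mset k M)))"
    by (simp add: S_def sum_distrib_left mult_right mfps.scale_sum_right power_mset_def)
  also have "\<dots> = (\<Sum>(k, M)\<in>(SIGMA k:{1..n}. part_msets (n - k)). mscale (b * c M) (power_mset (add_mset k M)))"
    by (rule sum.Sigma) (simp_all add: finite_part_msets)
  also have "\<dots> = (\<Sum>(M, k)\<in>(SIGMA M:part_msets n. set_mset M). mscale (c M * of_nat (k * count M k)) (power_mset M))"
  proof (rule sum.reindex_bij_witness[of _ "\<lambda>(M, k). (k, M - {#k#})" "\<lambda>(k, M). (add_mset k M, k)"])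
    fix x assume "x \<in> (SIGMA k:{1..n}. part_msets (n - k))"
    then obtain k M where x: "x = (k, M)" "1 \<le> k" "k \<le> n" "M \<in> part_msets (n - k)" by auto
    then show "(case x of (k, M) \<Rightarrow> (add_mset k M, k)) \<in> (SIGMA M:part_msets n. set_mset M)"
      by (auto simp: part_msets_def)
    have "0 \<notin># M" using x by (simp add: part_msets_def)
    then have z: "of_nat (zee_mset M) \<noteq> (0 :: 'a)" using zee_mset_pos[of M] by simp
    have "c (add_mset k M) * of_nat (k * Suc (count M k)) = b * c M"
      using z x(2) unfolding c_def zee_mset_add of_nat_mult by (simp add: field_simps del: of_nat_Suc)
    then have "c (add_mset k M) * of_nat (k * count (add_mset k M) k) = b * c M"
      by (simp del: of_nat_mult of_nat_Suc)
    then show "(case case x of (k, M) \<Rightarrow> (add_mset k M, k) of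
        (M, k) \<Rightarrow> mscale (c M * of_nat (k * count M k)) (power_mset M)) =
        (case x of (k, M) \<Rightarrow> mscale (b * c M) (power_mset (add_mset k M)))"
      by (simp only: x(1) prod.case)
  next
    fix x assume "x \<in> (SIGMA M:part_msets n. set_mset M)"
    then obtain M k where x: "x = (M, k)" "0 \<notin># M" "sum_mset M = n" "k \<in># M" by (auto simp: part_msets_def)
    then obtain M' where M': "M = add_mset k M'" by (metis multi_member_split)
    have "k \<noteq> 0" using x by metis
    then show "(case x of (M, k) \<Rightarrow> (k, M - {#k#})) \<in> (SIGMA k:{1..n}. part_msets (n - k))"
      using x M' by (auto simp: part_msets_def)
  qed auto
  also have "\<dots> = (\<Sum>M\<in>part_msets n. \<Sum>k\<in>set_mset M. mscale (c M * of_nat (k * count M k)) (power_mset M))"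
    by (rule sum.Sigma[symmetric]) (simp_all add: finite_part_msets)
  also have "\<dots> = (\<Sum>M\<in>part_msets n. mscale (of_nat n * c M) (power_mset M))"
  proof (rule sum.cong[OF refl])
    fix M assume M: "M \<in> part_msets n"
    have "(\<Sum>k\<in>set_mset M. mscale (c M * of_nat (k * count M k)) (power_mset M)) =
        mscale (c M * of_nat (\<Sum>k\<in>set_mset M. k * count M k)) (power_mset M)"
      by (simp only: mfps.scale_sum_left of_nat_sum sum_distrib_left)
    then show "(\<Sum>k\<in>set_mset M. mscale (c M * of_nat (k * count M k)) (power_mset M)) =
        mscale (of_nat n * c M) (power_mset M)"
      using M by (simp only: sum_count_eq) (simp add: part_msets_def mult.commute)
  qed
  also have "\<dots> = mscale (of_nat n) (S n)"
    by (simp add: S_def mfps.scale_sum_right)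
  finally show ?thesis by simp
qed

text \<open>Both sides are 1 in degree 0 and obey the same recurrence, in which \<open>n > 0\<close>
  can be cancelled.\<close>

lemma row_series_power_expansion:
  fixes b :: "'a::field_char_0"
  shows "row_series b n = (\<Sum>\<mu>\<in>parts n. mscale (b ^ length \<mu> / of_nat (zee \<mu>)) (power_sym \<mu>))"
proof -
  define S where "S n = (\<Sum>M\<in>part_msets n. mscale (b ^ size M / of_nat (zee_mset M)) (power_mset M))" for n
  have "row_series b n = S n"
  proof (induction n rule: less_induct)
    case (less n)
    show ?case
    proof (cases "n = 0")
      case True
      have "part_msets 0 = {{#}}" by (auto simp: part_msets_def) (metis multiset_nonemptyE)
      then show ?thesis using True
        by (simp add: row_series_0 S_def power_mset_def zee_mset_def)
    next
      case False
      have "mscale (of_nat n) (row_series b n) = mscale b (\<Sum>k=1..n. power_sum k * S (n - k))"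
        using False less by (simp add: row_series_rec)
      also have "\<dots> = mscale (of_nat n) (S n)"
        unfolding S_def by (rule row_power_rec[symmetric])
      finally show ?thesis using False by (simp add: mfps.scale_left_imp_eq)
    qed
  qed
  also have "S n = (\<Sum>\<mu>\<in>parts n. mscale (b ^ length \<mu> / of_nat (zee \<mu>)) (power_sym \<mu>))"
    unfolding S_def
    by (subst sum.reindex_bij_betw[OF bij_betw_mset_parts, symmetric])
       (simp add: zee_eq power_sym_eq)
  finally show ?thesis .
qed


section \<open>The form on the span of the power sums\<close>

abbreviation homogeneous_space :: "nat \<Rightarrow> 'a::linordered_field mfps set" where
  "homogeneous_space n \<equiv> mfps.span (power_sym ` parts n)"

lemma power_expansion:
  fixes f :: "'a::linordered_field mfps"
  assumes "f \<in> homogeneous_space n"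
  shows "f = (\<Sum>\<nu>\<in>parts n. mscale (expansion power_sym f \<nu>) (power_sym \<nu>))"
    and "\<nu> \<notin> parts n \<Longrightarrow> expansion power_sym f \<nu> = 0"
proof -
  obtain c where c: "f = (\<Sum>\<nu>\<in>parts n. mscale (c \<nu>) (power_sym \<nu>))"
    using span_imageE[OF assms finite_parts inj_on_subset[OF power_sym_basis(1) parts_subset]] by blast
  note e = expansion_sum[OF power_sym_basis(2,1) finite_parts parts_subset c]
  show "f = (\<Sum>\<nu>\<in>parts n. mscale (expansion power_sym f \<nu>) (power_sym \<nu>))"
    unfolding e by (subst c) simp
  show "\<nu> \<notin> parts n \<Longrightarrow> expansion power_sym f \<nu> = 0"
    by (simp add: e)
qed

lemma jack_form_eq:
  fixes f g :: "'a::linordered_field mfps"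
  assumes "f \<in> homogeneous_space n"
  shows "jack_form a f g = (\<Sum>\<nu>\<in>parts n.
    expansion power_sym f \<nu> * expansion power_sym g \<nu> * (of_nat (zee \<nu>) * a ^ length \<nu>))"
  unfolding jack_form_def
  using power_expansion(2)[OF assms] finite_parts
  by (intro sum.mono_neutral_left) auto

lemma expansion_power_sum:
  fixes v :: "'i \<Rightarrow> 'a::linordered_field mfps"
  assumes "\<And>i. i \<in> S \<Longrightarrow> v i \<in> homogeneous_space n"
  shows "expansion power_sym (\<Sum>i\<in>S. mscale (u i) (v i)) \<nu> = (\<Sum>i\<in>S. u i * expansion power_sym (v i) \<nu>)"
proof -
  let ?B = "(power_sym :: _ \<Rightarrow> 'a mfps) ` {\<mu>. is_partition \<mu>}"
  have "homogeneous_space n \<subseteq> mfps.span ?B" by (intro mfps.span_mono image_mono parts_subset)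
  then have v: "v i \<in> mfps.span ?B" if "i \<in> S" for i using assms[OF that] by blast
  have "mfps.representation ?B (\<Sum>i\<in>S. mscale (u i) (v i)) =
      (\<lambda>x. \<Sum>i\<in>S. mfps.representation ?B (mscale (u i) (v i)) x)"
    by (intro mfps.representation_sum power_sym_basis(2) mfps.span_scale v)
  also have "\<dots> = (\<lambda>x. \<Sum>i\<in>S. u i * mfps.representation ?B (v i) x)"
    by (intro ext sum.cong refl) (simp add: mfps.representation_scale[OF power_sym_basis(2) v])
  finally have "mfps.representation ?B (\<Sum>i\<in>S. mscale (u i) (v i)) =
      (\<lambda>x. \<Sum>i\<in>S. u i * mfps.representation ?B (v i) x)" .
  then show ?thesis by (simp add: expansion_def)
qed

lemma jack_form_sum_left:
  fixes v :: "'i \<Rightarrow> 'a::linordered_field mfps"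
  assumes "\<And>i. i \<in> S \<Longrightarrow> v i \<in> homogeneous_space n"
  shows "jack_form a (\<Sum>i\<in>S. mscale (u i) (v i)) g = (\<Sum>i\<in>S. u i * jack_form a (v i) g)"
proof -
  have "(\<Sum>i\<in>S. mscale (u i) (v i)) \<in> homogeneous_space n"
    using assms by (intro mfps.span_sum mfps.span_scale)
  moreover have "expansion power_sym (\<Sum>i\<in>S. mscale (u i) (v i)) \<nu> = (\<Sum>i\<in>S. u i * expansion power_sym (v i) \<nu>)" for \<nu>
    by (rule expansion_power_sum) (rule assms)
  ultimately have "jack_form a (\<Sum>i\<in>S. mscale (u i) (v i)) g = (\<Sum>\<nu>\<in>parts n. (\<Sum>i\<in>S. u i * expansion power_sym (v i) \<nu>) *
      expansion power_sym g \<nu> * (of_nat (zee \<nu>) * a ^ length \<nu>))"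
    by (simp add: jack_form_eq)
  also have "\<dots> = (\<Sum>\<nu>\<in>parts n. \<Sum>i\<in>S. u i * (expansion power_sym (v i) \<nu> *
      expansion power_sym g \<nu> * (of_nat (zee \<nu>) * a ^ length \<nu>)))"
    by (simp add: sum_distrib_right mult.assoc)
  also have "\<dots> = (\<Sum>i\<in>S. u i * jack_form a (v i) g)"
    by (subst sum.swap, intro sum.cong refl) (simp add: jack_form_eq[OF assms] sum_distrib_left)
  finally show ?thesis .
qed

lemma jack_form_commute:
  fixes f g :: "'a::linordered_field mfps"
  assumes "f \<in> homogeneous_space n" "g \<in> homogeneous_space n"
  shows "jack_form a f g = jack_form a g f"
  by (simp add: jack_form_eq[OF assms(1)] jack_form_eq[OF assms(2)] mult.commute mult.left_commute)

lemma zee_pos: "is_partition \<mu> \<Longrightarrow> zee \<mu> > 0"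
  by (simp add: zee_eq zee_mset_pos is_partition_def)

text \<open>In power sum coordinates the form is a sum of squares with positive weights.\<close>

lemma jack_form_definite:
  fixes f :: "'a::linordered_field mfps"
  assumes f: "f \<in> homogeneous_space n" and a: "a > 0" and "jack_form a f f = 0"
  shows "f = 0"
proof -
  have pos: "of_nat (zee \<nu>) * a ^ length \<nu> > 0" if "\<nu> \<in> parts n" for \<nu>
    using that a zee_pos[of \<nu>] by (simp add: parts_def)
  have "(\<Sum>\<nu>\<in>parts n. expansion power_sym f \<nu> * expansion power_sym f \<nu> * (of_nat (zee \<nu>) * a ^ length \<nu>)) = 0"
    using assms(3) by (simp add: jack_form_eq[OF f])
  then have "\<forall>\<nu>\<in>parts n. expansion power_sym f \<nu> * expansion power_sym f \<nu> * (of_nat (zee \<nu>) * a ^ length \<nu>) = 0"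
    using pos finite_parts
    by (subst (asm) sum_nonneg_eq_0_iff) (auto intro: mult_nonneg_nonneg[OF zero_le_square less_imp_le])
  then have z: "expansion power_sym f \<nu> = 0" if "\<nu> \<in> parts n" for \<nu>
    using pos[OF that] that by (metis less_irrefl mult_eq_0_iff)
  then have "(\<Sum>\<nu>\<in>parts n. mscale (expansion power_sym f \<nu>) (power_sym \<nu>)) = 0"
    by (intro sum.neutral) simp
  then show ?thesis using power_expansion(1)[OF f] by simp
qed

lemma orthogonal_imp_independent:
  fixes S :: "'a::linordered_field mfps set"
  assumes S: "S \<subseteq> homogeneous_space n" "0 \<notin> S" and a: "a > 0"
    and orth: "\<And>f g. f \<in> S \<Longrightarrow> g \<in> S \<Longrightarrow> f \<noteq> g \<Longrightarrow> jack_form a f g = 0"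
  shows "mfps.independent S"
proof
  assume "mfps.dependent S"
  then obtain t u w where t: "finite t" "t \<subseteq> S" "(\<Sum>v\<in>t. mscale (u v) v) = 0" and w: "w \<in> t" "u w \<noteq> 0"
    unfolding mfps.dependent_explicit by blast
  have "0 = jack_form a (\<Sum>v\<in>t. mscale (u v) v) w"
    unfolding t(3) by (simp add: jack_form_def expansion_def mfps.representation_zero)
  also have "\<dots> = (\<Sum>v\<in>t. u v * jack_form a v w)"
    using t(2) S(1) by (intro jack_form_sum_left) blast
  also have "\<dots> = (\<Sum>v\<in>{w}. u v * jack_form a v w)"
    using t w orth by (intro sum.mono_neutral_right) auto
  finally have "jack_form a w w = 0" using w(2) by simp
  then show False using jack_form_definite[OF _ a] S t(2) w(1) by (metis subsetD)
qed

lemma mcoeff_power_sym_single: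
  "0 \<notin> set \<mu> \<Longrightarrow> mcoeff (power_sym \<mu> :: 'a::comm_ring_1 mfps) (Poly_Mapping.single 0 (sum_list \<mu>)) = 1"
proof (induction \<mu>)
  case (Cons k \<mu>)
  then have k: "k > 0" by auto
  then have "{i. k \<le> Poly_Mapping.lookup (Poly_Mapping.single (0::nat) (k + sum_list \<mu>)) i} = {0}"
    by (auto simp: lookup_single when_def split: if_splits)
  moreover have "Poly_Mapping.single (0::nat) (k + sum_list \<mu>) - Poly_Mapping.single 0 k =
      Poly_Mapping.single 0 (sum_list \<mu>)"
    by (simp flip: single_diff)
  ultimately show ?case using Cons by (simp add: power_sym_Cons mcoeff_power_sum_mult[OF k])
qed (simp add: power_sym_def mcoeff_one)

lemma row_series_in_space: "row_series b n \<in> homogeneous_space n" for b :: "'a::linordered_field"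
  unfolding row_series_power_expansion by (intro mfps.span_sum mfps.span_scale mfps.span_base) auto

text \<open>
  The reproducing property of the one-row function: pairing with it evaluates at
  \<open>x\<^sub>0 = 1\<close> and all other variables \<open>0\<close>.
\<close>

lemma jack_form_row_series:
  fixes f :: "'a::linordered_field mfps"
  assumes f: "f \<in> homogeneous_space n" and a: "a > 0"
  shows "jack_form a (row_series (1 / a) n) f = mcoeff f (Poly_Mapping.single 0 n)"
proof -
  have e: "expansion power_sym (row_series (1 / a) n) \<nu> = (1 / a) ^ length \<nu> / of_nat (zee \<nu>)" if "\<nu> \<in> parts n" for \<nu>
    using expansion_sum[OF power_sym_basis(2,1) finite_parts parts_subset row_series_power_expansion[of "1 / a" n]] that
    by simp
  \<comment> \<open>The coordinates of the one-row function are the inverse weights of the form, so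
    the pairing adds up the coordinates of \<open>f\<close>. Each power sum product has coefficient
    1 at the pure power of \<open>x_0\<close>, so the same sum is that coefficient of
    \<open>f\<close>.\<close>
  have "jack_form a (row_series (1 / a) n) f = (\<Sum>\<nu>\<in>parts n. expansion power_sym f \<nu>)"
    unfolding jack_form_eq[OF row_series_in_space]
  proof (rule sum.cong[OF refl])
    fix \<nu> assume \<nu>: "\<nu> \<in> parts n"
    have "of_nat (zee \<nu>) \<noteq> (0 :: 'a)" using zee_pos[of \<nu>] \<nu> by (simp add: parts_def)
    then show "expansion power_sym (row_series (1 / a) n) \<nu> * expansion power_sym f \<nu> *
        (of_nat (zee \<nu>) * a ^ length \<nu>) = expansion power_sym f \<nu>"
      using a by (simp add: e[OF \<nu>] power_divide)
  qed
  also have "\<dots> = (\<Sum>\<nu>\<in>parts n. expansion power_sym f \<nu> * mcoeff (power_sym \<nu>) (Poly_Mapping.single 0 n))"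
    by (intro sum.cong refl) (use mcoeff_power_sym_single[where ?'a = 'a] in \<open>auto simp: parts_def is_partition_def\<close>)
  also have "\<dots> = mcoeff f (Poly_Mapping.single 0 n)"
    by (subst (2) power_expansion(1)[OF f]) simp
  finally show ?thesis .
qed


section \<open>The one-row Jack function\<close>

text \<open>The order on \<open>ratfun\<close> comes from the polynomial order in which the sign of
  the leading coefficient decides.\<close>

lemma alpha_pos: "alpha > 0"
  unfolding alpha_def to_fract_def
  by (simp add: zero_less_Fract_iff) (simp add: less_poly_def pos_poly_def)

lemma is_partition_replicate: "is_partition (replicate n 1)"
  by (induction n) (simp_all add: is_partition_def)

text \<open>A symmetric function only has bounded degree. Homogeneity comes from dominance, which
  includes equality of the sums.\<close>

lemma jack_homogeneous_space:
  assumes J: "jack_family J" and \<mu>: "is_partition \<mu>"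
  shows "J \<mu> \<in> homogeneous_space (sum_list \<mu>)"
    and "\<And>\<nu>. is_partition \<nu> \<Longrightarrow> mcoeff (J \<mu>) (Poly_Mapping.nth \<nu>) \<noteq> 0 \<Longrightarrow> dominated \<nu> \<mu>"
    and "mcoeff (J \<mu>) (Poly_Mapping.nth (replicate (sum_list \<mu>) 1)) = fact (sum_list \<mu>)"
proof -
  have sf: "symmetric_function (J \<mu>)" using J \<mu> by (simp add: jack_family_def)
  then have inv: "invariant (J \<mu>)" by (simp add: symmetric_function_def invariant_def)
  show dom: "dominated \<nu> \<mu>" if "is_partition \<nu>" "mcoeff (J \<mu>) (Poly_Mapping.nth \<nu>) \<noteq> 0" for \<nu>
    using J \<mu> that by (auto simp: jack_family_def expansion_monomial_sym[OF sf])
  note is_partition_replicate[of "sum_list \<mu>"]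
  then show "mcoeff (J \<mu>) (Poly_Mapping.nth (replicate (sum_list \<mu>) 1)) = fact (sum_list \<mu>)"
    using J \<mu> by (simp add: jack_family_def expansion_monomial_sym[OF sf, symmetric])
  have "homogeneous (sum_list \<mu>) (J \<mu>)"
    unfolding homogeneous_def
  proof (intro allI impI)
    fix m assume m: "mcoeff (J \<mu>) m \<noteq> 0"
    let ?\<nu> = "partition_of (exponents m)"
    have \<nu>: "is_partition ?\<nu>" by (simp add: is_partition_partition_of zero_notin_exponents)
    have "mcoeff (J \<mu>) (Poly_Mapping.nth ?\<nu>) = mcoeff (J \<mu>) m"
      by (rule invariant_mcoeff_cong[OF inv]) (simp add: exponents_nth \<nu>)
    then have "dominated ?\<nu> \<mu>" using dom[OF \<nu>] m by simp
    then show "mdeg m = sum_list \<mu>"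
      using partition_of_exponents[of m] by (simp add: dominated_def parts_def)
  qed
  with inv show "J \<mu> \<in> homogeneous_space (sum_list \<mu>)"
    using homogeneous_in_span_monomial span_monomial_eq_span_power by blast
qed

lemma jack_one_row:
  assumes J: "jack_family J" and n: "n \<ge> 1"
  shows "J [n] = mscale (fact n * alpha ^ n) (row_series (1 / alpha) n)"
proof -
  let ?G = "row_series (1 / alpha) n" and ?V = "homogeneous_space n :: ratfun mfps set"
  let ?e = "Poly_Mapping.nth (replicate n 1) :: nat \<Rightarrow>\<^sub>0 nat"
  have pn: "is_partition [n]" "[n] \<in> parts n" using n by (simp_all add: is_partition_def parts_def)
  have V: "J \<mu> \<in> ?V" if "\<mu> \<in> parts n" for \<mu>
    using jack_homogeneous_space(1)[OF J, of \<mu>] that by (simp add: parts_def)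
  have e: "mcoeff (J \<mu>) ?e = fact n" if "\<mu> \<in> parts n" for \<mu>
    using jack_homogeneous_space(3)[OF J, of \<mu>] that by (simp add: parts_def)
  have nz: "J \<mu> \<noteq> 0" if "\<mu> \<in> parts n" for \<mu> using e[OF that] by auto
  have orth: "jack_form alpha (J \<mu>) (J \<nu>) = 0" if "\<mu> \<in> parts n" "\<nu> \<in> parts n" "\<mu> \<noteq> \<nu>" for \<mu> \<nu>
    using J that by (simp add: jack_family_def parts_def)
  have definite: "jack_form alpha f f \<noteq> 0" if "f \<in> ?V" "f \<noteq> 0" for f
    using jack_form_definite[OF that(1) alpha_pos] that(2) by blast
  have inj: "inj_on J (parts n)"
    using orth definite[OF V nz] by (metis inj_onI)
  have G_orth: "jack_form alpha ?G (J \<mu>) = 0" if \<mu>: "\<mu> \<in> parts n" "\<mu> \<noteq> [n]" for \<mu>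
  proof -
    have "jack_form alpha ?G (J \<mu>) = mcoeff (J \<mu>) (Poly_Mapping.nth [n])"
      using jack_form_row_series[OF V[OF \<mu>(1)] alpha_pos] by simp
    \<comment> \<open>Dominance would make the first part of \<open>\<mu>\<close> at least
      \<open>n\<close>, leaving nothing for further parts.\<close>
    also have "\<dots> = 0"
    proof (rule ccontr)
      assume "mcoeff (J \<mu>) (Poly_Mapping.nth [n]) \<noteq> 0"
      then have "dominated [n] \<mu>" using jack_homogeneous_space(2)[OF J _ pn(1)] \<mu> by (simp add: parts_def)
      then have le: "n \<le> sum_list (take 1 \<mu>)" by (auto simp: dominated_def dest: spec[of _ 1])
      obtain x \<mu>' where \<mu>': "\<mu> = x # \<mu>'" using \<mu> n by (cases \<mu>) (auto simp: parts_def)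
      then have "x + sum_list \<mu>' = n" "0 \<notin> set \<mu>'" using \<mu> by (auto simp: parts_def is_partition_def)
      with le \<mu>' have "sum_list \<mu>' = 0" "x = n" by auto
      with \<open>0 \<notin> set \<mu>'\<close> have "\<mu>' = []" by (cases \<mu>') auto
      with \<mu>' \<open>x = n\<close> \<mu>(2) show False by simp
    qed
    finally show ?thesis .
  qed
  define c where "c = jack_form alpha ?G (J [n]) / jack_form alpha (J [n]) (J [n])"
  \<comment> \<open>\<open>D\<close> is the component of the one-row series orthogonal to
    \<open>J [n]\<close>, and so to all \<open>J \<mu>\<close> of degree \<open>n\<close>. If
    nonzero, it would enlarge them to an independent set with more members than the power sums
    spanning the space.\<close>
  define D where "D = ?G - mscale c (J [n])"
  have DV: "D \<in> ?V" unfolding D_def by (intro mfps.span_diff mfps.span_scale V pn row_series_in_space)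
  have D_form: "jack_form alpha D g = jack_form alpha ?G g - c * jack_form alpha (J [n]) g" for g
  proof -
    \<comment> \<open>A sum over \<open>bool\<close> brings the difference into the form required by
      \<open>jack_form_sum_left\<close>.\<close>
    let ?v = "\<lambda>i::bool. if i then ?G else J [n]" and ?u = "\<lambda>i. if i then 1 else - c"
    have "D = (\<Sum>i\<in>UNIV. mscale (?u i) (?v i))"
      by (rule mfps_eqI) (simp add: D_def UNIV_bool)
    then show ?thesis
      using jack_form_sum_left[of UNIV ?v n alpha ?u g] V[OF pn(2)] row_series_in_space[of "1 / alpha" n]
      by (simp add: UNIV_bool)
  qed
  have D_orth: "jack_form alpha D (J \<mu>) = 0" if "\<mu> \<in> parts n" for \<mu>
  proof (cases "\<mu> = [n]")
    case True
    then show ?thesis using definite[OF V[OF pn(2)] nz[OF pn(2)]] by (simp add: D_form c_def)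
  next
    case False
    then show ?thesis using G_orth[OF that] orth[OF pn(2) that] by (simp add: D_form)
  qed
  have "D = 0"
  proof (rule ccontr)
    assume D: "D \<noteq> 0"
    let ?S = "insert D (J ` parts n)"
    have "D \<notin> J ` parts n" using D_orth definite[OF DV D] by auto
    then have card: "card ?S = Suc (card (parts n))"
      using finite_parts by (simp add: card_image[OF inj])
    have "jack_form alpha f g = 0" if "f \<in> ?S" "g \<in> ?S" "f \<noteq> g" for f g
      using that D_orth orth jack_form_commute[OF V DV, where a = alpha] by auto
    then have "mfps.independent ?S"
      using DV V D nz by (intro orthogonal_imp_independent[OF _ _ alpha_pos, of _ n]) auto
    moreover have "?S \<subseteq> ?V" using DV V by auto
    ultimately have "card ?S \<le> card ((power_sym :: _ \<Rightarrow> ratfun mfps) ` parts n)"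
      using mfps.independent_span_bound[of "power_sym ` parts n" ?S] finite_parts by blast
    then show False using card card_image_le[OF finite_parts, of "power_sym :: _ \<Rightarrow> ratfun mfps" n] by simp
  qed
  then have G: "?G = mscale c (J [n])" by (simp add: D_def)
  \<comment> \<open>The scalar is fixed by the squarefree monomial: each of its \<open>n\<close>
    variables contributes \<open>rising_coeff (1 / alpha) 1 = 1 / alpha\<close>.\<close>
  have "mcoeff ?G ?e = (1 / alpha) ^ n"
  proof -
    note p = is_partition_replicate[of n]
    have keys: "Poly_Mapping.keys ?e = {..<n}"
      by (auto simp: in_keys_iff nth_default_def simp del: keys_nth split: if_splits)
    have "(\<Prod>i\<in>{..<n}. rising_coeff (1 / alpha) (Poly_Mapping.lookup ?e i)) = (\<Prod>i\<in>{..<n}. 1 / alpha)"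
      by (intro prod.cong) (auto simp: nth_default_def rising_coeff_def)
    then show ?thesis
      unfolding mcoeff_row_series[OF finite_lessThan eq_refl[OF keys]]
      using mdeg_nth[OF p] by (simp add: sum_list_replicate)
  qed
  then have "(1 / alpha) ^ n = c * fact n" using e[OF pn(2)] by (simp add: G)
  then have "fact n * alpha ^ n * c = 1" using alpha_pos by (simp add: field_simps)
  then show ?thesis by (simp add: G)
qed

text \<open>One rational polynomial can thus be evaluated at the naturals, at \<open>alpha\<close>
  and at \<open>1 / alpha\<close>, in different fields.\<close>

definition poly_at :: "'a::field_char_0 \<Rightarrow> rat poly \<Rightarrow> 'a" where
  "poly_at t q = poly (map_poly of_rat q) t"

lemma poly_at_pCons [simp]: "poly_at t (pCons a q) = of_rat a + t * poly_at t q"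
  by (simp add: poly_at_def map_poly_pCons)

lemma poly_at_0 [simp]: "poly_at t 0 = 0"
  by (simp add: poly_at_def)

lemma poly_at_1 [simp]: "poly_at t 1 = 1"
  by (simp add: poly_at_def)

lemma poly_at_add [simp]: "poly_at t (p + q) = poly_at t p + poly_at t q"
proof -
  have "map_poly of_rat (p + q) = (map_poly of_rat p + map_poly of_rat q :: 'a poly)"
    by (rule poly_eqI) (simp add: coeff_map_poly of_rat_add)
  then show ?thesis by (simp add: poly_at_def)
qed

lemma poly_at_smult [simp]: "poly_at t (smult c p) = of_rat c * poly_at t p"
proof -
  have "map_poly of_rat (smult c p) = smult (of_rat c) (map_poly of_rat p :: 'a poly)"
    by (rule poly_eqI) (simp add: coeff_map_poly of_rat_mult)
  then show ?thesis by (simp add: poly_at_def)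
qed

lemma poly_at_mult [simp]: "poly_at t (p * q) = poly_at t p * poly_at t q"
  by (induction p) (simp_all add: distrib_right mult.assoc)

lemma poly_at_prod: "poly_at t (\<Prod>i\<in>A. f i) = (\<Prod>i\<in>A. poly_at t (f i))"
  by (induction A rule: infinite_finite_induct) simp_all

lemma poly_at_sum: "poly_at t (\<Sum>i\<in>A. f i) = (\<Sum>i\<in>A. poly_at t (f i))"
  by (induction A rule: infinite_finite_induct) simp_all

lemma to_fract_const: "to_fract [:c:] = (of_rat c :: ratfun)"
proof -
  have nat: "to_fract (of_nat k :: rat poly) = of_nat k" for k by (induction k) simp_all
  have neg: "to_fract [:- x:] = (- to_fract [:x:] :: ratfun)" for x
    by (simp flip: to_fract_uminus)
  have int: "to_fract [:of_int k:] = (of_int k :: ratfun)" for k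
    by (cases k rule: int_cases2) (simp_all add: of_nat_poly[symmetric] nat neg)
  obtain p q where c: "c = Rat.Fract p q" "q > 0" by (cases c) auto
  have "to_fract [:c:] * of_int q = (to_fract ([:c:] * [:of_int q:]) :: ratfun)"
    by (simp only: to_fract_mult int)
  also have "[:c:] * [:of_int q:] = [:of_int p:]"
    using c by (simp add: Fract_of_int_quotient)
  finally show ?thesis using c by (simp add: int of_rat_rat field_simps)
qed

lemma to_fract_eq_poly_at: "to_fract q = poly_at alpha q"
proof (induction q)
  case (pCons a q)
  have "pCons a q = [:a:] + [:0, 1:] * q" by simp
  then have "to_fract (pCons a q) = to_fract [:a:] + alpha * to_fract q"
    unfolding alpha_def by (metis to_fract_add to_fract_mult)
  then show ?case using pCons by (simp add: to_fract_const)
qed simp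

text \<open>A polynomial has normalized denominator 1, so the substitution is plain
  evaluation.\<close>

lemma ratfun_subst_poly_at: "ratfun_subst t (poly_at alpha q) = poly_at t q"
  unfolding to_fract_eq_poly_at[symmetric] by (simp add: ratfun_subst_def poly_at_def)

text \<open>\<open>(\<Prod>j<k. 1 + j x) / k!\<close>, which is
  \<open>rising_coeff (1 / x) k\<close> with its denominator \<open>x^k\<close> cleared.\<close>

definition scaled_rising :: "nat \<Rightarrow> rat poly" where
  "scaled_rising k = smult (1 / fact k) (\<Prod>j<k. [:1, of_nat j:])"

lemma of_rat_fact [simp]: "of_rat (fact k) = fact k"
  by (metis of_nat_fact of_rat_of_nat_eq)

lemma poly_at_scaled_rising:
  assumes "x \<noteq> 0"
  shows "poly_at x (scaled_rising k) = x ^ k * rising_coeff (1 / x) k"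
proof -
  have "(\<Prod>j<k. 1 + x * of_nat j) = x ^ k * pochhammer (1 / x) k"
    using assms by (induction k) (simp_all add: pochhammer_Suc field_simps)
  then show ?thesis
    by (simp add: scaled_rising_def poly_at_prod rising_coeff_def of_rat_divide)
qed

text \<open>On a monomial of degree \<open>n\<close> the factor \<open>alpha^n\<close> of
  \<open>J [n]\<close> splits over the variables and clears all denominators, so the coefficient is
  a polynomial \<open>q\<close> at \<open>alpha\<close>. At \<open>1 / alpha\<close> it leaves a
  factor \<open>alpha^(-n)\<close>, which the prefactor in \<open>jack_tilde\<close>
  cancels.\<close>

lemma jack_tilde_one_row:
  assumes J: "jack_family J" and n: "n \<ge> 1"
  shows "jack_tilde J [n] = mscale (fact n) (row_series alpha n)"
proof (rule mfps_eqI)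
  fix m :: "nat \<Rightarrow>\<^sub>0 nat"
  let ?K = "Poly_Mapping.keys m" and ?l = "Poly_Mapping.lookup m"
  have a: "alpha \<noteq> 0" using alpha_pos by simp
  have lhs: "mcoeff (jack_tilde J [n]) m =
      alpha ^ n * ratfun_subst (1 / alpha) (fact n * alpha ^ n * mcoeff (row_series (1 / alpha) n) m)"
    by (simp add: jack_tilde_def map_mfps_def jack_one_row[OF J n])
  show "mcoeff (jack_tilde J [n]) m = mcoeff (mscale (fact n) (row_series alpha n)) m"
  proof (cases "mdeg m = n")
    case True
    define q where "q = smult (fact n) (\<Prod>i\<in>?K. scaled_rising (?l i))"
    have q: "poly_at x q = fact n * x ^ n * (\<Prod>i\<in>?K. rising_coeff (1 / x) (?l i))" if "x \<noteq> 0" for x :: ratfun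
    proof -
      have "x ^ n = (\<Prod>i\<in>?K. x ^ ?l i)" unfolding True[symmetric] mdeg_def by (rule power_sum)
      then show ?thesis
        by (simp add: q_def poly_at_prod poly_at_scaled_rising[OF that] prod.distrib)
    qed
    have "fact n * alpha ^ n * mcoeff (row_series (1 / alpha) n) m = poly_at alpha q"
      using q[OF a] True by (simp add: row_series_def)
    then have "mcoeff (jack_tilde J [n]) m = alpha ^ n * poly_at (1 / alpha) q"
      unfolding lhs by (simp only: ratfun_subst_poly_at)
    also have "\<dots> = mcoeff (mscale (fact n) (row_series alpha n)) m"
      using q[of "1 / alpha"] a True by (simp add: row_series_def power_divide)
    finally show ?thesis .
  next
    case False
    then show ?thesis using ratfun_subst_poly_at[of "1 / alpha" 0] by (simp add: lhs row_series_def)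
  qed
qed


section \<open>Schur functions\<close>

lemma cells_nth_default: "cells (nth_default 0 l) = diagram l"
  by (auto simp: cells_def diagram_def nth_default_def split: if_splits)

lemma is_partition_nth_mono: "is_partition l \<Longrightarrow> i \<le> j \<Longrightarrow> j < length l \<Longrightarrow> l ! j \<le> l ! i"
  by (cases "i = j") (auto simp: is_partition_def sorted_wrt_iff_nth_less)

lemma finite_diagram: "finite (diagram l)"
proof -
  have "diagram l = (SIGMA r:{..<length l}. {..<l ! r})" by (auto simp: diagram_def)
  then show ?thesis by simp
qed

lemma psize_nth_default: "psize (nth_default 0 l) = sum_list l"
  by (subst psize_eq_sum[of "length l"]) (auto simp: nth_default_def sum_list_sum_nth lessThan_atLeast0)

lemma card_diagram: "card (diagram l) = sum_list l"
  using psize_nth_default[of l] by (simp add: psize_def cells_nth_default)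

lemma down_closed_diagram: "is_partition l \<Longrightarrow> down_closed (diagram l)"
  unfolding down_closed_def diagram_def
  by (auto intro: less_le_trans le_less_trans dest: is_partition_nth_mono)

lemma nth_default_partition_funs: "is_partition l \<Longrightarrow> nth_default 0 l \<in> partition_funs"
  unfolding partition_funs_def
  by (auto simp: decseq_def nth_default_def is_partition_nth_mono intro!: exI[of _ "length l"])

lemma nth_default_inject:
  assumes "is_partition l" "is_partition l'" "nth_default 0 l = nth_default 0 l'"
  shows "l = l'"
proof -
  have "Poly_Mapping.nth l = Poly_Mapping.nth l'" by (rule poly_mapping_eqI) (simp add: assms(3))
  then have "mset l = mset l'" using exponents_nth assms(1,2) by metis
  then show ?thesis using assms(1,2) by (intro is_partition_unique)
qed

lemma bij_betw_nth_default:
  "bij_betw (nth_default 0) (parts n) {p \<in> partition_funs. psize p = n}"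
  unfolding bij_betw_def
proof (intro conjI inj_onI set_eqI iffI)
  fix p assume p: "p \<in> {p \<in> partition_funs. psize p = n}"
  then obtain L where L: "\<forall>i\<ge>L. p i = 0" by (auto simp: partition_funs_def)
  define L' where "L' = (LEAST L. \<forall>i\<ge>L. p i = 0)"
  have "\<forall>i\<ge>L'. p i = 0"
    unfolding L'_def by (rule LeastI[of "\<lambda>L. \<forall>i\<ge>L. p i = 0", OF L])
  then have L': "p i = 0" if "i \<ge> L'" for i using that by blast
  have dec: "p j \<le> p i" if "i \<le> j" for i j using p that by (auto simp: partition_funs_def dest: decseqD)
  have pos: "p i \<noteq> 0" if "i < L'" for i
  proof
    assume "p i = 0"
    then have "\<forall>j\<ge>i. p j = 0" using dec by (metis le_zero_eq)
    then have "L' \<le> i" unfolding L'_def by (rule Least_le)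
    with that show False by simp
  qed
  define l where "l = map p [0..<L']"
  have nl: "nth_default 0 l = p" using L' by (auto simp: l_def nth_default_def fun_eq_iff)
  have "sorted_wrt (\<ge>) l" using dec by (simp add: l_def sorted_wrt_iff_nth_less)
  moreover have "0 \<notin> set l"
  proof
    assume "0 \<in> set l"
    then obtain i where "i < L'" "p i = 0" by (auto simp: l_def)
    with pos show False by blast
  qed
  ultimately have "is_partition l" by (simp add: is_partition_def)
  moreover have "sum_list l = n" using psize_nth_default[of l] p by (simp add: nl)
  ultimately show "p \<in> nth_default 0 ` parts n" using nl by (force simp: parts_def)
qed (auto simp: parts_def nth_default_inject nth_default_partition_funs psize_nth_default)

section \<open>Tableaux of given content\<close>

definition content_tableaux :: "nat list \<Rightarrow> (nat \<Rightarrow>\<^sub>0 nat) \<Rightarrow> (nat \<times> nat \<Rightarrow> nat) set" where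
  "content_tableaux l m = {T. tableau (diagram l) T \<and>
     (\<forall>i. Poly_Mapping.lookup m i = card {x \<in> diagram l. T x = Suc i})}"

lemma mcoeff_schur: "mcoeff (schur l) m = of_nat (card (content_tableaux l m))"
  by (simp add: schur_def content_tableaux_def ssyt_iff_tableau)

lemma content_tableaux_bound:
  assumes T: "T \<in> content_tableaux l m" and M: "Poly_Mapping.keys m \<subseteq> {..<M}" and x: "x \<in> diagram l"
  shows "0 < T x" "T x \<le> M"
proof -
  show pos: "0 < T x" using T x unfolding content_tableaux_def tableau_def by blast
  have "x \<in> {y \<in> diagram l. T y = Suc (T x - 1)}" (is "_ \<in> ?A") using x pos by simp
  moreover have "finite ?A" by (rule finite_subset[OF _ finite_diagram[of l]]) blast
  ultimately have "card ?A \<noteq> 0" by (metis card_0_eq empty_iff)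
  then have "Poly_Mapping.lookup m (T x - 1) \<noteq> 0" using T by (simp add: content_tableaux_def)
  then have "T x - 1 \<in> Poly_Mapping.keys m" by (simp only: in_keys_iff not_False_eq_True)
  then have "T x - 1 < M" using M by auto
  then show "T x \<le> M" by simp
qed

text \<open>A constant \<open>g\<close> yields the degree of the content, and the identity yields
  the sum of the entries that is compared with the rows in \<open>schur_triangular\<close>.\<close>

lemma sum_content:
  fixes g :: "nat \<Rightarrow> nat"
  assumes T: "T \<in> content_tableaux l m" and M: "Poly_Mapping.keys m \<subseteq> {..<M}"
  shows "(\<Sum>x\<in>diagram l. g (T x - 1)) = (\<Sum>i<M. Poly_Mapping.lookup m i * g i)"
proof -
  have "(\<Sum>i<M. \<Sum>x | x \<in> diagram l \<and> T x - 1 = i. g (T x - 1)) = (\<Sum>x\<in>diagram l. g (T x - 1))"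
    by (rule sum.group) (use finite_diagram content_tableaux_bound[OF T M] in fastforce)+
  moreover have "(\<Sum>x | x \<in> diagram l \<and> T x - 1 = i. g (T x - 1)) = Poly_Mapping.lookup m i * g i" for i
  proof -
    have "{x. x \<in> diagram l \<and> T x - 1 = i} = {x \<in> diagram l. T x = Suc i}"
      using content_tableaux_bound(1)[OF T M] by fastforce
    then show ?thesis using T by (simp add: content_tableaux_def)
  qed
  ultimately show ?thesis by (simp only:)
qed

lemma keys_bounded:
  obtains M where "Poly_Mapping.keys (m :: nat \<Rightarrow>\<^sub>0 nat) \<subseteq> {..<M}"
  using finite_nat_iff_bounded finite_keys by blast

lemma content_tableaux_mdeg: "content_tableaux l m \<noteq> {} \<Longrightarrow> mdeg m = sum_list l"
proof -
  assume "content_tableaux l m \<noteq> {}"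
  then obtain T where T: "T \<in> content_tableaux l m" by auto
  obtain M where M: "Poly_Mapping.keys m \<subseteq> {..<M}" by (rule keys_bounded)
  show ?thesis
    using sum_content[OF T M, of "\<lambda>_. 1"] mdeg_eq_sum[OF finite_lessThan M] by (simp add: card_diagram)
qed

lemma content_tableaux_eq:
  assumes M: "Poly_Mapping.keys m \<subseteq> {..<M}"
  shows "content_tableaux l m = {T \<in> tableaux M (diagram l). \<forall>i<M. card {x. T x = Suc i} = Poly_Mapping.lookup m i}"
proof (intro set_eqI iffI)
  have eq: "{x. T x = Suc i} = {x \<in> diagram l. T x = Suc i}" if "tableau (diagram l) T" for T i
    using that unfolding tableau_def by (metis (mono_tags, lifting) Zero_not_Suc)
  fix T
  {
    assume T: "T \<in> content_tableaux l m"
    then have t: "tableau (diagram l) T" by (simp add: content_tableaux_def)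
    then have "T x \<le> M" for x
      using content_tableaux_bound(2)[OF T M, of x] unfolding tableau_def by (metis le0)
    with T t show "T \<in> {T \<in> tableaux M (diagram l). \<forall>i<M. card {x. T x = Suc i} = Poly_Mapping.lookup m i}"
      by (simp add: tableaux_def content_tableaux_def eq[OF t])
  }
  {
    assume T: "T \<in> {T \<in> tableaux M (diagram l). \<forall>i<M. card {x. T x = Suc i} = Poly_Mapping.lookup m i}"
    then have t: "tableau (diagram l) T" and le: "\<And>x. T x \<le> M" by (auto simp: tableaux_def)
    have "Poly_Mapping.lookup m i = card {x \<in> diagram l. T x = Suc i}" for i
    proof (cases "i < M")
      case False
      then have "T x \<noteq> Suc i" for x using le[of x] by auto
      moreover have "Poly_Mapping.lookup m i = 0" using M False by (auto simp: in_keys_iff)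
      ultimately show ?thesis by simp
    qed (use T in \<open>simp add: eq[OF t]\<close>)
    with t show "T \<in> content_tableaux l m" by (simp add: content_tableaux_def)
  }
qed

lemma finite_content_tableaux: "finite (content_tableaux l m)"
proof -
  obtain M where M: "Poly_Mapping.keys m \<subseteq> {..<M}" by (rule keys_bounded)
  show ?thesis unfolding content_tableaux_eq[OF M] using finite_tableaux[OF finite_diagram] by simp
qed

lemma card_diagram_row: "card {x \<in> diagram l. fst x = i} = nth_default 0 l i"
proof -
  have "{x \<in> diagram l. fst x = i} = Pair i ` {..<nth_default 0 l i}"
    by (auto simp: diagram_def nth_default_def)
  then show ?thesis by (simp add: card_image inj_on_def)
qed

lemma sum_diagram_rows:
  fixes g :: "nat \<Rightarrow> nat"
  assumes "length l \<le> M"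
  shows "(\<Sum>x\<in>diagram l. g (fst x)) = (\<Sum>i<M. nth_default 0 l i * g i)"
proof -
  have "(\<Sum>i<M. \<Sum>x | x \<in> diagram l \<and> fst x = i. g (fst x)) = (\<Sum>x\<in>diagram l. g (fst x))"
    using assms by (intro sum.group finite_diagram) (auto simp: diagram_def)
  then show ?thesis by (simp add: card_diagram_row flip: card_diagram_row)
qed

lemma tableau_ge_row:
  assumes T: "tableau (diagram l) T" and l: "is_partition l" and "(r, c) \<in> diagram l"
  shows "r \<le> T (r, c) - 1"
proof -
  have "Suc r \<le> T (r, c)" using assms(3)
  proof (induction r)
    case 0
    then show ?case using T unfolding tableau_def by (metis Suc_leI)
  next
    case (Suc r)
    then have mem: "(r, c) \<in> diagram l"
      using down_closed_diagram[OF l] unfolding down_closed_def by (metis le_refl lessI less_imp_le)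
    then have "T (r, c) < T (Suc r, c)" using T Suc.prems unfolding tableau_def by blast
    then show ?case using Suc.IH[OF mem] by simp
  qed
  then show ?thesis by simp
qed

text \<open>Strict columns make each entry minus 1 at least its row index, and for content
  \<open>k\<close> the entries minus 1 sum to the row indices of \<open>k\<close>. Equality of the
  sums would force entry \<open>Suc r\<close> throughout row \<open>r\<close>, so that content and
  shape agree.\<close>

lemma schur_triangular:
  assumes l: "is_partition l" and k: "is_partition k"
    and T: "T \<in> content_tableaux l (Poly_Mapping.nth k)" and "l \<noteq> k"
  shows "(\<Sum>x\<in>diagram l. fst x) < (\<Sum>x\<in>diagram k. fst x)"
proof -
  let ?m = "Poly_Mapping.nth k"
  have t: "tableau (diagram l) T" using T by (simp add: content_tableaux_def)
  have M: "Poly_Mapping.keys ?m \<subseteq> {..<length k}"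
    by (auto simp: in_keys_iff nth_default_def simp del: keys_nth split: if_splits)
  have le: "fst x \<le> T x - 1" if "x \<in> diagram l" for x
    using tableau_ge_row[OF t l, of "fst x" "snd x"] that by simp
  have eq: "(\<Sum>x\<in>diagram l. T x - 1) = (\<Sum>x\<in>diagram k. fst x)"
    using sum_content[OF T M, of "\<lambda>i. i"] sum_diagram_rows[of k "length k" "\<lambda>i. i"] by simp
  have "\<exists>x\<in>diagram l. fst x \<noteq> T x - 1"
  proof (rule ccontr)
    assume "\<not> ?thesis"
    then have "T x = Suc i \<longleftrightarrow> fst x = i" if "x \<in> diagram l" for x i
      using that content_tableaux_bound(1)[OF T M that] by auto
    then have "nth_default 0 l i = nth_default 0 k i" for i
      using T card_diagram_row[of l i] by (simp add: content_tableaux_def cong: conj_cong)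
    then show False using nth_default_inject[OF l k] \<open>l \<noteq> k\<close> by (simp add: fun_eq_iff)
  qed
  then show ?thesis
    unfolding eq[symmetric] using le finite_diagram by (intro sum_strict_mono_ex1) (auto simp: le_less)
qed

lemma schur_basis:
  "inj_on (schur :: _ \<Rightarrow> 'a::field_char_0 mfps) {\<mu>. is_partition \<mu>}"
  "mfps.independent ((schur :: _ \<Rightarrow> 'a mfps) ` {\<mu>. is_partition \<mu>})"
proof -
  let ?f = "\<lambda>l. int (\<Sum>x\<in>diagram l. fst x)"
  have 1: "mcoeff (schur l :: 'a mfps) (Poly_Mapping.nth l) \<noteq> 0" if "l \<in> {\<mu>. is_partition \<mu>}" for l
  proof -
    \<comment> \<open>The filling with \<open>Suc r\<close> in row \<open>r\<close> has its own
      shape as content.\<close>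
    let ?T = "\<lambda>x. if x \<in> diagram l then Suc (fst x) else 0"
    have "{x \<in> diagram l. ?T x = Suc i} = {x \<in> diagram l. fst x = i}" for i by auto
    then have "?T \<in> content_tableaux l (Poly_Mapping.nth l)"
      by (auto simp: content_tableaux_def tableau_def card_diagram_row)
    then have "content_tableaux l (Poly_Mapping.nth l) \<noteq> {}" by blast
    then show ?thesis by (simp add: mcoeff_schur finite_content_tableaux)
  qed
  have 2: "?f l < ?f k" if "l \<in> {\<mu>. is_partition \<mu>}" "k \<in> {\<mu>. is_partition \<mu>}" "l \<noteq> k"
    "mcoeff (schur l :: 'a mfps) (Poly_Mapping.nth k) \<noteq> 0" for l k
  proof -
    have "content_tableaux l (Poly_Mapping.nth k) \<noteq> {}" using that(4) by (auto simp: mcoeff_schur)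
    then show ?thesis using schur_triangular[of l k] that(1-3) by fastforce
  qed
  show "inj_on (schur :: _ \<Rightarrow> 'a mfps) {\<mu>. is_partition \<mu>}"
    by (rule triangular_family(1)[OF 1 2])
  show "mfps.independent ((schur :: _ \<Rightarrow> 'a mfps) ` {\<mu>. is_partition \<mu>})"
    by (rule triangular_family(2)[OF 1 2])
qed

lemma hall_schur:
  fixes f :: "'a::field_char_0 mfps"
  assumes f: "f = (\<Sum>\<mu>\<in>parts n. mscale (c \<mu>) (schur \<mu>))" and l: "l \<in> parts n"
  shows "hall f (schur l) = c l"
proof -
  have ef: "expansion schur f \<nu> = (if \<nu> \<in> parts n then c \<nu> else 0)" for \<nu>
    by (rule expansion_sum[OF schur_basis(2,1) finite_parts parts_subset f])
  have "schur l = (\<Sum>\<mu>\<in>{l}. mscale 1 (schur \<mu> :: 'a mfps))" by simp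
  from expansion_sum[OF schur_basis(2,1) _ _ this] l
  have es: "expansion schur (schur l :: 'a mfps) \<nu> = (if \<nu> = l then 1 else 0)" for \<nu>
    by (simp add: parts_def)
  have "hall f (schur l) = (\<Sum>\<nu>\<in>parts n. expansion schur f \<nu> * expansion schur (schur l) \<nu>)"
    unfolding hall_def by (rule sum.mono_neutral_left[OF finite_parts]) (auto simp: ef)
  also have "\<dots> = c l" using l by (simp add: es ef finite_parts if_distrib sum.delta cong: if_cong)
  finally show ?thesis .
qed


section \<open>From integers to the indeterminate\<close>

lemma poly_at_nat_eqI:
  assumes "\<And>N. poly_at (of_nat N :: rat) p = poly_at (of_nat N) q"
  shows "p = q"
proof (rule ccontr)
  assume "p \<noteq> q"
  then have "finite {x. poly (p - q) x = 0}" by (intro poly_roots_finite) simp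
  moreover have "range (of_nat :: nat \<Rightarrow> rat) \<subseteq> {x. poly (p - q) x = 0}"
    using assms by (auto simp: poly_at_def)
  moreover have "infinite (range (of_nat :: nat \<Rightarrow> rat))"
    by (simp add: finite_image_iff inj_of_nat)
  ultimately show False by (meson finite_subset)
qed

definition gbinomial_poly :: "nat \<Rightarrow> nat \<Rightarrow> rat poly" where
  "gbinomial_poly n k = smult (1 / fact n) (\<Prod>i = 0..<n. [:of_nat k - of_nat i, 1:])"

definition rising_poly :: "nat \<Rightarrow> rat poly" where
  "rising_poly w = smult (1 / fact w) (\<Prod>i = 0..<w. [:of_nat i, 1:])"

lemma poly_at_gbinomial_poly: "poly_at x (gbinomial_poly n k) = (x + of_nat k) gchoose n"
  by (simp add: gbinomial_poly_def poly_at_prod gbinomial_prod_rev of_rat_diff of_rat_divide algebra_simps)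

lemma poly_at_rising_poly: "poly_at x (rising_poly w) = rising_coeff x w"
  by (simp add: rising_poly_def poly_at_prod rising_coeff_def pochhammer_prod of_rat_divide add.commute)

lemma rising_coeff_of_nat: "rising_coeff (of_nat N) w = of_nat ((N + w - 1) choose w)"
\<comment> \<open>If \<open>N + w = 0\<close>, the subtraction is truncated, but the lower index 0
  makes the binomial 1.\<close>
proof (cases "N + w = 0")
  case False
  then obtain s where s: "N + w = Suc s" using not0_implies_Suc by blast
  have "of_nat N + of_nat w = (of_nat s + 1 :: 'a)"
    by (metis s of_nat_add of_nat_Suc add.commute)
  then have "of_nat (N + w - 1) - of_nat w + 1 = (of_nat N :: 'a)"
    by (simp add: s algebra_simps)
  then show ?thesis
    by (simp add: rising_coeff_def binomial_gbinomial gbinomial_pochhammer')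
qed simp

definition ascent_count :: "nat list \<Rightarrow> nat \<Rightarrow> nat" where
  "ascent_count l k = card {xs \<in> standard_orders (diagram l). ascents xs = k}"

text \<open>\<open>cauchy_tableaux\<close> runs over all shapes of size up to \<open>n\<close>; a
  tableau of content \<open>m\<close> has exactly \<open>mdeg m\<close> cells, so only shapes of
  size \<open>n\<close> remain.\<close>

lemma cauchy_partitions:
  assumes m: "mdeg m = n" and n: "n \<ge> 1"
  shows "(\<Sum>l\<in>parts n. (\<Sum>k=0..n-1. ascent_count l k * ((N + k) choose n)) * card (content_tableaux l m)) =
    (\<Prod>i\<in>Poly_Mapping.keys m. (N + Poly_Mapping.lookup m i - 1) choose (Poly_Mapping.lookup m i))"
proof -
  let ?w = "Poly_Mapping.lookup m"
  obtain M where M: "Poly_Mapping.keys m \<subseteq> {..<M}" by (rule keys_bounded)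
  let ?K = "\<lambda>p. {T \<in> tableaux M (cells p). \<forall>i<M. card {x. T x = Suc i} = ?w i}"
  have w: "(\<Sum>i<M. ?w i) = n" using mdeg_eq_sum[OF finite_lessThan M] m by simp
  have c: "card (tableaux N (diagram l)) = (\<Sum>k=0..n-1. ascent_count l k * ((N + k) choose n))" if "l \<in> parts n" for l
  proof -
    have "card (diagram l) = n" "diagram l \<noteq> {}" "down_closed (diagram l)"
      using that n card_diagram[of l] by (auto simp: parts_def down_closed_diagram)
    then show ?thesis using card_tableaux_by_ascents[OF finite_diagram, of l N] by (simp add: ascent_count_def)
  qed
  have sz: "psize p = n" if p: "p \<in> partition_funs" "psize p \<le> n" "?K p \<noteq> {}" for p
  proof -
    obtain l where l: "l \<in> parts (psize p)" "p = nth_default 0 l"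
      using bij_betw_imp_surj_on[OF bij_betw_nth_default, of "psize p"] p(1) by blast
    then have "content_tableaux l m \<noteq> {}" using p(3) by (simp add: content_tableaux_eq[OF M] cells_nth_default)
    then show ?thesis using content_tableaux_mdeg[of l m] l m by (simp add: parts_def)
  qed
  have z: "card (?K p) = 0" if "p \<in> partition_funs" "psize p \<le> n" "psize p \<noteq> n" for p
  proof -
    have "?K p = {}" by (rule ccontr) (use sz[OF that(1,2)] that(3) in blast)
    then show ?thesis by (simp only: card.empty)
  qed
  have "(\<Prod>i\<in>Poly_Mapping.keys m. (N + ?w i - 1) choose (?w i)) = (\<Prod>i<M. (N + ?w i - 1) choose (?w i))"
    using M by (intro prod.mono_neutral_left) (auto simp: in_keys_iff)
  also have "\<dots> = (\<Sum>p | p \<in> partition_funs \<and> psize p \<le> n. card (tableaux N (cells p)) * card (?K p))"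
    by (rule cauchy_tableaux[symmetric]) (simp add: w)
  also have "\<dots> = (\<Sum>p | p \<in> partition_funs \<and> psize p = n. card (tableaux N (cells p)) * card (?K p))"
    using z finite_partition_funs_psize_le[of n] by (intro sum.mono_neutral_right) auto
  also have "\<dots> = (\<Sum>l\<in>parts n. card (tableaux N (diagram l)) * card (content_tableaux l m))"
    unfolding content_tableaux_eq[OF M] cells_nth_default[symmetric]
    by (rule sum.reindex_bij_betw[OF bij_betw_nth_default, symmetric])
  also have "\<dots> = (\<Sum>l\<in>parts n. (\<Sum>k=0..n-1. ascent_count l k * ((N + k) choose n)) * card (content_tableaux l m))"
    by (intro sum.cong) (auto simp: c)
  finally show ?thesis by simp
qed

lemma row_series_schur_expansion:
  fixes x :: "'a::field_char_0"
  assumes n: "n \<ge> 1"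
  shows "row_series x n = (\<Sum>l\<in>parts n. mscale
    (\<Sum>k=0..n-1. of_nat (ascent_count l k) * ((x + of_nat k) gchoose n)) (schur l))"
proof (rule mfps_eqI)
  fix m
  show "mcoeff (row_series x n) m = mcoeff (\<Sum>l\<in>parts n. mscale
    (\<Sum>k=0..n-1. of_nat (ascent_count l k) * ((x + of_nat k) gchoose n)) (schur l)) m"
  proof (cases "mdeg m = n")
    case False
    then have "content_tableaux l m = {}" if "l \<in> parts n" for l
      using that content_tableaux_mdeg[of l m] by (auto simp: parts_def)
    then show ?thesis using False by (simp add: row_series_def mcoeff_schur)
  next
    case True
    \<comment> \<open>\<open>P\<close> and \<open>Q\<close> have rational coefficients and do not
      involve \<open>x\<close>: they are compared at the naturals inside \<open>rat\<close> and
      evaluated at \<open>x\<close> afterwards.\<close>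
    define P where "P = (\<Sum>l\<in>parts n. smult (of_nat (card (content_tableaux l m)))
        (\<Sum>k=0..n-1. smult (of_nat (ascent_count l k)) (gbinomial_poly n k)))"
    define Q where "Q = (\<Prod>i\<in>Poly_Mapping.keys m. rising_poly (Poly_Mapping.lookup m i))"
    have P: "poly_at y P = (\<Sum>l\<in>parts n. (\<Sum>k=0..n-1. of_nat (ascent_count l k) * ((y + of_nat k) gchoose n)) *
        of_nat (card (content_tableaux l m)))" for y :: "'b::field_char_0"
      by (simp add: P_def poly_at_sum poly_at_gbinomial_poly mult.commute)
    have Q: "poly_at y Q = (\<Prod>i\<in>Poly_Mapping.keys m. rising_coeff y (Poly_Mapping.lookup m i))" for y :: "'b::field_char_0"
      by (simp add: Q_def poly_at_prod poly_at_rising_poly)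
    have "P = Q"
    proof (rule poly_at_nat_eqI)
      fix N
      have "poly_at (of_nat N :: rat) P = of_nat (\<Sum>l\<in>parts n.
          (\<Sum>k=0..n-1. ascent_count l k * ((N + k) choose n)) * card (content_tableaux l m))"
        unfolding P by (simp add: binomial_gbinomial)
      also have "\<dots> = poly_at (of_nat N) Q"
        unfolding cauchy_partitions[OF True n] Q by (simp add: rising_coeff_of_nat)
      finally show "poly_at (of_nat N :: rat) P = poly_at (of_nat N) Q" .
    qed
    then show ?thesis
      using P[of x] Q[of x] True by (simp add: row_series_def mcoeff_schur)
  qed
qed

text \<open>A rational polynomial vanishing at \<open>alpha\<close> is zero, so the relation may be
  evaluated at the natural number \<open>n - k\<close>. There the terms \<open>j < k\<close> vanish
  because the upper index is below \<open>n\<close>, those with \<open>j > k\<close> by descending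
  induction, and the term \<open>k\<close> has binomial 1.\<close>

lemma gbinomial_shift_independent:
  assumes "(\<Sum>k=0..n-1. of_rat (d k) * ((alpha + of_nat k) gchoose n)) = 0" and n: "n \<ge> 1" and "k \<le> n - 1"
  shows "d k = 0"
proof -
  define P where "P = (\<Sum>k=0..n-1. smult (d k) (gbinomial_poly n k))"
  have P: "poly_at y P = (\<Sum>k=0..n-1. of_rat (d k) * ((y + of_nat k) gchoose n))" for y :: "'b::field_char_0"
    by (simp add: P_def poly_at_sum poly_at_gbinomial_poly)
  have "to_fract P = 0" using assms(1) P[of alpha] by (simp add: to_fract_eq_poly_at)
  then have "P = 0" by simp
  then have eval: "(\<Sum>k=0..n-1. d k * of_nat ((N + k) choose n)) = 0" for N
    using P[of "of_nat N :: rat"] by (simp add: binomial_gbinomial)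
  show "d k = 0" using \<open>k \<le> n - 1\<close>
  proof (induction "n - 1 - k" arbitrary: k rule: less_induct)
    case less
    have "0 = (\<Sum>j=0..n-1. d j * of_nat ((n - k + j) choose n))" by (rule eval[symmetric])
    also have "\<dots> = (\<Sum>j\<in>{k}. d j * of_nat ((n - k + j) choose n))"
    proof (rule sum.mono_neutral_right)
      show "\<forall>j\<in>{0..n - 1} - {k}. d j * of_nat ((n - k + j) choose n) = 0"
      proof
        fix j assume j: "j \<in> {0..n - 1} - {k}"
        show "d j * of_nat ((n - k + j) choose n) = 0"
        proof (cases "j < k")
          case True
          then have "n - k + j < n" using less.prems n by linarith
          then show ?thesis by (simp add: binomial_eq_0)
        next
          case False
          then have "n - 1 - j < n - 1 - k" using j less.prems by auto
          then show ?thesis using less.hyps[of j] j by simp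
        qed
      qed
    qed (use less.prems in auto)
    finally show "d k = 0" using less.prems n by simp
  qed
qed

lemma QYT_conjugate:
  assumes l: "is_partition l" and n: "sum_list l \<ge> 1"
  shows "QYT (k + 1) (conjugate l) = ascent_count l k"
proof -
  let ?D = "diagram l" and ?D' = "prod.swap ` diagram l"
  have ne: "?D \<noteq> {}" using n card_diagram[of l] by (metis card.empty not_one_le_zero)
  have dc: "down_closed ?D" by (rule down_closed_diagram[OF l])
  then have dc': "down_closed ?D'"
    unfolding down_closed_def by (force simp: image_iff)
  have "card ?D' = card ?D" by (rule card_image) simp
  then have "QYT (k + 1) (conjugate l) = card {xs \<in> standard_orders ?D'. card ?D = Suc k + ascents xs}"
    using QYT_eq_card_standard_orders[of "conjugate l" "k + 1"] ne dc'
    by (simp add: diagram_conjugate[OF l] finite_diagram)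
  also have "\<dots> = ascent_count l k"
    unfolding ascent_count_def by (rule card_standard_orders_swap[OF dc finite_diagram ne])
  finally show ?thesis .
qed

theorem theorem3p4:
  fixes J :: "nat list \<Rightarrow> ratfun mfps" and n :: nat and l :: "nat list"
  assumes "jack_family J"
    and "n \<ge> 1"
    and "is_partition l" and "sum_list l = n"
  shows "(\<exists>a :: nat \<Rightarrow> rat. hall (jack_tilde J [n]) (schur l) =
             (\<Sum>k=0..n-1. of_rat (a k) * ((alpha + of_nat k) gchoose n)))
       \<and> (\<forall>a :: nat \<Rightarrow> rat. hall (jack_tilde J [n]) (schur l) =
             (\<Sum>k=0..n-1. of_rat (a k) * ((alpha + of_nat k) gchoose n)) \<longrightarrow>
           (\<forall>k. k \<le> n - 1 \<longrightarrow> a k = fact n * of_nat (QYT (k + 1) (conjugate l))))"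
proof -
  have q: "QYT (k + 1) (conjugate l) = ascent_count l k" for k
    using assms by (intro QYT_conjugate) simp_all
  define b where "b k = (fact n * of_nat (QYT (k + 1) (conjugate l)) :: rat)" for k
  have "jack_tilde J [n] = (\<Sum>\<mu>\<in>parts n. mscale (fact n *
      (\<Sum>k=0..n-1. of_nat (ascent_count \<mu> k) * ((alpha + of_nat k) gchoose n))) (schur \<mu>))"
    unfolding jack_tilde_one_row[OF assms(1,2)] row_series_schur_expansion[OF assms(2)]
    by (simp add: mfps.scale_sum_right)
  from hall_schur[OF this, of l] assms(3,4)
  have "hall (jack_tilde J [n]) (schur l) =
      fact n * (\<Sum>k=0..n-1. of_nat (ascent_count l k) * ((alpha + of_nat k) gchoose n))"
    by (simp add: parts_def)
  also have "\<dots> = (\<Sum>k=0..n-1. of_rat (b k) * ((alpha + of_nat k) gchoose n))"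
    unfolding b_def q by (simp add: sum_distrib_left of_rat_mult mult.assoc)
  finally have eq: "hall (jack_tilde J [n]) (schur l) =
      (\<Sum>k=0..n-1. of_rat (b k) * ((alpha + of_nat k) gchoose n))" .
  have uniq: "a k = b k"
    if a: "hall (jack_tilde J [n]) (schur l) = (\<Sum>k=0..n-1. of_rat (a k) * ((alpha + of_nat k) gchoose n))"
      and k: "k \<le> n - 1" for a k
  proof -
    have "(\<Sum>k=0..n-1. of_rat (a k - b k) * ((alpha + of_nat k) gchoose n)) = 0"
      using a eq by (simp add: of_rat_diff left_diff_distrib sum_subtractf)
    from gbinomial_shift_independent[OF this assms(2) k] show ?thesis by simp
  qed
  show ?thesis
  proof (intro conjI exI[of _ b] allI impI)
    show "hall (jack_tilde J [n]) (schur l) =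
        (\<Sum>k=0..n-1. of_rat (b k) * ((alpha + of_nat k) gchoose n))" by (rule eq)
    fix a k
    assume "hall (jack_tilde J [n]) (schur l) = (\<Sum>k=0..n-1. of_rat (a k) * ((alpha + of_nat k) gchoose n))"
      and "k \<le> n - 1"
    then show "a k = fact n * of_nat (QYT (k + 1) (conjugate l))"
      unfolding b_def[symmetric] by (rule uniq)
  qed
qed

end
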